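(* Let $\mathbf{G}\rightrightarrows\Omega$ be a discrete countable groupoid. The lattice of propositions $\mathcal{P}(\mathbf{G})$ of the groupoid is Boolean if and only if the groupoid $\mathbf{G}$ is totally disconnected, its isotropy groups are Abelian, and its von Neumann algebra $\mathcal{V}(\mathbf{G})$ is Abelian.
   Context: A groupoid $\mathbf{G}\rightrightarrows\Omega$ has set of objects ("outcomes") $\Omega$, elements ("transitions") $\alpha\colon x\to y$ with source $s(\alpha)=x$ and target $t(\alpha)=y$, composition $\alpha\circ\beta$ defined when $s(\alpha)=t(\beta)$, units $1_x$ ($x\in\Omega$) and inverses $\alpha^{-1}$. It is discrete countable if $\mathbf{G}$ is a countable set with no further (topological) structure. The isotropy group at $x$ is $\mathbf{G}_x=\{\alpha\in\mathbf{G}: s(\alpha)=t(\alpha)=x\}$. $\mathbf{G}$ is totally disconnected if there is no transition $\alpha\colon x\to y$ with $x\neq y$, i.e. $\mathbf{G}=\bigsqcup_{x\in\Omega}\mathbf{G}_x$. The algebra of transitions $\mathbb{C}[\mathbf{G}]$ is the space of finite formal linear combinations $A=\sum_{\alpha\in\mathbf{G}}A_\alpha\,\alpha$, $A_\alpha\in\mathbb{C}$, with product $AB=\sum_{s(\alpha)=t(\beta)}A_\alpha B_\beta\,\alpha\circ\beta$ and involution $A^*=\sum_\alpha\overline{A_\alpha}\,\alpha^{-1}$. Let $\mathcal{L}^2(\mathbf{G})$ be the Hilbert space of square summable functions on $\mathbf{G}$ (counting measure). The left-regular representation $\lambda\colon\mathbb{C}[\mathbf{G}]\to\mathcal{B}(\mathcal{L}^2(\mathbf{G}))$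 is $(\lambda(A)\Psi)(\beta)=\sum_{\alpha\in\mathbf{G},\,t(\alpha)=t(\beta)}A_\alpha\,\Psi(\alpha^{-1}\circ\beta)$. The von Neumann algebra of the groupoid is the double commutant $\mathcal{V}(\mathbf{G}):=(\lambda(\mathbb{C}[\mathbf{G}]))''\subset\mathcal{B}(\mathcal{L}^2(\mathbf{G}))$, with identity $\mathbf{1}$. A proposition is an element $P\in\mathcal{V}(\mathbf{G})$ with $P=P^*=P^2$. The set $\mathcal{P}(\mathbf{G})$ of propositions is partially ordered by $P\subseteq Q\Leftrightarrow PQ=P$; it is an orthocomplemented lattice with $P'=\mathbf{1}-P$, greatest lower bound $P\cap Q=\text{s-}\lim_{n\to\infty}(PQ)^n$ (strong operator limit) and least upper bound $P\cup Q=(P'\cap Q')'$. The lattice is Boolean if it satisfies the distributive laws $P\cup(Q\cap R)=(P\cup Q)\cap(P\cup R)$ and $P\cap(Q\cup R)=(P\cap Q)\cup(P\cap R)$ for all $P,Q,R\in\mathcal{P}(\mathbf{G})$. *)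

theory Defs
  imports "HOL-Analysis.Analysis" "HOL-Algebra.Group"
begin

section \<open>Groupoids\<close>

record ('o, 'g) groupoid =
  objs :: "'o set"
  arrs :: "'g set"
  src :: "'g \<Rightarrow> 'o"
  tgt :: "'g \<Rightarrow> 'o"
  comp_arr :: "'g \<Rightarrow> 'g \<Rightarrow> 'g"
  unit_arr :: "'o \<Rightarrow> 'g"
  inv_arr :: "'g \<Rightarrow> 'g"

text \<open>Composition is written in the order of functions: \<open>comp_arr G \<alpha> \<beta>\<close> is
  meaningful only if \<open>src G \<alpha> = tgt G \<beta>\<close>; nothing is assumed about its value otherwise.\<close>

locale groupoid =
  fixes G :: "('o, 'g) groupoid"
  assumes src_in: "\<alpha> \<in> arrs G \<Longrightarrow> src G \<alpha> \<in> objs G"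
    and tgt_in: "\<alpha> \<in> arrs G \<Longrightarrow> tgt G \<alpha> \<in> objs G"
    and comp_in: "\<lbrakk>\<alpha> \<in> arrs G; \<beta> \<in> arrs G; src G \<alpha> = tgt G \<beta>\<rbrakk> \<Longrightarrow> comp_arr G \<alpha> \<beta> \<in> arrs G"
    and src_comp: "\<lbrakk>\<alpha> \<in> arrs G; \<beta> \<in> arrs G; src G \<alpha> = tgt G \<beta>\<rbrakk> \<Longrightarrow> src G (comp_arr G \<alpha> \<beta>) = src G \<beta>"
    and tgt_comp: "\<lbrakk>\<alpha> \<in> arrs G; \<beta> \<in> arrs G; src G \<alpha> = tgt G \<beta>\<rbrakk> \<Longrightarrow> tgt G (comp_arr G \<alpha> \<beta>) = tgt G \<alpha>"
    and comp_assoc: "\<lbrakk>\<alpha> \<in> arrs G; \<beta> \<in> arrs G; \<gamma> \<in> arrs G; src G \<alpha> = tgt G \<beta>; src G \<beta> = tgt G \<gamma>\<rbrakk>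
      \<Longrightarrow> comp_arr G (comp_arr G \<alpha> \<beta>) \<gamma> = comp_arr G \<alpha> (comp_arr G \<beta> \<gamma>)"
    and unit_in: "x \<in> objs G \<Longrightarrow> unit_arr G x \<in> arrs G"
    and src_unit: "x \<in> objs G \<Longrightarrow> src G (unit_arr G x) = x"
    and tgt_unit: "x \<in> objs G \<Longrightarrow> tgt G (unit_arr G x) = x"
    and comp_unit_right: "\<alpha> \<in> arrs G \<Longrightarrow> comp_arr G \<alpha> (unit_arr G (src G \<alpha>)) = \<alpha>"
    and comp_unit_left: "\<alpha> \<in> arrs G \<Longrightarrow> comp_arr G (unit_arr G (tgt G \<alpha>)) \<alpha> = \<alpha>"
    and inv_in: "\<alpha> \<in> arrs G \<Longrightarrow> inv_arr G \<alpha> \<in> arrs G"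
    and src_inv: "\<alpha> \<in> arrs G \<Longrightarrow> src G (inv_arr G \<alpha>) = tgt G \<alpha>"
    and tgt_inv: "\<alpha> \<in> arrs G \<Longrightarrow> tgt G (inv_arr G \<alpha>) = src G \<alpha>"
    and comp_inv_left: "\<alpha> \<in> arrs G \<Longrightarrow> comp_arr G (inv_arr G \<alpha>) \<alpha> = unit_arr G (src G \<alpha>)"
    and comp_inv_right: "\<alpha> \<in> arrs G \<Longrightarrow> comp_arr G \<alpha> (inv_arr G \<alpha>) = unit_arr G (tgt G \<alpha>)"

definition discrete_countable_groupoid :: "('o, 'g) groupoid \<Rightarrow> bool" where
  "discrete_countable_groupoid G \<longleftrightarrow> groupoid G \<and> countable (arrs G)"

definition isotropy_group :: "('o, 'g) groupoid \<Rightarrow> 'o \<Rightarrow> 'g monoid" where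
  "isotropy_group G x =
    \<lparr>carrier = {\<alpha> \<in> arrs G. src G \<alpha> = x \<and> tgt G \<alpha> = x}, mult = comp_arr G, one = unit_arr G x\<rparr>"

definition totally_disconnected :: "('o, 'g) groupoid \<Rightarrow> bool" where
  "totally_disconnected G \<longleftrightarrow> \<not> (\<exists>\<alpha> \<in> arrs G. src G \<alpha> \<noteq> tgt G \<alpha>)"


section \<open>The Hilbert space of square summable functions and its bounded operators\<close>

text \<open>A function on the set of arrows is represented by a function on the whole type that
  vanishes outside that set, and an operator on the Hilbert space by a map on all functions
  that sends everything outside the Hilbert space to the zero function.
  Equality of functions and of operators is then equality in HOL, and the
  composition of operators is \<open>(\<circ>)\<close>.\<close>

definition L2 :: "('o, 'g) groupoid \<Rightarrow> ('g \<Rightarrow> complex) set" where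
  "L2 G = {\<psi>. (\<forall>\<alpha>. \<alpha> \<notin> arrs G \<longrightarrow> \<psi> \<alpha> = 0) \<and> (\<lambda>\<alpha>. (cmod (\<psi> \<alpha>))\<^sup>2) summable_on arrs G}"

definition L2_inner :: "('o, 'g) groupoid \<Rightarrow> ('g \<Rightarrow> complex) \<Rightarrow> ('g \<Rightarrow> complex) \<Rightarrow> complex" where
  "L2_inner G \<psi> \<phi> = (\<Sum>\<^sub>\<infinity>\<alpha>\<in>arrs G. cnj (\<psi> \<alpha>) * \<phi> \<alpha>)"

definition L2_norm :: "('o, 'g) groupoid \<Rightarrow> ('g \<Rightarrow> complex) \<Rightarrow> real" where
  "L2_norm G \<psi> = sqrt (\<Sum>\<^sub>\<infinity>\<alpha>\<in>arrs G. (cmod (\<psi> \<alpha>))\<^sup>2)"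

type_synonym 'g operator = "('g \<Rightarrow> complex) \<Rightarrow> ('g \<Rightarrow> complex)"

definition bounded_operators :: "('o, 'g) groupoid \<Rightarrow> 'g operator set" where
  "bounded_operators G = {T.
     (\<forall>\<psi> \<in> L2 G. T \<psi> \<in> L2 G) \<and>
     (\<forall>\<psi> \<in> L2 G. \<forall>\<phi> \<in> L2 G. \<forall>a b.
        T (\<lambda>\<alpha>. a * \<psi> \<alpha> + b * \<phi> \<alpha>) = (\<lambda>\<alpha>. a * T \<psi> \<alpha> + b * T \<phi> \<alpha>)) \<and>
     (\<exists>K. \<forall>\<psi> \<in> L2 G. L2_norm G (T \<psi>) \<le> K * L2_norm G \<psi>) \<and>
     (\<forall>\<psi>. \<psi> \<notin> L2 G \<longrightarrow> T \<psi> = (\<lambda>\<alpha>. 0))}"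

definition is_adjoint :: "('o, 'g) groupoid \<Rightarrow> 'g operator \<Rightarrow> 'g operator \<Rightarrow> bool" where
  "is_adjoint G T S \<longleftrightarrow> (\<forall>\<psi> \<in> L2 G. \<forall>\<phi> \<in> L2 G. L2_inner G (T \<psi>) \<phi> = L2_inner G \<psi> (S \<phi>))"

definition strong_limit :: "('o, 'g) groupoid \<Rightarrow> (nat \<Rightarrow> 'g operator) \<Rightarrow> 'g operator \<Rightarrow> bool" where
  "strong_limit G T R \<longleftrightarrow> R \<in> bounded_operators G \<and>
     (\<forall>\<psi> \<in> L2 G. (\<lambda>n. L2_norm G (\<lambda>\<alpha>. T n \<psi> \<alpha> - R \<psi> \<alpha>)) \<longlonglongrightarrow> 0)"

definition commutant :: "('o, 'g) groupoid \<Rightarrow> 'g operator set \<Rightarrow> 'g operator set" where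
  "commutant G S = {T \<in> bounded_operators G. \<forall>A \<in> S. T \<circ> A = A \<circ> T}"


section \<open>The von Neumann algebra of a groupoid\<close>

definition groupoid_algebra :: "('o, 'g) groupoid \<Rightarrow> ('g \<Rightarrow> complex) set" where
  "groupoid_algebra G = {A. (\<forall>\<alpha>. \<alpha> \<notin> arrs G \<longrightarrow> A \<alpha> = 0) \<and> finite {\<alpha>. A \<alpha> \<noteq> 0}}"

text \<open>The summation is restricted to the support of \<open>A\<close>, so that it is a finite sum.\<close>

definition left_regular :: "('o, 'g) groupoid \<Rightarrow> ('g \<Rightarrow> complex) \<Rightarrow> 'g operator" where
  "left_regular G A \<psi> = (\<lambda>\<beta>. if \<psi> \<in> L2 G \<and> \<beta> \<in> arrs G
     then \<Sum>\<alpha> | \<alpha> \<in> arrs G \<and> A \<alpha> \<noteq> 0 \<and> tgt G \<alpha> = tgt G \<beta>. A \<alpha> * \<psi> (comp_arr G (inv_arr G \<alpha>) \<beta>)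
     else 0)"

definition vN_algebra :: "('o, 'g) groupoid \<Rightarrow> 'g operator set" where
  "vN_algebra G = commutant G (commutant G (left_regular G ` groupoid_algebra G))"

definition abelian_algebra :: "'g operator set \<Rightarrow> bool" where
  "abelian_algebra N \<longleftrightarrow> (\<forall>A \<in> N. \<forall>B \<in> N. A \<circ> B = B \<circ> A)"


section \<open>The lattice of propositions\<close>

definition propositions :: "('o, 'g) groupoid \<Rightarrow> 'g operator set" where
  "propositions G = {P \<in> vN_algebra G. is_adjoint G P P \<and> P \<circ> P = P}"

definition prop_compl :: "('o, 'g) groupoid \<Rightarrow> 'g operator \<Rightarrow> 'g operator" where
  "prop_compl G P \<psi> = (if \<psi> \<in> L2 G then (\<lambda>\<alpha>. \<psi> \<alpha> - P \<psi> \<alpha>) else (\<lambda>\<alpha>. 0))"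

text \<open>For orthogonal projections \<open>P\<close> and \<open>Q\<close> the strong limit exists (von Neumann's alternating
  projections); it is the greatest lower bound for the order \<open>P \<circ> Q = P\<close>.\<close>

definition prop_meet :: "('o, 'g) groupoid \<Rightarrow> 'g operator \<Rightarrow> 'g operator \<Rightarrow> 'g operator" where
  "prop_meet G P Q = (THE R. strong_limit G (\<lambda>n. (P \<circ> Q) ^^ n) R)"

definition prop_join :: "('o, 'g) groupoid \<Rightarrow> 'g operator \<Rightarrow> 'g operator \<Rightarrow> 'g operator" where
  "prop_join G P Q = prop_compl G (prop_meet G (prop_compl G P) (prop_compl G Q))"

definition boolean_propositions :: "('o, 'g) groupoid \<Rightarrow> bool" where
  "boolean_propositions G \<longleftrightarrow>
    (\<forall>P \<in> propositions G. \<forall>Q \<in> propositions G. \<forall>R \<in> propositions G.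
       prop_join G P (prop_meet G Q R) = prop_meet G (prop_join G P Q) (prop_join G P R) \<and>
       prop_meet G P (prop_join G Q R) = prop_join G (prop_meet G P Q) (prop_meet G P R))"

end

theory Submission
  imports Defs "HOL-Library.Function_Algebras" "HOL-Algebra.Multiplicative_Group"
    "HOL-Real_Asymp.Real_Asymp"
begin

text \<open>If the von Neumann algebra is Abelian, its projections commute, meets are products and the
  distributive laws are polynomial identities. Conversely, let the lattice be Boolean. The law
  \<open>P = (P \<inter> Q) \<union> (P \<inter> Q')\<close> makes any two projections \<open>P\<close>, \<open>Q\<close> commute. If all projections commute,
  each of them is central, because a nonzero corner \<open>(1 - P) X P\<close> would give a projection not
  commuting with \<open>P\<close>. Centrality of the unit \<open>1\<^sub>x\<close> excludes transitions between different outcomes.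
  For an isotropy element \<open>a\<close>, the von Neumann algebra of the cyclic group generated by \<open>a\<close> contains a
  projection whose Fourier coefficient at \<open>a\<close> differs from all others; as it commutes with
  every \<open>b\<close> in the isotropy group, \<open>a\<close> is fixed by conjugation with \<open>b\<close>. So the algebra of transitions
  is commutative, and then so is its bicommutant.\<close>

section \<open>Square summable functions\<close>

text \<open>Two constructions supply the projections, both without the spectral theorem. Strong
  limits of powers of \<open>C \<circ> B\<close>, with \<open>B\<close> a contraction and
  \<open>C\<close> its adjoint, give meets (von Neumann's alternating projections) and projections
  onto kernels. Square summable kernels that reproduce themselves give the projections attached to
  isotropy elements. Elements of infinite order force the second construction: the finitely
  supported algebra of the integers consists of Laurent polynomials, whose only projections are 0
  and 1, so an infinite series is required. The coefficients of the indicator of a half circle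
  serve: \<open>1/2\<close> at 0 and a fixed multiple of \<open>1/n\<close> at odd \<open>n\<close>,
  hence pairwise different at odd \<open>n\<close>. This series is not absolutely summable, so the
  operator is neither the image of an element of the algebra of transitions nor bounded for a
  trivial reason. Boundedness comes from the reproducing identity, and membership in the double
  commutant is tested on basis vectors. For finite order, a character projection of the cyclic group
  does the same job.\<close>

lemma L2_outside: "\<psi> \<in> L2 G \<Longrightarrow> \<alpha> \<notin> arrs G \<Longrightarrow> \<psi> \<alpha> = 0"
  by (simp add: L2_def)

lemma L2_summable: "\<psi> \<in> L2 G \<Longrightarrow> (\<lambda>\<alpha>. (cmod (\<psi> \<alpha>))\<^sup>2) summable_on arrs G"
  by (simp add: L2_def)

lemma L2_norm_nonneg [simp]: "0 \<le> L2_norm G \<psi>"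
  by (simp add: L2_norm_def infsum_nonneg)

lemma L2_norm_squared: "(L2_norm G \<psi>)\<^sup>2 = (\<Sum>\<^sub>\<infinity>\<alpha>\<in>arrs G. (cmod (\<psi> \<alpha>))\<^sup>2)"
  by (simp add: L2_norm_def infsum_nonneg)

lemma L2_finite_sum_le:
  assumes "\<psi> \<in> L2 G" "finite F" "F \<subseteq> arrs G"
  shows "(\<Sum>\<alpha>\<in>F. (cmod (\<psi> \<alpha>))\<^sup>2) \<le> (L2_norm G \<psi>)\<^sup>2"
  unfolding L2_norm_squared using assms
  by (intro finite_sum_le_infsum) (auto simp: L2_summable)

text \<open>Operators given by pointwise formulas, such as translations and kernel operators, get
  both membership in \<open>L2 G\<close> and their norm bound from one estimate on finite
  sums.\<close>

lemma L2_boundI: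
  assumes "\<And>\<alpha>. \<alpha> \<notin> arrs G \<Longrightarrow> \<psi> \<alpha> = 0" "0 \<le> c"
    and le: "\<And>F. finite F \<Longrightarrow> F \<subseteq> arrs G \<Longrightarrow> (\<Sum>\<alpha>\<in>F. (cmod (\<psi> \<alpha>))\<^sup>2) \<le> c\<^sup>2"
  shows "\<psi> \<in> L2 G" "L2_norm G \<psi> \<le> c"
proof -
  have s: "(\<lambda>\<alpha>. (cmod (\<psi> \<alpha>))\<^sup>2) summable_on arrs G"
    by (rule nonneg_bdd_above_summable_on) (auto intro!: bdd_aboveI[of _ "c\<^sup>2"] le)
  then show "\<psi> \<in> L2 G" using assms by (simp add: L2_def)
  have "(L2_norm G \<psi>)\<^sup>2 \<le> c\<^sup>2"
    unfolding L2_norm_squared by (rule infsum_le_finite_sums[OF s]) (use le in auto)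
  then show "L2_norm G \<psi> \<le> c" using \<open>0 \<le> c\<close> by (rule power2_le_imp_le)
qed

lemma L2_point_le:
  assumes "\<psi> \<in> L2 G" shows "cmod (\<psi> \<alpha>) \<le> L2_norm G \<psi>"
proof (cases "\<alpha> \<in> arrs G")
  case True
  then have "(cmod (\<psi> \<alpha>))\<^sup>2 \<le> (L2_norm G \<psi>)\<^sup>2"
    using L2_finite_sum_le[OF assms, of "{\<alpha>}"] by simp
  then show ?thesis by (rule power2_le_imp_le) simp
qed (simp add: L2_outside[OF assms])

lemma L2_sum_abs_le:
  assumes "\<psi> \<in> L2 G" "\<phi> \<in> L2 G" "finite F" "F \<subseteq> arrs G"
  shows "(\<Sum>\<alpha>\<in>F. cmod (\<psi> \<alpha>) * cmod (\<phi> \<alpha>)) \<le> L2_norm G \<psi> * L2_norm G \<phi>"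
proof -
  have le: "L2_set (\<lambda>\<alpha>. cmod (\<xi> \<alpha>)) F \<le> L2_norm G \<xi>" if "\<xi> \<in> L2 G" for \<xi>
    unfolding L2_set_def
    by (rule real_le_lsqrt) (auto simp: sum_nonneg L2_finite_sum_le[OF that assms(3,4)])
  have "(\<Sum>\<alpha>\<in>F. cmod (\<psi> \<alpha>) * cmod (\<phi> \<alpha>)) = (\<Sum>\<alpha>\<in>F. \<bar>cmod (\<psi> \<alpha>)\<bar> * \<bar>cmod (\<phi> \<alpha>)\<bar>)"
    by simp
  also have "\<dots> \<le> L2_set (\<lambda>\<alpha>. cmod (\<psi> \<alpha>)) F * L2_set (\<lambda>\<alpha>. cmod (\<phi> \<alpha>)) F"
    by (rule L2_set_mult_ineq)
  also have "\<dots> \<le> L2_norm G \<psi> * L2_norm G \<phi>"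
    by (intro mult_mono le assms) auto
  finally show ?thesis .
qed

lemma L2_abs_summable_mult:
  assumes "\<psi> \<in> L2 G" "\<phi> \<in> L2 G"
  shows "(\<lambda>\<alpha>. cmod (\<psi> \<alpha>) * cmod (\<phi> \<alpha>)) summable_on arrs G"
  by (rule nonneg_bdd_above_summable_on)
     (auto intro!: bdd_aboveI[of _ "L2_norm G \<psi> * L2_norm G \<phi>"] L2_sum_abs_le assms)

lemma L2_summable_mult:
  assumes "\<psi> \<in> L2 G" "\<phi> \<in> L2 G"
  shows "(\<lambda>\<alpha>. \<psi> \<alpha> * \<phi> \<alpha>) summable_on arrs G"
    "(\<lambda>\<alpha>. cnj (\<psi> \<alpha>) * \<phi> \<alpha>) summable_on arrs G"
  by (rule abs_summable_summable, simp add: norm_mult L2_abs_summable_mult assms)+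

lemma L2_inner_bound:
  assumes "\<psi> \<in> L2 G" "\<phi> \<in> L2 G"
  shows "cmod (L2_inner G \<psi> \<phi>) \<le> L2_norm G \<psi> * L2_norm G \<phi>"
proof -
  have s: "(\<lambda>\<alpha>. cmod (cnj (\<psi> \<alpha>) * \<phi> \<alpha>)) summable_on arrs G"
    using L2_abs_summable_mult[OF assms] by (simp add: norm_mult)
  have "cmod (L2_inner G \<psi> \<phi>) \<le> (\<Sum>\<^sub>\<infinity>\<alpha>\<in>arrs G. cmod (cnj (\<psi> \<alpha>) * \<phi> \<alpha>))"
    unfolding L2_inner_def by (rule norm_infsum_bound[OF s])
  also have "\<dots> \<le> L2_norm G \<psi> * L2_norm G \<phi>"
    by (rule infsum_le_finite_sums[OF s])
       (auto simp: norm_mult intro!: L2_sum_abs_le assms)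
  finally show ?thesis .
qed

lemma L2_zero [simp, intro]: "0 \<in> L2 G" "(\<lambda>\<alpha>. 0) \<in> L2 G"
  by (simp_all add: L2_def)

lemma L2_norm_zero [simp]: "L2_norm G 0 = 0" "L2_norm G (\<lambda>\<alpha>. 0) = 0"
  by (simp_all add: L2_norm_def)

lemma L2_scale [simp, intro]: "\<psi> \<in> L2 G \<Longrightarrow> (\<lambda>\<alpha>. c * \<psi> \<alpha>) \<in> L2 G"
  by (auto simp: L2_def norm_mult power_mult_distrib intro: summable_on_cmult_right)

lemma L2_norm_scale [simp]: "L2_norm G (\<lambda>\<alpha>. c * \<psi> \<alpha>) = cmod c * L2_norm G \<psi>"
  by (simp add: L2_norm_def norm_mult power_mult_distrib infsum_cmult_right' real_sqrt_mult)

lemma L2_add [simp, intro]: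
  assumes "\<psi> \<in> L2 G" "\<phi> \<in> L2 G" shows "\<psi> + \<phi> \<in> L2 G"
proof -
  have "(\<lambda>\<alpha>. 2 * (cmod (\<psi> \<alpha>))\<^sup>2 + 2 * (cmod (\<phi> \<alpha>))\<^sup>2) summable_on arrs G"
    using assms by (intro summable_on_add summable_on_cmult_right L2_summable)
  then have "(\<lambda>\<alpha>. (cmod (\<psi> \<alpha> + \<phi> \<alpha>))\<^sup>2) summable_on arrs G"
  proof (rule summable_on_comparison_test)
    fix \<alpha>
    have "(cmod (\<psi> \<alpha> + \<phi> \<alpha>))\<^sup>2 \<le> (cmod (\<psi> \<alpha>) + cmod (\<phi> \<alpha>))\<^sup>2"
      by (intro power_mono norm_triangle_ineq) auto
    also have "\<dots> \<le> 2 * (cmod (\<psi> \<alpha>))\<^sup>2 + 2 * (cmod (\<phi> \<alpha>))\<^sup>2"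
      using sum_squares_bound[of "cmod (\<psi> \<alpha>)" "cmod (\<phi> \<alpha>)"] by (simp add: power2_sum)
    finally show "(cmod (\<psi> \<alpha> + \<phi> \<alpha>))\<^sup>2 \<le> 2 * (cmod (\<psi> \<alpha>))\<^sup>2 + 2 * (cmod (\<phi> \<alpha>))\<^sup>2" .
  qed auto
  then show ?thesis using assms by (auto simp: L2_def)
qed

lemma L2_diff [simp, intro]:
  assumes "\<psi> \<in> L2 G" "\<phi> \<in> L2 G" shows "\<psi> - \<phi> \<in> L2 G"
proof -
  have "\<psi> + (\<lambda>\<alpha>. (-1) * \<phi> \<alpha>) \<in> L2 G" using assms by (intro L2_add L2_scale)
  also have "\<psi> + (\<lambda>\<alpha>. (-1) * \<phi> \<alpha>) = \<psi> - \<phi>" by (auto simp: fun_eq_iff)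
  finally show ?thesis .
qed

section \<open>Sesquilinearity of the inner product and norm identities\<close>

lemma L2_inner_add_right:
  assumes "\<xi> \<in> L2 G" "\<psi> \<in> L2 G" "\<phi> \<in> L2 G"
  shows "L2_inner G \<xi> (\<psi> + \<phi>) = L2_inner G \<xi> \<psi> + L2_inner G \<xi> \<phi>"
  unfolding L2_inner_def plus_fun_apply distrib_left
  by (intro infsum_add L2_summable_mult(2) assms)

lemma L2_inner_scale_right: "L2_inner G \<xi> (\<lambda>\<alpha>. c * \<psi> \<alpha>) = c * L2_inner G \<xi> \<psi>"
proof -
  have "L2_inner G \<xi> (\<lambda>\<alpha>. c * \<psi> \<alpha>) = (\<Sum>\<^sub>\<infinity>\<alpha>\<in>arrs G. c * (cnj (\<xi> \<alpha>) * \<psi> \<alpha>))"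
    unfolding L2_inner_def by (intro infsum_cong) (rule mult.left_commute)
  then show ?thesis unfolding L2_inner_def by (simp only: infsum_cmult_right')
qed

lemma L2_inner_commute: "L2_inner G \<psi> \<phi> = cnj (L2_inner G \<phi> \<psi>)"
proof -
  have "cnj (L2_inner G \<phi> \<psi>) = (\<Sum>\<^sub>\<infinity>\<alpha>\<in>arrs G. cnj (cnj (\<phi> \<alpha>) * \<psi> \<alpha>))"
    unfolding L2_inner_def by (rule infsum_cnj[symmetric])
  also have "\<dots> = L2_inner G \<psi> \<phi>"
    unfolding L2_inner_def by (intro infsum_cong) simp
  finally show ?thesis ..
qed

lemma L2_inner_diff_right:
  assumes "\<xi> \<in> L2 G" "\<psi> \<in> L2 G" "\<phi> \<in> L2 G"
  shows "L2_inner G \<xi> (\<psi> - \<phi>) = L2_inner G \<xi> \<psi> - L2_inner G \<xi> \<phi>"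
  using L2_inner_add_right[of \<xi> G "\<psi> - \<phi>" \<phi>] assms by simp

lemma L2_inner_diff_left:
  assumes "\<xi> \<in> L2 G" "\<psi> \<in> L2 G" "\<phi> \<in> L2 G"
  shows "L2_inner G (\<psi> - \<phi>) \<xi> = L2_inner G \<psi> \<xi> - L2_inner G \<phi> \<xi>"
  using arg_cong[OF L2_inner_diff_right[OF assms], of cnj]
  unfolding complex_cnj_diff L2_inner_commute[symmetric] .

lemma L2_inner_add_left:
  assumes "\<xi> \<in> L2 G" "\<psi> \<in> L2 G" "\<phi> \<in> L2 G"
  shows "L2_inner G (\<psi> + \<phi>) \<xi> = L2_inner G \<psi> \<xi> + L2_inner G \<phi> \<xi>"
  using arg_cong[OF L2_inner_add_right[OF assms], of cnj]
  unfolding complex_cnj_add L2_inner_commute[symmetric] .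

lemma L2_inner_scale_left: "L2_inner G (\<lambda>\<alpha>. c * \<psi> \<alpha>) \<xi> = cnj c * L2_inner G \<psi> \<xi>"
  using arg_cong[OF L2_inner_scale_right[of G \<xi> c \<psi>], of cnj]
  unfolding complex_cnj_mult L2_inner_commute[symmetric] .

lemma L2_inner_zero [simp]: "L2_inner G \<psi> 0 = 0" "L2_inner G 0 \<psi> = 0"
  by (simp_all add: L2_inner_def)

lemma L2_inner_self:
  assumes "\<psi> \<in> L2 G"
  shows "L2_inner G \<psi> \<psi> = complex_of_real ((L2_norm G \<psi>)\<^sup>2)"
proof -
  have "L2_inner G \<psi> \<psi> = (\<Sum>\<^sub>\<infinity>\<alpha>\<in>arrs G. complex_of_real ((cmod (\<psi> \<alpha>))\<^sup>2))"
    unfolding L2_inner_def by (intro infsum_cong) (metis mult.commute complex_norm_square)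
  also have "\<dots> = complex_of_real ((L2_norm G \<psi>)\<^sup>2)"
    unfolding L2_norm_squared
    by (intro infsumI has_sum_of_real has_sum_infsum L2_summable assms)
  finally show ?thesis .
qed

lemma L2_norm_add_squared:
  assumes "\<psi> \<in> L2 G" "\<phi> \<in> L2 G"
  shows "(L2_norm G (\<psi> + \<phi>))\<^sup>2
    = (L2_norm G \<psi>)\<^sup>2 + 2 * Re (L2_inner G \<psi> \<phi>) + (L2_norm G \<phi>)\<^sup>2"
proof -
  have "complex_of_real ((L2_norm G (\<psi> + \<phi>))\<^sup>2) = L2_inner G \<psi> \<psi> + L2_inner G \<psi> \<phi>
    + cnj (L2_inner G \<psi> \<phi>) + L2_inner G \<phi> \<phi>"
    unfolding L2_inner_commute[of G \<phi> \<psi>, symmetric]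
    using assms by (simp add: L2_inner_add_left L2_inner_add_right flip: L2_inner_self of_real_power)
  from arg_cong[OF this, of Re] show ?thesis using assms by (simp add: L2_inner_self)
qed

lemma L2_norm_diff_squared:
  assumes "\<psi> \<in> L2 G" "\<phi> \<in> L2 G"
  shows "(L2_norm G (\<psi> - \<phi>))\<^sup>2
    = (L2_norm G \<psi>)\<^sup>2 - 2 * Re (L2_inner G \<psi> \<phi>) + (L2_norm G \<phi>)\<^sup>2"
proof -
  have "complex_of_real ((L2_norm G (\<psi> - \<phi>))\<^sup>2) = L2_inner G \<psi> \<psi> - L2_inner G \<psi> \<phi>
    - cnj (L2_inner G \<psi> \<phi>) + L2_inner G \<phi> \<phi>"
    unfolding L2_inner_commute[of G \<phi> \<psi>, symmetric]
    using assms by (simp add: L2_inner_diff_left L2_inner_diff_right flip: L2_inner_self of_real_power)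
  from arg_cong[OF this, of Re] show ?thesis using assms by (simp add: L2_inner_self)
qed

lemma L2_norm_triangle:
  assumes "\<psi> \<in> L2 G" "\<phi> \<in> L2 G"
  shows "L2_norm G (\<psi> + \<phi>) \<le> L2_norm G \<psi> + L2_norm G \<phi>"
proof (rule power2_le_imp_le)
  have "Re (L2_inner G \<psi> \<phi>) \<le> L2_norm G \<psi> * L2_norm G \<phi>"
    using L2_inner_bound[OF assms] complex_Re_le_cmod order_trans by blast
  then show "(L2_norm G (\<psi> + \<phi>))\<^sup>2 \<le> (L2_norm G \<psi> + L2_norm G \<phi>)\<^sup>2"
    using assms by (simp add: L2_norm_add_squared power2_sum)
qed simp

lemma L2_norm_minus_commute: "L2_norm G (\<psi> - \<phi>) = L2_norm G (\<phi> - \<psi>)"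
  by (simp add: L2_norm_def norm_minus_commute)

lemma L2_norm_triangle_diff:
  assumes "\<psi> \<in> L2 G" "\<phi> \<in> L2 G"
  shows "L2_norm G (\<psi> - \<phi>) \<le> L2_norm G \<psi> + L2_norm G \<phi>"
  using L2_norm_triangle[of \<psi> G "0 - \<phi>"] assms L2_norm_minus_commute[of G 0 \<phi>]
  by (simp del: diff_0 add: algebra_simps)

lemma L2_norm_triangle3:
  assumes "\<psi> \<in> L2 G" "\<phi> \<in> L2 G" "\<xi> \<in> L2 G"
  shows "L2_norm G (\<psi> - \<xi>) \<le> L2_norm G (\<psi> - \<phi>) + L2_norm G (\<phi> - \<xi>)"
  using L2_norm_triangle[of "\<psi> - \<phi>" G "\<phi> - \<xi>"] assms by simp

lemma L2_norm_eq_0: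
  assumes "\<psi> \<in> L2 G" "L2_norm G \<psi> = 0" shows "\<psi> = 0"
  using L2_point_le[OF assms(1)] assms(2) by (auto simp: fun_eq_iff)

lemma L2_inner_eqI:
  assumes "\<psi> \<in> L2 G" "\<phi> \<in> L2 G" "\<And>\<xi>. \<xi> \<in> L2 G \<Longrightarrow> L2_inner G \<xi> \<psi> = L2_inner G \<xi> \<phi>"
  shows "\<psi> = \<phi>"
proof -
  have "L2_inner G (\<psi> - \<phi>) (\<psi> - \<phi>) = 0"
    using assms by (simp add: L2_inner_diff_right)
  then have "L2_norm G (\<psi> - \<phi>) = 0" using assms by (simp add: L2_inner_self)
  then show ?thesis using L2_norm_eq_0[of "\<psi> - \<phi>" G] assms by simp
qed

text \<open>The limit \<open>w\<close> is taken pointwise. For fixed \<open>n\<close> and a finite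
  set \<open>F\<close>, the Cauchy bound on the sum of squares over \<open>F\<close> survives
  letting \<open>m\<close> tend to infinity, and \<open>L2_boundI\<close> turns these uniform bounds
  into a bound on the norm of \<open>v n - w\<close>.\<close>

lemma L2_complete:
  assumes v: "\<And>n. v n \<in> L2 G"
    and Cauchy: "\<And>e. 0 < e \<Longrightarrow> \<exists>N::nat. \<forall>m\<ge>N. \<forall>n\<ge>N. L2_norm G (v m - v n) \<le> e"
  shows "\<exists>w\<in>L2 G. (\<lambda>n. L2_norm G (v n - w)) \<longlonglongrightarrow> 0"
proof -
  have "Cauchy (\<lambda>n. v n \<alpha>)" for \<alpha>
  proof (rule metric_CauchyI)
    fix e :: real assume "0 < e"
    then obtain N where N: "\<forall>m\<ge>N. \<forall>n\<ge>N. L2_norm G (v m - v n) \<le> e / 2"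
      using Cauchy[of "e/2"] by auto
    have "dist (v m \<alpha>) (v n \<alpha>) < e" if "m \<ge> N" "n \<ge> N" for m n
    proof -
      have "cmod ((v m - v n) \<alpha>) \<le> L2_norm G (v m - v n)"
        by (rule L2_point_le[of "v m - v n"]) (use v in auto)
      also have "\<dots> \<le> e / 2" using N that by blast
      finally show ?thesis using \<open>0 < e\<close> by (simp add: dist_norm)
    qed
    then show "\<exists>M. \<forall>m\<ge>M. \<forall>n\<ge>M. dist (v m \<alpha>) (v n \<alpha>) < e" by blast
  qed
  then have "\<forall>\<alpha>. \<exists>l. (\<lambda>n. v n \<alpha>) \<longlonglongrightarrow> l"
    by (simp add: Cauchy_convergent_iff convergent_def)
  then obtain w where w: "\<And>\<alpha>. (\<lambda>n. v n \<alpha>) \<longlonglongrightarrow> w \<alpha>" by metis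
  have w0: "w \<alpha> = 0" if "\<alpha> \<notin> arrs G" for \<alpha>
    using w[of \<alpha>] L2_outside[OF v that] by (simp add: LIMSEQ_const_iff)
  have ev: "\<exists>N. \<forall>n\<ge>N. v n - w \<in> L2 G \<and> L2_norm G (v n - w) \<le> e" if "0 < e" for e
  proof -
    obtain N where N: "\<forall>m\<ge>N. \<forall>n\<ge>N. L2_norm G (v m - v n) \<le> e"
      using Cauchy[OF \<open>0 < e\<close>] by auto
    have "(\<Sum>\<alpha>\<in>F. (cmod ((v n - w) \<alpha>))\<^sup>2) \<le> e\<^sup>2"
      if "n \<ge> N" "finite F" "F \<subseteq> arrs G" for n F
    proof (rule LIMSEQ_le_const2)
      show "(\<lambda>m. \<Sum>\<alpha>\<in>F. (cmod (v n \<alpha> - v m \<alpha>))\<^sup>2) \<longlonglongrightarrow> (\<Sum>\<alpha>\<in>F. (cmod ((v n - w) \<alpha>))\<^sup>2)"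
        unfolding minus_apply by (intro tendsto_intros w)
      have "(\<Sum>\<alpha>\<in>F. (cmod (v n \<alpha> - v m \<alpha>))\<^sup>2) \<le> e\<^sup>2" if "m \<ge> N" for m
      proof -
        have "(\<Sum>\<alpha>\<in>F. (cmod ((v n - v m) \<alpha>))\<^sup>2) \<le> (L2_norm G (v n - v m))\<^sup>2"
          by (rule L2_finite_sum_le[of "v n - v m"]) (use v that \<open>finite F\<close> \<open>F \<subseteq> arrs G\<close> in auto)
        also have "\<dots> \<le> e\<^sup>2" using N that \<open>n \<ge> N\<close> by (intro power_mono) auto
        finally show ?thesis by simp
      qed
      then show "\<exists>M. \<forall>m\<ge>M. (\<Sum>\<alpha>\<in>F. (cmod (v n \<alpha> - v m \<alpha>))\<^sup>2) \<le> e\<^sup>2" by blast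
    qed
    then have "v n - w \<in> L2 G \<and> L2_norm G (v n - w) \<le> e" if "n \<ge> N" for n
      using L2_boundI[of G "v n - w" e] that \<open>0 < e\<close> L2_outside[OF v] w0 by simp
    then show ?thesis by blast
  qed
  \<comment> \<open>So far \<open>w\<close> is only a pointwise limit; it lies in
    \<open>L2 G\<close> as the difference of \<open>v N\<close> and \<open>v N - w\<close>.\<close>
  obtain N where "v N - w \<in> L2 G" using ev[of 1] by auto
  then have "v N - (v N - w) \<in> L2 G" using v by blast
  then have "w \<in> L2 G" by simp
  moreover have "(\<lambda>n. L2_norm G (v n - w)) \<longlonglongrightarrow> 0"
  proof (rule LIMSEQ_I)
    fix r :: real assume "0 < r"
    then obtain N where "\<forall>n\<ge>N. L2_norm G (v n - w) \<le> r / 2" using ev[of "r/2"] by auto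
    then show "\<exists>no. \<forall>n\<ge>no. norm (L2_norm G (v n - w) - 0) < r" using \<open>0 < r\<close>
      by (intro exI[of _ N]) force
  qed
  ultimately show ?thesis by blast
qed

lemma L2_limit_unique:
  assumes "\<And>n. v n \<in> L2 G" "w \<in> L2 G" "w' \<in> L2 G"
    and "(\<lambda>n. L2_norm G (v n - w)) \<longlonglongrightarrow> 0" "(\<lambda>n. L2_norm G (v n - w')) \<longlonglongrightarrow> 0"
  shows "w = w'"
proof -
  have "(\<lambda>n. L2_norm G (v n - w) + L2_norm G (v n - w')) \<longlonglongrightarrow> 0 + 0"
    by (intro tendsto_add assms)
  moreover have "L2_norm G (w - w') \<le> L2_norm G (v n - w) + L2_norm G (v n - w')" for n
    using L2_norm_triangle3[of w G "v n" w'] assms L2_norm_minus_commute[of G w "v n"] by simp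
  ultimately have "L2_norm G (w - w') \<le> 0"
    by (metis (no_types, lifting) LIMSEQ_le_const add.right_neutral)
  then show ?thesis using L2_norm_eq_0[of "w - w'" G] assms
    by (simp add: order_antisym)
qed

lemma L2_inner_tendsto:
  assumes "\<And>n. v n \<in> L2 G" "w \<in> L2 G" "\<xi> \<in> L2 G" "(\<lambda>n. L2_norm G (v n - w)) \<longlonglongrightarrow> 0"
  shows "(\<lambda>n. L2_inner G \<xi> (v n)) \<longlonglongrightarrow> L2_inner G \<xi> w"
proof -
  have "(\<lambda>n. L2_norm G \<xi> * L2_norm G (v n - w)) \<longlonglongrightarrow> 0"
    using tendsto_mult_right_zero[OF assms(4)] .
  then have "(\<lambda>n. L2_inner G \<xi> (v n) - L2_inner G \<xi> w) \<longlonglongrightarrow> 0"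
    by (rule Lim_null_comparison[rotated])
       (use assms L2_inner_bound[of \<xi> G "v _ - w"] in \<open>auto simp: L2_inner_diff_right\<close>)
  then show ?thesis by (simp add: LIM_zero_iff)
qed

text \<open>Has two roles: the basis vector of the Hilbert space at \<open>\<alpha>\<close>, and the
  transition \<open>\<alpha>\<close> as an element of the algebra of transitions.\<close>

definition delta :: "'g \<Rightarrow> 'g \<Rightarrow> complex" where
  "delta \<alpha> = (\<lambda>\<beta>. if \<beta> = \<alpha> then 1 else 0)"

lemma finite_support_L2:
  assumes "finite {\<alpha>. \<psi> \<alpha> \<noteq> 0}" "\<And>\<alpha>. \<alpha> \<notin> arrs G \<Longrightarrow> \<psi> \<alpha> = 0"
  shows "\<psi> \<in> L2 G"
  using assms by (auto simp: L2_def intro!: finite_nonzero_values_imp_summable_on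
    elim: finite_subset[rotated])

lemma delta_L2 [simp, intro]: "\<alpha> \<in> arrs G \<Longrightarrow> delta \<alpha> \<in> L2 G"
  by (rule finite_support_L2) (auto simp: delta_def)

lemma L2_inner_delta:
  assumes "\<alpha> \<in> arrs G"
  shows "L2_inner G (delta \<alpha>) \<psi> = \<psi> \<alpha>" "L2_inner G \<psi> (delta \<alpha>) = cnj (\<psi> \<alpha>)"
proof -
  have "L2_inner G (delta \<alpha>) \<psi> = (\<Sum>\<^sub>\<infinity>\<beta>\<in>{\<alpha>}. \<psi> \<beta>)"
    unfolding L2_inner_def by (rule infsum_cong_neutral) (use assms in \<open>auto simp: delta_def\<close>)
  then show *: "L2_inner G (delta \<alpha>) \<psi> = \<psi> \<alpha>" by simp
  show "L2_inner G \<psi> (delta \<alpha>) = cnj (\<psi> \<alpha>)" by (subst L2_inner_commute) (simp add: *)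
qed

section \<open>Bounded operators\<close>

lemma bounded_operator_in [simp, intro]:
  "T \<in> bounded_operators G \<Longrightarrow> \<psi> \<in> L2 G \<Longrightarrow> T \<psi> \<in> L2 G"
  unfolding bounded_operators_def by blast

lemma bounded_operator_outside:
  "T \<in> bounded_operators G \<Longrightarrow> \<psi> \<notin> L2 G \<Longrightarrow> T \<psi> = 0"
  unfolding bounded_operators_def zero_fun_def by blast

lemma bounded_operator_lincomb:
  "T \<in> bounded_operators G \<Longrightarrow> \<psi> \<in> L2 G \<Longrightarrow> \<phi> \<in> L2 G \<Longrightarrow>
    T (\<lambda>\<alpha>. a * \<psi> \<alpha> + b * \<phi> \<alpha>) = (\<lambda>\<alpha>. a * T \<psi> \<alpha> + b * T \<phi> \<alpha>)"
  unfolding bounded_operators_def by blast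

lemma bounded_operator_add:
  assumes "T \<in> bounded_operators G" "\<psi> \<in> L2 G" "\<phi> \<in> L2 G"
  shows "T (\<psi> + \<phi>) = T \<psi> + T \<phi>"
  using bounded_operator_lincomb[OF assms, of 1 1] by (simp add: plus_fun_def)

lemma bounded_operator_diff:
  assumes "T \<in> bounded_operators G" "\<psi> \<in> L2 G" "\<phi> \<in> L2 G"
  shows "T (\<psi> - \<phi>) = T \<psi> - T \<phi>"
  using bounded_operator_lincomb[OF assms, of 1 "-1"] by (simp add: fun_diff_def)

lemma bounded_operator_scale:
  assumes "T \<in> bounded_operators G" "\<psi> \<in> L2 G"
  shows "T (\<lambda>\<alpha>. c * \<psi> \<alpha>) = (\<lambda>\<alpha>. c * T \<psi> \<alpha>)"
  using bounded_operator_lincomb[OF assms assms(2), of c 0] by simp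

lemma bounded_operator_zero:
  assumes "T \<in> bounded_operators G"
  shows "T 0 = 0" "T (\<lambda>\<alpha>. 0) = 0"
  using bounded_operator_diff[OF assms L2_zero(1) L2_zero(1)] by (simp_all flip: zero_fun_def)

lemma bounded_operator_bound:
  assumes "T \<in> bounded_operators G"
  obtains K where "0 \<le> K" "\<And>\<psi>. \<psi> \<in> L2 G \<Longrightarrow> L2_norm G (T \<psi>) \<le> K * L2_norm G \<psi>"
proof -
  obtain K where K: "\<And>\<psi>. \<psi> \<in> L2 G \<Longrightarrow> L2_norm G (T \<psi>) \<le> K * L2_norm G \<psi>"
    using assms unfolding bounded_operators_def by blast
  have "L2_norm G (T \<psi>) \<le> \<bar>K\<bar> * L2_norm G \<psi>" if "\<psi> \<in> L2 G" for \<psi>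
    using K[OF that] by (rule order_trans) (intro mult_right_mono; simp)
  then show ?thesis by (intro that[of "\<bar>K\<bar>"]) auto
qed

lemma bounded_operatorI:
  assumes "\<And>\<psi>. \<psi> \<in> L2 G \<Longrightarrow> T \<psi> \<in> L2 G"
    and "\<And>\<psi> \<phi> a b. \<psi> \<in> L2 G \<Longrightarrow> \<phi> \<in> L2 G \<Longrightarrow>
      T (\<lambda>\<alpha>. a * \<psi> \<alpha> + b * \<phi> \<alpha>) = (\<lambda>\<alpha>. a * T \<psi> \<alpha> + b * T \<phi> \<alpha>)"
    and "\<And>\<psi>. \<psi> \<in> L2 G \<Longrightarrow> L2_norm G (T \<psi>) \<le> K * L2_norm G \<psi>"
    and "\<And>\<psi>. \<psi> \<notin> L2 G \<Longrightarrow> T \<psi> = 0"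
  shows "T \<in> bounded_operators G"
  using assms unfolding bounded_operators_def zero_fun_def by blast

lemma bounded_operator_eqI:
  assumes "T \<in> bounded_operators G" "S \<in> bounded_operators G"
    "\<And>\<psi>. \<psi> \<in> L2 G \<Longrightarrow> T \<psi> = S \<psi>"
  shows "T = S"
  using assms by (metis bounded_operator_outside ext)

lemma L2_lincomb [simp, intro]:
  assumes "\<psi> \<in> L2 G" "\<phi> \<in> L2 G"
  shows "(\<lambda>\<alpha>. a * \<psi> \<alpha> + b * \<phi> \<alpha>) \<in> L2 G"
  using L2_add[OF L2_scale[OF assms(1), of a] L2_scale[OF assms(2), of b]]
  by (simp add: plus_fun_def)

lemma bounded_operator_comp [simp, intro]:
  assumes T: "T \<in> bounded_operators G" and S: "S \<in> bounded_operators G"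
  shows "T \<circ> S \<in> bounded_operators G"
proof -
  obtain K where K: "0 \<le> K" "\<And>\<psi>. \<psi> \<in> L2 G \<Longrightarrow> L2_norm G (T \<psi>) \<le> K * L2_norm G \<psi>"
    using bounded_operator_bound[OF T] by blast
  obtain K' where K': "0 \<le> K'" "\<And>\<psi>. \<psi> \<in> L2 G \<Longrightarrow> L2_norm G (S \<psi>) \<le> K' * L2_norm G \<psi>"
    using bounded_operator_bound[OF S] by blast
  show ?thesis
  proof (rule bounded_operatorI[where K = "K * K'"])
    fix \<psi> assume "\<psi> \<in> L2 G"
    have "L2_norm G (T (S \<psi>)) \<le> K * L2_norm G (S \<psi>)"
      using K S \<open>\<psi> \<in> L2 G\<close> by blast
    also have "\<dots> \<le> K * (K' * L2_norm G \<psi>)"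
      using K K' \<open>\<psi> \<in> L2 G\<close> by (intro mult_left_mono) auto
    finally show "L2_norm G ((T \<circ> S) \<psi>) \<le> K * K' * L2_norm G \<psi>" by (simp add: mult.assoc)
  qed (use T S in \<open>auto simp: bounded_operator_lincomb bounded_operator_outside bounded_operator_zero\<close>)
qed

definition op_lincomb ::
  "complex \<Rightarrow> 'g operator \<Rightarrow> complex \<Rightarrow> 'g operator \<Rightarrow> 'g operator" where
  "op_lincomb a T b S \<psi> = (\<lambda>\<alpha>. a * T \<psi> \<alpha> + b * S \<psi> \<alpha>)"

lemma op_lincomb_bounded [simp, intro]:
  assumes T: "T \<in> bounded_operators G" and S: "S \<in> bounded_operators G"
  shows "op_lincomb a T b S \<in> bounded_operators G"
proof -
  obtain K where K: "0 \<le> K" "\<And>\<psi>. \<psi> \<in> L2 G \<Longrightarrow> L2_norm G (T \<psi>) \<le> K * L2_norm G \<psi>"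
    using bounded_operator_bound[OF T] by blast
  obtain K' where K': "0 \<le> K'" "\<And>\<psi>. \<psi> \<in> L2 G \<Longrightarrow> L2_norm G (S \<psi>) \<le> K' * L2_norm G \<psi>"
    using bounded_operator_bound[OF S] by blast
  show ?thesis
  proof (rule bounded_operatorI[where K = "cmod a * K + cmod b * K'"])
    fix \<psi> assume \<psi>: "\<psi> \<in> L2 G"
    have "L2_norm G (op_lincomb a T b S \<psi>)
      \<le> L2_norm G (\<lambda>\<alpha>. a * T \<psi> \<alpha>) + L2_norm G (\<lambda>\<alpha>. b * S \<psi> \<alpha>)"
      using L2_norm_triangle[of "\<lambda>\<alpha>. a * T \<psi> \<alpha>" G "\<lambda>\<alpha>. b * S \<psi> \<alpha>"] T S \<psi>
      by (simp add: op_lincomb_def plus_fun_def)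
    also have "\<dots> \<le> cmod a * (K * L2_norm G \<psi>) + cmod b * (K' * L2_norm G \<psi>)"
      unfolding L2_norm_scale using K K' \<psi> by (intro add_mono mult_left_mono) auto
    finally show "L2_norm G (op_lincomb a T b S \<psi>) \<le> (cmod a * K + cmod b * K') * L2_norm G \<psi>"
      by (simp add: algebra_simps)
  qed (use T S in \<open>auto simp: op_lincomb_def bounded_operator_lincomb bounded_operator_outside
        algebra_simps fun_eq_iff\<close>)
qed

lemma bounded_operator_sum:
  assumes "finite F" "\<And>\<alpha>. \<alpha> \<in> F \<Longrightarrow> T \<alpha> \<in> bounded_operators G"
  shows "(\<lambda>\<psi> \<beta>. \<Sum>\<alpha>\<in>F. c \<alpha> * T \<alpha> \<psi> \<beta>) \<in> bounded_operators G"
  using assms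
proof (induction F)
  case empty
  show ?case by (rule bounded_operatorI[where K = 0]) (auto simp: fun_eq_iff)
next
  case (insert \<alpha> F)
  have "(\<lambda>\<psi> \<beta>. \<Sum>\<alpha>\<in>insert \<alpha> F. c \<alpha> * T \<alpha> \<psi> \<beta>)
    = op_lincomb (c \<alpha>) (T \<alpha>) 1 (\<lambda>\<psi> \<beta>. \<Sum>\<alpha>\<in>F. c \<alpha> * T \<alpha> \<psi> \<beta>)"
    using insert by (simp add: op_lincomb_def fun_eq_iff)
  then show ?case using insert by simp
qed

text \<open>The identity of the operator algebra. The HOL constant \<open>id\<close> cannot replace
  it, because bounded operators have to send functions outside \<open>L2 G\<close> to zero.\<close>

definition id_op :: "('o, 'g) groupoid \<Rightarrow> 'g operator" where
  "id_op G \<psi> = (if \<psi> \<in> L2 G then \<psi> else 0)"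

lemma id_op_bounded [simp, intro]: "id_op G \<in> bounded_operators G"
  by (rule bounded_operatorI[where K = 1]) (auto simp: id_op_def)

lemma prop_compl_eq:
  "T \<in> bounded_operators G \<Longrightarrow> prop_compl G T = op_lincomb 1 (id_op G) (-1) T"
  by (auto simp: prop_compl_def op_lincomb_def id_op_def fun_eq_iff bounded_operator_outside)

lemma prop_compl_apply:
  "\<psi> \<in> L2 G \<Longrightarrow> prop_compl G T \<psi> = \<psi> - T \<psi>"
  by (simp add: prop_compl_def fun_diff_def)

lemma prop_compl_bounded [simp, intro]:
  "T \<in> bounded_operators G \<Longrightarrow> prop_compl G T \<in> bounded_operators G"
  by (simp add: prop_compl_eq)

lemma funpow_bounded:
  assumes "T \<in> bounded_operators G" "\<psi> \<in> L2 G"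
  shows "(T ^^ n) \<psi> \<in> L2 G"
  by (induction n) (use assms in auto)

section \<open>Adjoints\<close>

lemma adjoint_inner:
  "is_adjoint G T S \<Longrightarrow> \<psi> \<in> L2 G \<Longrightarrow> \<phi> \<in> L2 G \<Longrightarrow>
    L2_inner G (T \<psi>) \<phi> = L2_inner G \<psi> (S \<phi>)"
  by (simp add: is_adjoint_def)

lemma adjoint_sym: "is_adjoint G T S \<Longrightarrow> is_adjoint G S T"
  unfolding is_adjoint_def by (metis L2_inner_commute)

lemma adjoint_comp:
  assumes "is_adjoint G T T'" "is_adjoint G S S'"
    "T' \<in> bounded_operators G" "S \<in> bounded_operators G"
  shows "is_adjoint G (T \<circ> S) (S' \<circ> T')"
  using assms by (simp add: is_adjoint_def)

lemma adjoint_lincomb: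
  assumes "is_adjoint G T T'" "is_adjoint G S S'"
    "T \<in> bounded_operators G" "S \<in> bounded_operators G"
    "T' \<in> bounded_operators G" "S' \<in> bounded_operators G"
  shows "is_adjoint G (op_lincomb a T b S) (op_lincomb (cnj a) T' (cnj b) S')"
  unfolding is_adjoint_def
proof (intro ballI)
  fix \<psi> \<phi> assume *: "\<psi> \<in> L2 G" "\<phi> \<in> L2 G"
  have "L2_inner G ((\<lambda>\<alpha>. a * T \<psi> \<alpha>) + (\<lambda>\<alpha>. b * S \<psi> \<alpha>)) \<phi>
    = L2_inner G \<psi> ((\<lambda>\<alpha>. cnj a * T' \<phi> \<alpha>) + (\<lambda>\<alpha>. cnj b * S' \<phi> \<alpha>))"
    using assms * by (simp add: L2_inner_add_left L2_inner_add_right L2_inner_scale_left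
        L2_inner_scale_right adjoint_inner)
  then show "L2_inner G (op_lincomb a T b S \<psi>) \<phi>
    = L2_inner G \<psi> (op_lincomb (cnj a) T' (cnj b) S' \<phi>)"
    by (simp add: op_lincomb_def plus_fun_def)
qed

lemma adjoint_id: "is_adjoint G (id_op G) (id_op G)"
  by (simp add: is_adjoint_def id_op_def)

lemma adjoint_prop_compl:
  assumes "is_adjoint G T T'" "T \<in> bounded_operators G" "T' \<in> bounded_operators G"
  shows "is_adjoint G (prop_compl G T) (prop_compl G T')"
  using adjoint_lincomb[OF adjoint_id assms(1), of 1 "-1"] assms by (simp add: prop_compl_eq)

lemma adjoint_unique:
  assumes "is_adjoint G T S" "is_adjoint G T S'"
    "S \<in> bounded_operators G" "S' \<in> bounded_operators G"
  shows "S = S'"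
proof (rule bounded_operator_eqI[OF assms(3,4)])
  fix \<psi> assume "\<psi> \<in> L2 G"
  then show "S \<psi> = S' \<psi>"
    using assms by (intro L2_inner_eqI[of _ G]) (auto simp flip: adjoint_inner)
qed

section \<open>Strong limits\<close>

lemma strong_limit_bounded: "strong_limit G T R \<Longrightarrow> R \<in> bounded_operators G"
  by (simp add: strong_limit_def)

lemma strong_limit_tendsto:
  "strong_limit G T R \<Longrightarrow> \<psi> \<in> L2 G \<Longrightarrow> (\<lambda>n. L2_norm G (T n \<psi> - R \<psi>)) \<longlonglongrightarrow> 0"
  by (simp add: strong_limit_def fun_diff_def)

lemma strong_limit_unique:
  assumes "\<And>n \<psi>. \<psi> \<in> L2 G \<Longrightarrow> T n \<psi> \<in> L2 G" "strong_limit G T R" "strong_limit G T R'"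
  shows "R = R'"
proof (rule bounded_operator_eqI)
  fix \<psi> assume "\<psi> \<in> L2 G"
  then show "R \<psi> = R' \<psi>"
    using assms by (intro L2_limit_unique[of "\<lambda>n. T n \<psi>" G])
      (auto intro: strong_limit_tendsto strong_limit_bounded)
qed (use assms in \<open>auto intro: strong_limit_bounded\<close>)

lemma L2_tendsto_operator:
  assumes T: "T \<in> bounded_operators G" and v: "\<And>n. v n \<in> L2 G" and w: "w \<in> L2 G"
    and lim: "(\<lambda>n. L2_norm G (v n - w)) \<longlonglongrightarrow> 0"
  shows "(\<lambda>n. L2_norm G (T (v n) - T w)) \<longlonglongrightarrow> 0"
proof -
  obtain K where K: "\<And>\<psi>. \<psi> \<in> L2 G \<Longrightarrow> L2_norm G (T \<psi>) \<le> K * L2_norm G \<psi>"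
    using bounded_operator_bound[OF T] by metis
  have "(\<lambda>n. K * L2_norm G (v n - w)) \<longlonglongrightarrow> 0" using tendsto_mult_right_zero[OF lim] .
  then show ?thesis
  proof (rule Lim_null_comparison[rotated], intro always_eventually allI)
    fix n
    show "norm (L2_norm G (T (v n) - T w)) \<le> K * L2_norm G (v n - w)"
      using K[of "v n - w"] v w by (simp add: bounded_operator_diff[OF T])
  qed
qed

lemma commutantI:
  "T \<in> bounded_operators G \<Longrightarrow> (\<And>A. A \<in> S \<Longrightarrow> T \<circ> A = A \<circ> T) \<Longrightarrow> T \<in> commutant G S"
  by (simp add: commutant_def)

lemma commutant_in:
  "T \<in> commutant G S \<Longrightarrow> T \<in> bounded_operators G"
  "T \<in> commutant G S \<Longrightarrow> A \<in> S \<Longrightarrow> T (A \<psi>) = A (T \<psi>)"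
  unfolding commutant_def by (auto simp: fun_eq_iff)

lemma commutant_comp:
  assumes "T \<in> commutant G S" "T' \<in> commutant G S"
  shows "T \<circ> T' \<in> commutant G S"
proof -
  have "T \<circ> T' \<in> bounded_operators G" using assms commutant_in(1) by blast
  moreover have "T (T' (A \<psi>)) = A (T (T' \<psi>))" if "A \<in> S" for A \<psi>
    unfolding commutant_in(2)[OF assms(2) that] commutant_in(2)[OF assms(1) that] ..
  ultimately show ?thesis by (simp add: commutant_def fun_eq_iff)
qed

lemma commutant_lincomb:
  assumes "T \<in> commutant G S" "T' \<in> commutant G S" "S \<subseteq> bounded_operators G"
  shows "op_lincomb a T b T' \<in> commutant G S"
proof -
  have "op_lincomb a T b T' (A \<psi>) = A (op_lincomb a T b T' \<psi>)" if "A \<in> S" for A \<psi>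
  proof (cases "\<psi> \<in> L2 G")
    case True
    then show ?thesis
      using assms(3) that commutant_in[OF assms(1)] commutant_in[OF assms(2)]
      by (auto simp: op_lincomb_def bounded_operator_lincomb subset_iff)
  next
    case False
    moreover have "A \<in> bounded_operators G" using assms(3) that by blast
    ultimately have "A \<psi> = 0" "T \<psi> = 0" "T' \<psi> = 0" "A 0 = 0" "T 0 = 0" "T' 0 = 0"
      using commutant_in(1)[OF assms(1)] commutant_in(1)[OF assms(2)]
      by (auto simp: bounded_operator_outside bounded_operator_zero)
    then show ?thesis by (simp add: op_lincomb_def flip: zero_fun_def)
  qed
  moreover have "op_lincomb a T b T' \<in> bounded_operators G"
    using assms commutant_in(1) by blast
  ultimately show ?thesis by (simp add: commutant_def fun_eq_iff)
qed

lemma commutant_id: "S \<subseteq> bounded_operators G \<Longrightarrow> id_op G \<in> commutant G S"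
  by (auto simp: commutant_def id_op_def fun_eq_iff subset_iff bounded_operator_outside
      bounded_operator_zero)

text \<open>The sequence \<open>T n (A \<psi>) = A (T n \<psi>)\<close> tends to
  \<open>R (A \<psi>)\<close> by assumption and to \<open>A (R \<psi>)\<close> by boundedness of
  \<open>A\<close>; limits are unique.\<close>

lemma commutant_strong_limit:
  assumes T: "\<And>n. T n \<in> commutant G S" and S: "S \<subseteq> bounded_operators G"
    and lim: "strong_limit G T R"
  shows "R \<in> commutant G S"
proof -
  note R = strong_limit_bounded[OF lim]
  have "R \<circ> A = A \<circ> R" if "A \<in> S" for A
  proof (rule bounded_operator_eqI)
    have A: "A \<in> bounded_operators G" using S that by blast
    show "R \<circ> A \<in> bounded_operators G" "A \<circ> R \<in> bounded_operators G" using A R by auto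
    fix \<psi> assume \<psi>: "\<psi> \<in> L2 G"
    have "(\<lambda>n. L2_norm G (A (T n \<psi>) - A (R \<psi>))) \<longlonglongrightarrow> 0"
      using commutant_in(1)[OF T] R \<psi>
      by (intro L2_tendsto_operator[OF A] strong_limit_tendsto[OF lim]) auto
    then have "(\<lambda>n. L2_norm G (T n (A \<psi>) - A (R \<psi>))) \<longlonglongrightarrow> 0"
      using commutant_in(2)[OF T that] by simp
    moreover have "(\<lambda>n. L2_norm G (T n (A \<psi>) - R (A \<psi>))) \<longlonglongrightarrow> 0"
      using A \<psi> by (intro strong_limit_tendsto[OF lim]) auto
    ultimately show "(R \<circ> A) \<psi> = (A \<circ> R) \<psi>"
      using L2_limit_unique[of "\<lambda>n. T n (A \<psi>)" G "R (A \<psi>)" "A (R \<psi>)"]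
        commutant_in(1)[OF T] A R \<psi> by auto
  qed
  then show ?thesis using R by (auto simp: commutant_def)
qed

lemma commutant_bounded: "commutant G S \<subseteq> bounded_operators G"
  by (auto simp: commutant_def)


section \<open>Closure properties of the von Neumann algebra\<close>

lemma vN_algebra_bounded [simp, intro]: "T \<in> vN_algebra G \<Longrightarrow> T \<in> bounded_operators G"
  unfolding vN_algebra_def by (rule commutant_in(1))

lemma vN_closed:
  shows vN_comp [simp, intro]: "T \<in> vN_algebra G \<Longrightarrow> S \<in> vN_algebra G \<Longrightarrow> T \<circ> S \<in> vN_algebra G"
    and vN_lincomb [simp, intro]:
      "T \<in> vN_algebra G \<Longrightarrow> S \<in> vN_algebra G \<Longrightarrow> op_lincomb a T b S \<in> vN_algebra G"
    and vN_id [simp, intro]: "id_op G \<in> vN_algebra G"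
    and vN_compl [simp, intro]: "T \<in> vN_algebra G \<Longrightarrow> prop_compl G T \<in> vN_algebra G"
    and vN_strong_limit: "(\<And>n. U n \<in> vN_algebra G) \<Longrightarrow> strong_limit G U R \<Longrightarrow> R \<in> vN_algebra G"
proof -
  note c = commutant_bounded[of G "left_regular G ` groupoid_algebra G"]
  show *: "op_lincomb a T b S \<in> vN_algebra G" if "T \<in> vN_algebra G" "S \<in> vN_algebra G" for T S a b
    using that unfolding vN_algebra_def by (intro commutant_lincomb c)
  show **: "id_op G \<in> vN_algebra G" unfolding vN_algebra_def by (rule commutant_id[OF c])
  show "prop_compl G T \<in> vN_algebra G" if "T \<in> vN_algebra G"
    using *[OF ** that] that by (simp add: prop_compl_eq)
  show "T \<circ> S \<in> vN_algebra G" if "T \<in> vN_algebra G" "S \<in> vN_algebra G"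
    using that unfolding vN_algebra_def by (rule commutant_comp)
  show "R \<in> vN_algebra G" if "\<And>n. U n \<in> vN_algebra G" "strong_limit G U R"
    using that unfolding vN_algebra_def by (rule commutant_strong_limit[OF _ c])
qed

lemma strong_limit_powers_vN:
  assumes "T \<in> vN_algebra G" "strong_limit G (\<lambda>n. T ^^ n) R"
  shows "R \<in> vN_algebra G"
proof (rule vN_strong_limit)
  \<comment> \<open>The power with exponent 0 is \<open>id\<close>, which need not vanish outside
    \<open>L2 G\<close> and so need not be in the algebra. Dropping it leaves the strong limit
    unchanged.\<close>
  show "(T ^^ Suc n) \<in> vN_algebra G" for n
  proof (induction n)
    case (Suc n)
    then show ?case using vN_comp[OF assms(1)] by (subst funpow.simps)
  qed (use assms(1) in simp)
  show "strong_limit G (\<lambda>n. T ^^ Suc n) R"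
    using assms(2) unfolding strong_limit_def by (auto intro: LIMSEQ_Suc simp del: funpow.simps)
qed

section \<open>Powers of positive contractions\<close>

lemma funpow_lincomb:
  assumes "T \<in> bounded_operators G" "\<psi> \<in> L2 G" "\<phi> \<in> L2 G"
  shows "(T ^^ n) (\<lambda>\<alpha>. a * \<psi> \<alpha> + b * \<phi> \<alpha>) = (\<lambda>\<alpha>. a * (T ^^ n) \<psi> \<alpha> + b * (T ^^ n) \<phi> \<alpha>)"
  by (induction n) (use assms in \<open>auto simp: bounded_operator_lincomb funpow_bounded\<close>)

text \<open>The squared norm of \<open>C \<phi>\<close> is the inner product of
  \<open>B (C \<phi>)\<close> and \<open>\<phi>\<close>. Cauchy-Schwarz and contractivity of
  \<open>B\<close> bound it by \<open>L2_norm G (C \<phi>) * L2_norm G \<phi>\<close>, and one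
  factor cancels.\<close>

lemma adjoint_contraction:
  assumes B: "B \<in> bounded_operators G" and C: "C \<in> bounded_operators G"
    and adj: "is_adjoint G B C"
    and contr: "\<And>\<psi>. \<psi> \<in> L2 G \<Longrightarrow> L2_norm G (B \<psi>) \<le> L2_norm G \<psi>"
    and \<phi>: "\<phi> \<in> L2 G"
  shows "L2_norm G (C \<phi>) \<le> L2_norm G \<phi>"
proof -
  have C\<phi>: "C \<phi> \<in> L2 G" and BC\<phi>: "B (C \<phi>) \<in> L2 G" using B C \<phi> by auto
  have "complex_of_real ((L2_norm G (C \<phi>))\<^sup>2) = L2_inner G (B (C \<phi>)) \<phi>"
    using adjoint_inner[OF adj C\<phi> \<phi>] L2_inner_self[OF C\<phi>] by simp
  then have "(L2_norm G (C \<phi>))\<^sup>2 = cmod (L2_inner G (B (C \<phi>)) \<phi>)"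
    by (metis norm_of_real abs_of_nonneg zero_le_power2)
  also have "\<dots> \<le> L2_norm G (B (C \<phi>)) * L2_norm G \<phi>" by (rule L2_inner_bound[OF BC\<phi> \<phi>])
  also have "\<dots> \<le> L2_norm G (C \<phi>) * L2_norm G \<phi>" by (intro mult_right_mono contr C\<phi>) simp
  finally have *: "L2_norm G (C \<phi>) * L2_norm G (C \<phi>) \<le> L2_norm G (C \<phi>) * L2_norm G \<phi>"
    by (simp only: power2_eq_square)
  show ?thesis
  proof (cases "L2_norm G (C \<phi>) = 0")
    case False
    then have "0 < L2_norm G (C \<phi>)" using L2_norm_nonneg[of G "C \<phi>"] by linarith
    then show ?thesis using * mult_le_cancel_left_pos by blast
  qed simp
qed

text \<open>Powers of a positive contraction \<open>T\<close> tend strongly to the projection onto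
  its fixed vectors. The moments \<open>a k\<close>, the real parts of the inner products of
  \<open>\<psi>\<close> and \<open>(T ^^ k) \<psi>\<close>, take the place of the spectral measure.
  Writing \<open>T\<close> as \<open>C \<circ> B\<close> with \<open>C\<close> adjoint to
  \<open>B\<close> encodes positivity and makes odd moments squared norms as well.\<close>

lemma positive_contraction_limit:
  assumes B: "B \<in> bounded_operators G" and C: "C \<in> bounded_operators G"
    and adj: "is_adjoint G B C"
    and contr: "\<And>\<psi>. \<psi> \<in> L2 G \<Longrightarrow> L2_norm G (B \<psi>) \<le> L2_norm G \<psi>"
  obtains R where "strong_limit G (\<lambda>n. (C \<circ> B) ^^ n) R" "is_adjoint G R R" "R \<circ> R = R"
    "(C \<circ> B) \<circ> R = R" "\<And>\<psi>. \<psi> \<in> L2 G \<Longrightarrow> C (B \<psi>) = \<psi> \<Longrightarrow> R \<psi> = \<psi>"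
proof -
  define T where "T = C \<circ> B"
  have CB: "C (B v) = T v" for v by (simp add: T_def)
  have T: "T \<in> bounded_operators G" using B C by (simp add: T_def)
  have Tadj: "is_adjoint G T T"
    unfolding T_def by (rule adjoint_comp[OF adjoint_sym[OF adj] adj B B])
  note Ccontr = adjoint_contraction[OF B C adj contr]
  have TL2: "(T ^^ n) \<psi> \<in> L2 G" if "\<psi> \<in> L2 G" for n \<psi> by (rule funpow_bounded[OF T that])
  have Tn: "L2_inner G ((T ^^ m) \<psi>) \<phi> = L2_inner G \<psi> ((T ^^ m) \<phi>)"
    if "\<psi> \<in> L2 G" "\<phi> \<in> L2 G" for m \<psi> \<phi>
    using that
  proof (induction m arbitrary: \<phi>)
    case (Suc m)
    have "L2_inner G (T ((T ^^ m) \<psi>)) \<phi> = L2_inner G ((T ^^ m) \<psi>) (T \<phi>)"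
      by (rule adjoint_inner[OF Tadj TL2[OF Suc(2)] Suc(3)])
    also have "\<dots> = L2_inner G \<psi> ((T ^^ m) (T \<phi>))" using Suc T by blast
    finally show ?case by (simp add: funpow_swap1)
  qed simp
  have Tcontr: "L2_norm G ((T ^^ n) \<psi>) \<le> L2_norm G \<psi>" if "\<psi> \<in> L2 G" for n \<psi>
  proof (induction n)
    case (Suc n)
    have "L2_norm G (C (B ((T ^^ n) \<psi>))) \<le> L2_norm G (B ((T ^^ n) \<psi>))"
      using B TL2[OF that] by (intro Ccontr) auto
    also have "\<dots> \<le> L2_norm G ((T ^^ n) \<psi>)" by (rule contr[OF TL2[OF that]])
    finally show ?case using Suc by (simp add: CB)
  qed simp
  have lim: "\<exists>w\<in>L2 G. (\<lambda>n. L2_norm G ((T ^^ n) \<psi> - w)) \<longlonglongrightarrow> 0" if \<psi>: "\<psi> \<in> L2 G" for \<psi>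
  proof (rule L2_complete)
    show "(T ^^ n) \<psi> \<in> L2 G" for n by (rule TL2[OF \<psi>])
    define a where "a k = Re (L2_inner G \<psi> ((T ^^ k) \<psi>))" for k
    have inn: "Re (L2_inner G ((T ^^ m) \<psi>) ((T ^^ n) \<psi>)) = a (m + n)" for m n
      using Tn[OF \<psi> TL2[OF \<psi>], of m n] by (simp add: a_def funpow_add)
    have even: "a (2 * j) = (L2_norm G ((T ^^ j) \<psi>))\<^sup>2" for j
      using inn[of j j] L2_inner_self[OF TL2[OF \<psi>], of j] by (simp add: mult_2)
    have odd: "a (Suc (2 * j)) = (L2_norm G (B ((T ^^ j) \<psi>)))\<^sup>2" for j
    proof -
      have in2: "B ((T ^^ j) \<psi>) \<in> L2 G" using B TL2[OF \<psi>] by blast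
      have "a (Suc (2 * j)) = Re (L2_inner G ((T ^^ j) \<psi>) (C (B ((T ^^ j) \<psi>))))"
        using inn[of j "Suc j"] by (simp add: mult_2 CB)
      also have "\<dots> = Re (L2_inner G (B ((T ^^ j) \<psi>)) (B ((T ^^ j) \<psi>)))"
        using adjoint_inner[OF adj TL2[OF \<psi>] in2] by simp
      finally show ?thesis by (simp add: L2_inner_self[OF in2])
    qed
    \<comment> \<open>Successive moments are the squared norms of \<open>(T ^^ j) \<psi>\<close>, of
      its image under \<open>B\<close>, and of the image of that under \<open>C\<close>. Each of
      these steps applies a contraction.\<close>
    have "a (Suc k) \<le> a k" for k
    proof (cases "even k")
      case True
      then obtain j where k: "k = 2 * j" by blast
      show ?thesis unfolding k even odd by (intro power_mono contr TL2 \<psi>) simp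
    next
      case False
      then obtain j where k: "k = Suc (2 * j)" by (auto elim: oddE)
      have "Suc k = 2 * Suc j" by (simp add: k)
      then have "a (Suc k) = (L2_norm G (C (B ((T ^^ j) \<psi>))))\<^sup>2" by (simp only: even) (simp add: CB)
      also have "\<dots> \<le> (L2_norm G (B ((T ^^ j) \<psi>)))\<^sup>2"
        using B TL2[OF \<psi>] by (intro power_mono Ccontr) auto
      finally show ?thesis unfolding k odd .
    qed
    then have dec: "decseq a" by (simp add: decseq_Suc_iff)
    have nonneg: "0 \<le> a k" for k
    proof -
      have "0 \<le> a (2 * k)" unfolding even by simp
      also have "\<dots> \<le> a k" using dec by (simp add: decseq_def)
      finally show ?thesis .
    qed
    obtain l where l: "a \<longlonglongrightarrow> l" using decseq_convergent[OF dec, of 0] nonneg by blast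
    fix e :: real assume "0 < e"
    then have "0 < e\<^sup>2 / 4" by simp
    then obtain N where N: "\<And>n. n \<ge> N \<Longrightarrow> \<bar>a n - l\<bar> < e\<^sup>2 / 4"
      using LIMSEQ_D[OF l] by (metis real_norm_def)
    \<comment> \<open>The squared distance is \<open>a (2 * m) - 2 * a (m + n) + a (2 * n)\<close>.
      The coefficients 1, -2, 1 cancel the limit \<open>l\<close>, and four errors below a quarter
      of the square of \<open>e\<close> remain.\<close>
    have "L2_norm G ((T ^^ m) \<psi> - (T ^^ n) \<psi>) \<le> e" if "m \<ge> N" "n \<ge> N" for m n
    proof (rule power2_le_imp_le)
      have "(L2_norm G ((T ^^ m) \<psi> - (T ^^ n) \<psi>))\<^sup>2 = a (2 * m) - 2 * a (m + n) + a (2 * n)"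
        using L2_norm_diff_squared[OF TL2[OF \<psi>] TL2[OF \<psi>]] by (simp add: inn even)
      moreover have "\<bar>a (2 * m) - l\<bar> < e\<^sup>2 / 4" "\<bar>a (2 * n) - l\<bar> < e\<^sup>2 / 4" "\<bar>a (m + n) - l\<bar> < e\<^sup>2 / 4"
        by (rule N; use that in simp)+
      ultimately show "(L2_norm G ((T ^^ m) \<psi> - (T ^^ n) \<psi>))\<^sup>2 \<le> e\<^sup>2"
        unfolding abs_less_iff by linarith
    qed (use \<open>0 < e\<close> in simp)
    then show "\<exists>N. \<forall>m\<ge>N. \<forall>n\<ge>N. L2_norm G ((T ^^ m) \<psi> - (T ^^ n) \<psi>) \<le> e" by blast
  qed
  define R where "R \<psi> = (if \<psi> \<in> L2 G
    then SOME w. w \<in> L2 G \<and> (\<lambda>n. L2_norm G ((T ^^ n) \<psi> - w)) \<longlonglongrightarrow> 0 else 0)" for \<psi>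
  have R: "R \<psi> \<in> L2 G" "(\<lambda>n. L2_norm G ((T ^^ n) \<psi> - R \<psi>)) \<longlonglongrightarrow> 0" if "\<psi> \<in> L2 G" for \<psi>
    using someI_ex[of "\<lambda>w. w \<in> L2 G \<and> (\<lambda>n. L2_norm G ((T ^^ n) \<psi> - w)) \<longlonglongrightarrow> 0"] lim[OF that] that
    by (auto simp: R_def)
  have R_eqI: "R \<psi> = w"
    if "\<psi> \<in> L2 G" "w \<in> L2 G" "(\<lambda>n. L2_norm G ((T ^^ n) \<psi> - w)) \<longlonglongrightarrow> 0" for \<psi> w
    by (rule L2_limit_unique[of "\<lambda>n. (T ^^ n) \<psi>"]) (use that R TL2 in auto)
  have Rb: "R \<in> bounded_operators G"
  proof (rule bounded_operatorI[where K = 1])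
    fix \<psi> \<phi> a b assume *: "\<psi> \<in> L2 G" "\<phi> \<in> L2 G"
    show "R (\<lambda>\<alpha>. a * \<psi> \<alpha> + b * \<phi> \<alpha>) = (\<lambda>\<alpha>. a * R \<psi> \<alpha> + b * R \<phi> \<alpha>)"
    proof (rule R_eqI)
      have "(\<lambda>n. cmod a * L2_norm G ((T ^^ n) \<psi> - R \<psi>) + cmod b * L2_norm G ((T ^^ n) \<phi> - R \<phi>))
        \<longlonglongrightarrow> cmod a * 0 + cmod b * 0"
        by (intro tendsto_add tendsto_mult_left R *)
      then have z: "(\<lambda>n. cmod a * L2_norm G ((T ^^ n) \<psi> - R \<psi>) + cmod b * L2_norm G ((T ^^ n) \<phi> - R \<phi>))
        \<longlonglongrightarrow> 0" by simp
      show "(\<lambda>n. L2_norm G ((T ^^ n) (\<lambda>\<alpha>. a * \<psi> \<alpha> + b * \<phi> \<alpha>) - (\<lambda>\<alpha>. a * R \<psi> \<alpha> + b * R \<phi> \<alpha>)))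
        \<longlonglongrightarrow> 0"
      proof (rule Lim_null_comparison[OF always_eventually[OF allI] z])
        fix n
        have "(T ^^ n) (\<lambda>\<alpha>. a * \<psi> \<alpha> + b * \<phi> \<alpha>) - (\<lambda>\<alpha>. a * R \<psi> \<alpha> + b * R \<phi> \<alpha>)
          = (\<lambda>\<alpha>. a * ((T ^^ n) \<psi> - R \<psi>) \<alpha>) + (\<lambda>\<alpha>. b * ((T ^^ n) \<phi> - R \<phi>) \<alpha>)"
          unfolding funpow_lincomb[OF T *] by (simp add: fun_eq_iff algebra_simps)
        then show "norm (L2_norm G ((T ^^ n) (\<lambda>\<alpha>. a * \<psi> \<alpha> + b * \<phi> \<alpha>)
            - (\<lambda>\<alpha>. a * R \<psi> \<alpha> + b * R \<phi> \<alpha>)))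
          \<le> cmod a * L2_norm G ((T ^^ n) \<psi> - R \<psi>) + cmod b * L2_norm G ((T ^^ n) \<phi> - R \<phi>)"
          using L2_norm_triangle[of "\<lambda>\<alpha>. a * ((T ^^ n) \<psi> - R \<psi>) \<alpha>" G "\<lambda>\<alpha>. b * ((T ^^ n) \<phi> - R \<phi>) \<alpha>"]
            L2_scale[OF L2_diff[OF TL2[OF *(1)] R(1)[OF *(1)]], of a n]
            L2_scale[OF L2_diff[OF TL2[OF *(2)] R(1)[OF *(2)]], of b n]
          unfolding L2_norm_scale by (simp del: minus_apply)
      qed
    qed (use * R in auto)
  next
    fix \<psi> assume *: "\<psi> \<in> L2 G"
    have "(\<lambda>n. L2_norm G \<psi> + L2_norm G ((T ^^ n) \<psi> - R \<psi>)) \<longlonglongrightarrow> L2_norm G \<psi> + 0"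
      by (intro tendsto_add tendsto_const R *)
    moreover have "L2_norm G (R \<psi>) \<le> L2_norm G \<psi> + L2_norm G ((T ^^ n) \<psi> - R \<psi>)" for n
      using L2_norm_triangle_diff[OF TL2[OF *] L2_diff[OF TL2[OF *] R(1)[OF *]], of n n] Tcontr[OF *, of n]
      by simp
    ultimately have "L2_norm G (R \<psi>) \<le> L2_norm G \<psi> + 0" using LIMSEQ_le_const by blast
    then show "L2_norm G (R \<psi>) \<le> 1 * L2_norm G \<psi>" by simp
  qed (use R in \<open>auto simp: R_def\<close>)
  have sl: "strong_limit G (\<lambda>n. T ^^ n) R"
    using Rb R by (simp add: strong_limit_def fun_diff_def)
  have TR: "T (R \<psi>) = R \<psi>" if "\<psi> \<in> L2 G" for \<psi>
  proof (rule sym, rule R_eqI[OF that])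
    have "(\<lambda>n. L2_norm G (T ((T ^^ n) \<psi>) - T (R \<psi>))) \<longlonglongrightarrow> 0"
      by (intro L2_tendsto_operator[OF T] TL2 R that)
    then have "(\<lambda>n. L2_norm G ((T ^^ Suc n) \<psi> - T (R \<psi>))) \<longlonglongrightarrow> 0" by simp
    then show "(\<lambda>n. L2_norm G ((T ^^ n) \<psi> - T (R \<psi>))) \<longlonglongrightarrow> 0" by (rule LIMSEQ_imp_Suc)
  qed (use T R that in auto)
  have Rfix: "R \<psi> = \<psi>" if "\<psi> \<in> L2 G" "T \<psi> = \<psi>" for \<psi>
  proof (rule R_eqI[OF that(1) that(1)])
    have "(T ^^ n) \<psi> = \<psi>" for n by (induction n) (simp_all add: that)
    then show "(\<lambda>n. L2_norm G ((T ^^ n) \<psi> - \<psi>)) \<longlonglongrightarrow> 0" by simp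
  qed
  show ?thesis
  proof (rule that[OF sl[unfolded T_def]])
    show "is_adjoint G R R" unfolding is_adjoint_def
    proof (intro ballI)
      fix \<psi> \<phi> assume *: "\<psi> \<in> L2 G" "\<phi> \<in> L2 G"
      have "(\<lambda>n. L2_inner G \<psi> ((T ^^ n) \<phi>)) \<longlonglongrightarrow> L2_inner G \<psi> (R \<phi>)"
        by (intro L2_inner_tendsto TL2 R *)
      moreover have "(\<lambda>n. cnj (L2_inner G \<phi> ((T ^^ n) \<psi>))) \<longlonglongrightarrow> cnj (L2_inner G \<phi> (R \<psi>))"
        by (intro tendsto_cnj L2_inner_tendsto TL2 R *)
      then have "(\<lambda>n. L2_inner G ((T ^^ n) \<psi>) \<phi>) \<longlonglongrightarrow> L2_inner G (R \<psi>) \<phi>"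
        unfolding L2_inner_commute[symmetric] .
      ultimately show "L2_inner G (R \<psi>) \<phi> = L2_inner G \<psi> (R \<phi>)"
        unfolding Tn[OF *] using LIMSEQ_unique by blast
    qed
    \<comment> \<open>All values of \<open>R\<close> are fixed by \<open>T\<close>
      (\<open>TR\<close>), and \<open>R\<close> fixes every vector that \<open>T\<close> fixes
      (\<open>Rfix\<close>).\<close>
    show "R \<circ> R = R"
      by (rule bounded_operator_eqI) (use Rb R TR Rfix in auto)
    show "(C \<circ> B) \<circ> R = R" unfolding T_def[symmetric]
      by (rule bounded_operator_eqI) (use Rb R TR Rfix T in auto)
    show "R \<psi> = \<psi>" if "\<psi> \<in> L2 G" "C (B \<psi>) = \<psi>" for \<psi>
      using Rfix[OF that(1)] that(2) by (simp add: CB)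
  qed
qed

section \<open>The lattice operations\<close>

lemma propositionD:
  assumes "P \<in> propositions G"
  shows "P \<in> vN_algebra G" "P \<in> bounded_operators G" "is_adjoint G P P" "P \<circ> P = P" "P (P \<psi>) = P \<psi>"
  using assms by (auto simp: propositions_def dest: fun_cong[of "P \<circ> P" P \<psi>])

lemmas proposition_bounded [simp, intro] = propositionD(2)

lemma proposition_decomp:
  assumes "P \<in> propositions G" "\<psi> \<in> L2 G"
  shows "(L2_norm G (\<psi> - P \<psi>))\<^sup>2 = (L2_norm G \<psi>)\<^sup>2 - (L2_norm G (P \<psi>))\<^sup>2"
proof -
  note P = propositionD[OF assms(1)]
  have P\<psi>: "P \<psi> \<in> L2 G" using P assms by blast
  have "L2_inner G \<psi> (P \<psi>) = L2_inner G (P \<psi>) (P \<psi>)"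
    using adjoint_inner[OF P(3) assms(2) P\<psi>] by (simp add: P)
  then show ?thesis
    using L2_norm_diff_squared[OF assms(2) P\<psi>] by (simp add: L2_inner_self[OF P\<psi>])
qed

lemma proposition_contraction:
  assumes "P \<in> propositions G" "\<psi> \<in> L2 G"
  shows "L2_norm G (P \<psi>) \<le> L2_norm G \<psi>"
proof (rule power2_le_imp_le)
  show "(L2_norm G (P \<psi>))\<^sup>2 \<le> (L2_norm G \<psi>)\<^sup>2"
    using proposition_decomp[OF assms] zero_le_power2[of "L2_norm G (\<psi> - P \<psi>)"] by linarith
qed simp

lemma proposition_fixI:
  assumes "P \<in> propositions G" "\<psi> \<in> L2 G" "L2_norm G \<psi> \<le> L2_norm G (P \<psi>)"
  shows "P \<psi> = \<psi>"
proof -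
  have "L2_norm G (P \<psi>) = L2_norm G \<psi>"
    using proposition_contraction[OF assms(1,2)] assms(3) by linarith
  then have "L2_norm G (\<psi> - P \<psi>) = 0" using proposition_decomp[OF assms(1,2)] by simp
  then have "\<psi> - P \<psi> = 0"
    using L2_norm_eq_0[of "\<psi> - P \<psi>" G] propositionD(2)[OF assms(1)] assms(2) by blast
  then show ?thesis by simp
qed

lemma compl_proposition [simp, intro]:
  assumes "P \<in> propositions G" shows "prop_compl G P \<in> propositions G"
proof -
  note P = propositionD[OF assms]
  have "prop_compl G P \<circ> prop_compl G P = prop_compl G P"
  proof (rule bounded_operator_eqI[where G = G])
    fix \<psi> assume "\<psi> \<in> L2 G"
    then show "(prop_compl G P \<circ> prop_compl G P) \<psi> = prop_compl G P \<psi>"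
      using P(2) by (simp add: prop_compl_apply bounded_operator_diff[OF P(2)] P(5))
  qed (use P in auto)
  then show ?thesis
    using P adjoint_prop_compl[of G P P] by (simp add: propositions_def)
qed

lemma id_op_proposition [simp, intro]: "id_op G \<in> propositions G"
  by (auto simp: propositions_def adjoint_id id_op_def fun_eq_iff)

text \<open>The product \<open>P \<circ> Q\<close> need not be positive, but
  \<open>(P \<circ> Q) \<circ> (Q \<circ> P)\<close> is an operator composed with its adjoint. This
  identity carries the convergence of its powers over to the powers of
  \<open>P \<circ> Q\<close>.\<close>

lemma alternating_powers:
  assumes "P \<circ> P = P" "Q \<circ> Q = Q"
  shows "(P \<circ> Q) ^^ Suc n = (((P \<circ> Q) \<circ> (Q \<circ> P)) ^^ n) \<circ> (P \<circ> Q)"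
proof (induction n)
  case (Suc n)
  have *: "((P \<circ> Q) \<circ> (Q \<circ> P)) \<circ> (P \<circ> Q) = (P \<circ> Q) \<circ> (P \<circ> Q)"
    using assms by (metis comp_assoc)
  have "(P \<circ> Q) ^^ Suc (Suc n) = ((P \<circ> Q) ^^ Suc n) \<circ> (P \<circ> Q)"
    by (simp only: funpow_Suc_right)
  also have "\<dots> = (((P \<circ> Q) \<circ> (Q \<circ> P)) ^^ n) \<circ> ((P \<circ> Q) \<circ> (P \<circ> Q))"
    unfolding Suc by (simp only: comp_assoc)
  also have "\<dots> = (((P \<circ> Q) \<circ> (Q \<circ> P)) ^^ Suc n) \<circ> (P \<circ> Q)"
    unfolding *[symmetric] funpow_Suc_right by (simp only: comp_assoc)
  finally show ?case .
qed simp

lemma prop_meet_eqI: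
  assumes "P \<in> bounded_operators G" "Q \<in> bounded_operators G"
    "strong_limit G (\<lambda>n. (P \<circ> Q) ^^ n) R"
  shows "prop_meet G P Q = R"
  unfolding prop_meet_def
proof (rule the_equality)
  show "strong_limit G (\<lambda>n. (P \<circ> Q) ^^ n) R" by (rule assms(3))
  fix R' assume "strong_limit G (\<lambda>n. (P \<circ> Q) ^^ n) R'"
  then show "R' = R"
    using assms by (intro strong_limit_unique[of G "\<lambda>n. (P \<circ> Q) ^^ n"] funpow_bounded) auto
qed

lemma prop_meet_properties:
  assumes "P \<in> propositions G" "Q \<in> propositions G"
  shows prop_meet_proposition: "prop_meet G P Q \<in> propositions G"
    and prop_meet_left: "P \<circ> prop_meet G P Q = prop_meet G P Q"
    and prop_meet_right: "Q \<circ> prop_meet G P Q = prop_meet G P Q"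
proof -
  note P = propositionD[OF assms(1)] and Q = propositionD[OF assms(2)]
  define T where "T = (P \<circ> Q) \<circ> (Q \<circ> P)"
  have "is_adjoint G (Q \<circ> P) (P \<circ> Q)" by (rule adjoint_comp[OF Q(3) P(3) Q(2) P(2)])
  moreover have "L2_norm G ((Q \<circ> P) \<psi>) \<le> L2_norm G \<psi>" if "\<psi> \<in> L2 G" for \<psi>
    using proposition_contraction[OF assms(1) that]
      proposition_contraction[OF assms(2) bounded_operator_in[OF P(2) that]] by simp
  ultimately obtain R where R: "strong_limit G (\<lambda>n. T ^^ n) R" "is_adjoint G R R" "R \<circ> R = R"
    "T \<circ> R = R" "\<And>\<psi>. \<psi> \<in> L2 G \<Longrightarrow> (P \<circ> Q) ((Q \<circ> P) \<psi>) = \<psi> \<Longrightarrow> R \<psi> = \<psi>"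
    using positive_contraction_limit[of "Q \<circ> P" G "P \<circ> Q"] P Q unfolding T_def by blast
  have Rb: "R \<in> bounded_operators G" using R(1) by (rule strong_limit_bounded)
  have "P \<circ> T = T" unfolding T_def using P(4) by (metis comp_assoc)
  then have PR: "P \<circ> R = R" using R(4) by (metis comp_assoc)
  have fixT: "P (Q (R \<psi>)) = R \<psi>" for \<psi>
    using fun_cong[OF R(4), of \<psi>] fun_cong[OF PR, of \<psi>] by (simp add: T_def Q)
  \<comment> \<open>Since \<open>P (Q (R \<psi>)) = R \<psi>\<close> and \<open>P\<close> is a
    contraction, \<open>Q\<close> does not shrink \<open>R \<psi>\<close>; a projection fixes every
    vector that it does not shrink.\<close>
  have QR: "Q \<circ> R = R"
  proof (rule bounded_operator_eqI[where G = G])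
    fix \<psi> assume "\<psi> \<in> L2 G"
    then have "R \<psi> \<in> L2 G" using Rb by blast
    then have "L2_norm G (P (Q (R \<psi>))) \<le> L2_norm G (Q (R \<psi>))"
      using Q(2) by (intro proposition_contraction[OF assms(1)]) blast
    then have "Q (R \<psi>) = R \<psi>"
      unfolding fixT by (rule proposition_fixI[OF assms(2) \<open>R \<psi> \<in> L2 G\<close>])
    then show "(Q \<circ> R) \<psi> = R \<psi>" by simp
  qed (use Q Rb in auto)
  \<comment> \<open>Passing to adjoints turns absorption on the left into absorption on the
    right.\<close>
  have adj: "R \<circ> S = R" if "is_adjoint G S S" "S \<in> bounded_operators G" "S \<circ> R = R" for S
    using adjoint_unique[of G "S \<circ> R" "R \<circ> S" R] adjoint_comp[OF that(1) R(2) that(2) Rb] that R(2) Rb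
    by auto
  have RPQ: "R \<circ> (P \<circ> Q) = R"
    using adj[OF P(3,2) PR] adj[OF Q(3,2) QR] by (metis comp_assoc)
  \<comment> \<open>By \<open>alternating_powers\<close>, \<open>(P \<circ> Q) ^^ Suc n\<close> is
    \<open>T ^^ n\<close> applied after \<open>P \<circ> Q\<close>, so it tends to
    \<open>R \<circ> (P \<circ> Q)\<close>, which is \<open>R\<close> by \<open>RPQ\<close>.\<close>
  have "strong_limit G (\<lambda>n. (P \<circ> Q) ^^ n) R"
    unfolding strong_limit_def
  proof (intro conjI ballI Rb)
    fix \<psi> assume "\<psi> \<in> L2 G"
    then have "(P \<circ> Q) \<psi> \<in> L2 G" using P Q by auto
    from strong_limit_tendsto[OF R(1) this]
    have "(\<lambda>n. L2_norm G (((P \<circ> Q) ^^ Suc n) \<psi> - R \<psi>)) \<longlonglongrightarrow> 0"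
      unfolding alternating_powers[OF P(4) Q(4)] T_def[symmetric]
      using fun_cong[OF RPQ, of \<psi>] by simp
    then show "(\<lambda>n. L2_norm G (\<lambda>\<alpha>. ((P \<circ> Q) ^^ n) \<psi> \<alpha> - R \<psi> \<alpha>)) \<longlonglongrightarrow> 0"
      unfolding fun_diff_def by (rule LIMSEQ_imp_Suc)
  qed
  then have eq: "prop_meet G P Q = R" using P Q by (intro prop_meet_eqI) auto
  have Tv: "T \<in> vN_algebra G" unfolding T_def using P(1) Q(1) by (intro vN_comp)
  then have "R \<in> vN_algebra G" using R(1) by (rule strong_limit_powers_vN)
  then show "prop_meet G P Q \<in> propositions G" using R by (simp add: eq propositions_def)
  show "P \<circ> prop_meet G P Q = prop_meet G P Q" "Q \<circ> prop_meet G P Q = prop_meet G P Q"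
    using PR QR by (simp_all add: eq)
qed

section \<open>Commuting propositions and the distributive laws\<close>

lemma proposition_absorb_sym:
  assumes "P \<in> propositions G" "R \<in> propositions G" "P \<circ> R = R"
  shows "R \<circ> P = R"
  using adjoint_unique[of G "P \<circ> R" "R \<circ> P" R] adjoint_comp[of G P P R R]
    propositionD[OF assms(1)] propositionD[OF assms(2)] assms(3) by auto

lemma comp_proposition:
  assumes "P \<in> propositions G" "Q \<in> propositions G" "P \<circ> Q = Q \<circ> P"
  shows "P \<circ> Q \<in> propositions G"
proof -
  note P = propositionD[OF assms(1)] and Q = propositionD[OF assms(2)]
  have "is_adjoint G (P \<circ> Q) (P \<circ> Q)"
    using adjoint_comp[OF P(3) Q(3) P(2) Q(2)] assms(3) by simp
  moreover have "(P \<circ> Q) \<circ> (P \<circ> Q) = P \<circ> Q"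
    using P(4) Q(4) assms(3) by (metis comp_assoc)
  ultimately show ?thesis using P Q by (simp add: propositions_def)
qed

lemma prop_meet_commuting:
  assumes "P \<in> propositions G" "Q \<in> propositions G" "P \<circ> Q = Q \<circ> P"
  shows "prop_meet G P Q = P \<circ> Q"
proof (rule prop_meet_eqI)
  note PQ = propositionD[OF comp_proposition[OF assms]]
  define T where "T = P \<circ> Q"
  have "T ^^ Suc n = T" for n
    by (induction n) (use PQ(4) in \<open>simp_all only: funpow.simps comp_id T_def\<close>)
  then have "(\<lambda>n. L2_norm G (\<lambda>\<alpha>. (T ^^ Suc n) \<psi> \<alpha> - T \<psi> \<alpha>)) \<longlonglongrightarrow> 0" for \<psi>
    by (simp del: funpow.simps)
  from LIMSEQ_imp_Suc[OF this] show "strong_limit G (\<lambda>n. (P \<circ> Q) ^^ n) (P \<circ> Q)"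
    using PQ(2) unfolding strong_limit_def T_def by blast
qed (use assms propositionD in auto)

lemma compl_commute:
  assumes "P \<in> bounded_operators G" "Q \<in> bounded_operators G" "P \<circ> Q = Q \<circ> P"
  shows "prop_compl G P \<circ> Q = Q \<circ> prop_compl G P"
proof (rule bounded_operator_eqI[where G = G])
  fix \<psi> assume "\<psi> \<in> L2 G"
  then show "(prop_compl G P \<circ> Q) \<psi> = (Q \<circ> prop_compl G P) \<psi>"
    using assms(1,2) fun_cong[OF assms(3), of \<psi>]
    by (simp add: prop_compl_apply bounded_operator_diff[OF assms(2)] bounded_operator_in)
qed (use assms in auto)

lemma prop_join_commuting:
  assumes "P \<in> propositions G" "Q \<in> propositions G" "P \<circ> Q = Q \<circ> P"
  shows "prop_join G P Q \<in> propositions G"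
    and "\<psi> \<in> L2 G \<Longrightarrow> prop_join G P Q \<psi> = P \<psi> + Q \<psi> - P (Q \<psi>)"
proof -
  note P = propositionD[OF assms(1)] and Q = propositionD[OF assms(2)]
  have c: "prop_compl G P \<circ> prop_compl G Q = prop_compl G Q \<circ> prop_compl G P"
    using compl_commute[OF P(2) _ compl_commute[OF Q(2) P(2) assms(3)[symmetric], symmetric]] Q by blast
  have eq: "prop_join G P Q = prop_compl G (prop_compl G P \<circ> prop_compl G Q)"
    unfolding prop_join_def using prop_meet_commuting[of _ G, OF _ _ c] assms(1,2) by simp
  show "prop_join G P Q \<in> propositions G"
    unfolding eq using comp_proposition[OF _ _ c] assms(1,2) by blast
  show "prop_join G P Q \<psi> = P \<psi> + Q \<psi> - P (Q \<psi>)" if "\<psi> \<in> L2 G"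
    unfolding eq using that P(2) Q(2)
    by (simp add: prop_compl_apply bounded_operator_diff[OF P(2)])
qed

lemma commuting_imp_boolean:
  assumes comm: "\<And>P Q. P \<in> propositions G \<Longrightarrow> Q \<in> propositions G \<Longrightarrow> P \<circ> Q = Q \<circ> P"
  shows "boolean_propositions G"
  unfolding boolean_propositions_def
proof (intro ballI conjI)
  fix P Q R assume PQR: "P \<in> propositions G" "Q \<in> propositions G" "R \<in> propositions G"
  note P = propositionD[OF PQR(1)] and Q = propositionD[OF PQR(2)] and R = propositionD[OF PQR(3)]
  have pt: "Q (P \<psi>) = P (Q \<psi>)" "R (P \<psi>) = P (R \<psi>)" "R (Q \<psi>) = Q (R \<psi>)" for \<psi>
    using comm[OF PQR(1,2)] comm[OF PQR(1,3)] comm[OF PQR(2,3)] by (auto simp: fun_eq_iff)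
  note meet = prop_meet_commuting[OF _ _ comm] and join = prop_join_commuting[OF _ _ comm]
  have cp: "S \<circ> S' \<in> propositions G" if "S \<in> propositions G" "S' \<in> propositions G" for S S'
    using comp_proposition[OF that comm[OF that]] .
  note simps = P(5) Q(5) R(5) pt bounded_operator_add[OF P(2)] bounded_operator_diff[OF P(2)]
    bounded_operator_add[OF Q(2)] bounded_operator_diff[OF Q(2)]
    bounded_operator_add[OF R(2)] bounded_operator_diff[OF R(2)]
    bounded_operator_in[OF P(2)] bounded_operator_in[OF Q(2)] bounded_operator_in[OF R(2)]
  have mem: "prop_join G P Q \<in> propositions G" "prop_join G P R \<in> propositions G"
    "prop_join G Q R \<in> propositions G" "Q \<circ> R \<in> propositions G" "P \<circ> Q \<in> propositions G"
    "P \<circ> R \<in> propositions G"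
    using PQR join(1) cp by blast+
  have "prop_join G P (Q \<circ> R) = prop_join G P Q \<circ> prop_join G P R"
  proof (rule bounded_operator_eqI[where G = G])
    fix \<psi> assume \<psi>: "\<psi> \<in> L2 G"
    have "prop_join G P R \<psi> \<in> L2 G" using mem propositionD(2) \<psi> by blast
    then show "prop_join G P (Q \<circ> R) \<psi> = (prop_join G P Q \<circ> prop_join G P R) \<psi>"
      using \<psi> PQR mem by (simp add: join simps)
  qed (auto intro: PQR mem cp join(1) proposition_bounded)
  then show "prop_join G P (prop_meet G Q R) = prop_meet G (prop_join G P Q) (prop_join G P R)"
    using PQR mem by (simp add: meet)
  have "P \<circ> prop_join G Q R = prop_join G (P \<circ> Q) (P \<circ> R)"
  proof (rule bounded_operator_eqI[where G = G])
    fix \<psi> assume \<psi>: "\<psi> \<in> L2 G"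
    then show "(P \<circ> prop_join G Q R) \<psi> = prop_join G (P \<circ> Q) (P \<circ> R) \<psi>"
      using PQR mem by (simp add: join simps)
  qed (auto intro: PQR mem cp join(1) proposition_bounded)
  then show "prop_meet G P (prop_join G Q R) = prop_join G (prop_meet G P Q) (prop_meet G P R)"
    using PQR mem by (simp add: meet)
qed

text \<open>\<open>R\<close> is absorbed by \<open>Q\<close> and \<open>S\<close> by the complement
  of \<open>Q\<close>, so \<open>R\<close> and \<open>S\<close> are orthogonal and their join is
  \<open>R + S\<close>. Distributivity identifies this sum with \<open>P\<close>, and multiplying it
  by \<open>Q\<close> on either side leaves \<open>R\<close>.\<close>

lemma boolean_imp_commuting:
  assumes bool: "boolean_propositions G" and PQ: "P \<in> propositions G" "Q \<in> propositions G"
  shows "P \<circ> Q = Q \<circ> P"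
proof -
  note P = propositionD[OF PQ(1)] and Q = propositionD[OF PQ(2)]
  define Q' where "Q' = prop_compl G Q"
  have Q': "Q' \<in> propositions G" using PQ by (simp add: Q'_def)
  define R S where "R = prop_meet G P Q" and "S = prop_meet G P Q'"
  have R: "R \<in> propositions G" "P \<circ> R = R" "Q \<circ> R = R"
    and S: "S \<in> propositions G" "P \<circ> S = S" "Q' \<circ> S = S"
    using prop_meet_properties PQ Q' by (auto simp: R_def S_def)
  have QQ': "Q (Q' \<psi>) = 0" if "\<psi> \<in> L2 G" for \<psi>
    using that Q(2) by (simp add: Q'_def prop_compl_apply bounded_operator_diff[OF Q(2)] Q)
  have QS: "Q (S \<psi>) = 0" if "\<psi> \<in> L2 G" for \<psi>
    using QQ'[of "S \<psi>"] that fun_cong[OF S(3), of \<psi>] propositionD(2)[OF S(1)] by simp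
  have RQ: "R \<circ> Q = R" by (rule proposition_absorb_sym[OF PQ(2) R(1,3)])
  have RS: "R (S \<psi>) = 0" if "\<psi> \<in> L2 G" for \<psi>
    using fun_cong[OF RQ, of "S \<psi>"] QS[OF that] bounded_operator_zero(1)[OF propositionD(2)[OF R(1)]]
    by simp
  have SQ: "S (Q \<psi>) = 0" if "\<psi> \<in> L2 G" for \<psi>
  proof -
    have "S (Q' (Q \<psi>)) = S (Q \<psi>)"
      using fun_cong[OF proposition_absorb_sym[OF Q' S(1,3)]] by simp
    moreover have "Q' (Q \<psi>) = 0" using that Q by (simp add: Q'_def prop_compl_apply)
    ultimately show ?thesis using bounded_operator_zero(1)[OF propositionD(2)[OF S(1)]] by simp
  qed
  have SR: "S (R \<psi>) = 0" if "\<psi> \<in> L2 G" for \<psi>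
    using SQ[of "R \<psi>"] that fun_cong[OF R(3), of \<psi>] propositionD(2)[OF R(1)] by simp
  \<comment> \<open>The formula for joins is available for commuting pairs; here both products
    vanish.\<close>
  have cRS: "R \<circ> S = S \<circ> R"
    by (rule bounded_operator_eqI[where G = G]) (use R S RS SR propositionD(2) in auto)
  have cQQ': "Q \<circ> Q' = Q' \<circ> Q"
    unfolding Q'_def using compl_commute[OF Q(2) Q(2)] by simp
  have "prop_join G Q Q' = id_op G"
  proof (rule bounded_operator_eqI[where G = G])
    fix \<psi> assume "\<psi> \<in> L2 G"
    then show "prop_join G Q Q' \<psi> = id_op G \<psi>"
      using prop_join_commuting(2)[OF PQ(2) Q' cQQ'] QQ' Q(2)
      by (simp add: Q'_def prop_compl_apply id_op_def)
  qed (use prop_join_commuting(1)[OF PQ(2) Q' cQQ'] propositionD(2) in auto)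
  moreover have Pid: "P \<circ> id_op G = P" "id_op G \<circ> P = P"
    by (rule bounded_operator_eqI[where G = G]; use P in \<open>auto simp: id_op_def\<close>)+
  ultimately have "prop_meet G P (prop_join G Q Q') = P"
    using prop_meet_commuting[OF PQ(1) id_op_proposition] by simp
  moreover have "prop_meet G P (prop_join G Q Q') = prop_join G R S"
    using bool PQ Q' unfolding boolean_propositions_def R_def S_def by blast
  ultimately have join: "P = prop_join G R S" by simp
  have P_eq: "P \<psi> = R \<psi> + S \<psi>" if "\<psi> \<in> L2 G" for \<psi>
    unfolding join using prop_join_commuting(2)[OF R(1) S(1) cRS that] RS[OF that] by simp
  show ?thesis
  proof (rule bounded_operator_eqI[where G = G])
    fix \<psi> assume \<psi>: "\<psi> \<in> L2 G"
    have R\<psi>: "R \<psi> \<in> L2 G" "S \<psi> \<in> L2 G" "Q \<psi> \<in> L2 G" using R S Q propositionD(2) \<psi> by blast+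
    have "P (Q \<psi>) = R \<psi>"
      using P_eq[OF R\<psi>(3)] SQ[OF \<psi>] fun_cong[OF RQ, of \<psi>] by simp
    moreover have "Q (P \<psi>) = R \<psi>"
      using P_eq[OF \<psi>] QS[OF \<psi>] fun_cong[OF R(3), of \<psi>] bounded_operator_add[OF Q(2) R\<psi>(1,2)] by simp
    ultimately show "(P \<circ> Q) \<psi> = (Q \<circ> P) \<psi>" by simp
  qed (use P Q in auto)
qed

text \<open>The operator \<open>T = 1 - D' \<circ> D\<close> is a self-adjoint contraction that
  moves exactly the vectors outside the kernel of \<open>D\<close>. Its square has the form required
  by \<open>positive_contraction_limit\<close>, and the powers of this square converge to the
  projection onto the kernel.\<close>

lemma null_space_proposition:
  assumes D: "D \<in> vN_algebra G" and D': "D' \<in> vN_algebra G" and adj: "is_adjoint G D D'"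
    and contr: "\<And>\<psi>. \<psi> \<in> L2 G \<Longrightarrow> L2_norm G (D \<psi>) \<le> L2_norm G \<psi>"
  obtains R where "R \<in> propositions G"
    "\<And>\<psi>. \<psi> \<in> L2 G \<Longrightarrow> R \<psi> = \<psi> \<longleftrightarrow> D \<psi> = 0"
proof -
  define T where "T = prop_compl G (D' \<circ> D)"
  note Db = vN_algebra_bounded[OF D] vN_algebra_bounded[OF D']
  have Tv: "T \<in> vN_algebra G" using D D' by (simp add: T_def)
  have Tadj: "is_adjoint G T T"
    unfolding T_def using Db adj adjoint_sym[OF adj] by (intro adjoint_prop_compl adjoint_comp) auto
  have T_apply: "T \<psi> = \<psi> - D' (D \<psi>)" if "\<psi> \<in> L2 G" for \<psi>
    using that by (simp add: T_def prop_compl_apply)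
  \<comment> \<open>Expanding the square subtracts the squared norm of \<open>D \<psi>\<close> twice
    and adds that of \<open>D' (D \<psi>)\<close>, which is no larger because \<open>D'\<close> is a
    contraction.\<close>
  have T_norm: "(L2_norm G (T \<psi>))\<^sup>2 \<le> (L2_norm G \<psi>)\<^sup>2 - (L2_norm G (D \<psi>))\<^sup>2"
    if \<psi>: "\<psi> \<in> L2 G" for \<psi>
  proof -
    have in2: "D \<psi> \<in> L2 G" "D' (D \<psi>) \<in> L2 G" using Db \<psi> by auto
    have "L2_inner G \<psi> (D' (D \<psi>)) = L2_inner G (D \<psi>) (D \<psi>)"
      using adjoint_inner[OF adj \<psi> in2(1)] by simp
    then have "(L2_norm G (T \<psi>))\<^sup>2
      = (L2_norm G \<psi>)\<^sup>2 - 2 * (L2_norm G (D \<psi>))\<^sup>2 + (L2_norm G (D' (D \<psi>)))\<^sup>2"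
      unfolding T_apply[OF \<psi>] using L2_norm_diff_squared[OF \<psi> in2(2)]
      by (simp add: L2_inner_self[OF in2(1)])
    moreover have "(L2_norm G (D' (D \<psi>)))\<^sup>2 \<le> (L2_norm G (D \<psi>))\<^sup>2"
      by (intro power_mono adjoint_contraction[OF Db adj contr in2(1)]) auto
    ultimately show ?thesis by linarith
  qed
  have T_contr: "L2_norm G (T \<psi>) \<le> L2_norm G \<psi>" if "\<psi> \<in> L2 G" for \<psi>
  proof (rule power2_le_imp_le)
    show "(L2_norm G (T \<psi>))\<^sup>2 \<le> (L2_norm G \<psi>)\<^sup>2"
      using T_norm[OF that] zero_le_power2[of "L2_norm G (D \<psi>)"] by linarith
  qed simp
  note Tb = vN_algebra_bounded[OF Tv]
  obtain R where R: "strong_limit G (\<lambda>n. (T \<circ> T) ^^ n) R" "is_adjoint G R R" "R \<circ> R = R"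
    "(T \<circ> T) \<circ> R = R" "\<And>\<psi>. \<psi> \<in> L2 G \<Longrightarrow> T (T \<psi>) = \<psi> \<Longrightarrow> R \<psi> = \<psi>"
    using positive_contraction_limit[OF Tb Tb Tadj T_contr] by blast
  have Rp: "R \<in> propositions G"
    using strong_limit_powers_vN[OF _ R(1)] Tv R(2,3) by (simp add: propositions_def)
  have "D \<psi> = 0" if "\<psi> \<in> L2 G" "R \<psi> = \<psi>" for \<psi>
  proof -
    \<comment> \<open>A vector fixed by \<open>T \<circ> T\<close> loses no norm under
      \<open>T\<close>, so \<open>T_norm\<close> leaves no room for \<open>D \<psi>\<close>.\<close>
    have "T (T \<psi>) = \<psi>" using fun_cong[OF R(4), of \<psi>] that(2) by simp
    then have "L2_norm G \<psi> \<le> L2_norm G (T \<psi>)"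
      using T_contr[OF bounded_operator_in[OF Tb that(1)]] by simp
    then have "(L2_norm G \<psi>)\<^sup>2 \<le> (L2_norm G (T \<psi>))\<^sup>2" by (intro power_mono) auto
    then have "(L2_norm G (D \<psi>))\<^sup>2 \<le> 0" using T_norm[OF that(1)] by linarith
    then have "L2_norm G (D \<psi>) = 0" by simp
    then show ?thesis by (rule L2_norm_eq_0[OF bounded_operator_in[OF Db(1) that(1)]])
  qed
  moreover have "R \<psi> = \<psi>" if "\<psi> \<in> L2 G" "D \<psi> = 0" for \<psi>
    using that R(5)[OF that(1)] T_apply[OF that(1)] bounded_operator_zero(1)[OF Db(2)] by simp
  ultimately show ?thesis using that[OF Rp] by blast
qed

text \<open>If the corner \<open>Y = (1 - P) X P\<close> were nonzero, the projection onto the graph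
  \<open>{v + Y v | v \<in> ran P}\<close>, which is the kernel of \<open>1 - P - Y\<close>, would not commute with \<open>P\<close>.\<close>

lemma proposition_corner:
  assumes comm: "\<And>P Q. P \<in> propositions G \<Longrightarrow> Q \<in> propositions G \<Longrightarrow> P \<circ> Q = Q \<circ> P"
    and P: "P \<in> propositions G"
    and X: "X \<in> vN_algebra G" and X': "X' \<in> vN_algebra G" and adj: "is_adjoint G X X'"
    and contr: "\<And>\<psi>. \<psi> \<in> L2 G \<Longrightarrow> L2_norm G (X \<psi>) \<le> L2_norm G \<psi>"
    and \<psi>: "\<psi> \<in> L2 G"
  shows "P (X (P \<psi>)) = X (P \<psi>)"
proof -
  note Pp = propositionD[OF P]
  define P' where "P' = prop_compl G P"
  have P': "P' \<in> propositions G" using P by (simp add: P'_def)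
  note Xb = vN_algebra_bounded[OF X] vN_algebra_bounded[OF X']
  \<comment> \<open>This is \<open>(1 - X P) / 2\<close>; the factor \<open>1/2\<close> makes it a
    contraction, since \<open>X P\<close> is one. Composed with \<open>P'\<close> it gives
    \<open>(1 - P - Y) / 2\<close>, whose kernel is the graph of \<open>Y\<close>, and
    \<open>E'\<close> is its adjoint before that composition.\<close>
  define E where "E = op_lincomb (1/2) (id_op G) (-1/2) (X \<circ> P)"
  define E' where "E' = op_lincomb (1/2) (id_op G) (-1/2) (P \<circ> X')"
  have Ev: "E \<in> vN_algebra G" "E' \<in> vN_algebra G"
    unfolding E_def E'_def using X X' Pp(1) by simp_all
  have Eadj: "is_adjoint G E E'"
    using adjoint_lincomb[of G "id_op G" "id_op G" "X \<circ> P" "P \<circ> X'" "1/2" "-1/2",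
        OF adjoint_id adjoint_comp[OF adj Pp(3) Xb(2) Pp(2)]] Xb Pp(2)
    by (simp add: E_def E'_def)
  have E_contr: "L2_norm G (E \<phi>) \<le> L2_norm G \<phi>" if \<phi>: "\<phi> \<in> L2 G" for \<phi>
  proof -
    have in2: "X (P \<phi>) \<in> L2 G" using Xb(1) Pp(2) \<phi> by blast
    have "E \<phi> = (\<lambda>\<alpha>. 1/2 * \<phi> \<alpha>) + (\<lambda>\<alpha>. -1/2 * X (P \<phi>) \<alpha>)"
      using \<phi> by (simp add: E_def op_lincomb_def id_op_def fun_eq_iff)
    then have "L2_norm G (E \<phi>) \<le> 1/2 * L2_norm G \<phi> + 1/2 * L2_norm G (X (P \<phi>))"
      using L2_norm_triangle[OF L2_scale[OF \<phi>, of "1/2"] L2_scale[OF in2, of "-1/2"]]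
      unfolding L2_norm_scale by (simp add: norm_divide)
    moreover have "L2_norm G (X (P \<phi>)) \<le> L2_norm G \<phi>"
      using contr[OF bounded_operator_in[OF Pp(2) \<phi>]] proposition_contraction[OF P \<phi>] by linarith
    ultimately show ?thesis by linarith
  qed
  define D where "D = P' \<circ> E"
  note Eb = vN_algebra_bounded[OF Ev(1)] vN_algebra_bounded[OF Ev(2)]
  have "L2_norm G (D \<phi>) \<le> L2_norm G \<phi>" if \<phi>: "\<phi> \<in> L2 G" for \<phi>
    using proposition_contraction[OF P' bounded_operator_in[OF Eb(1) \<phi>]] E_contr[OF \<phi>]
    by (simp add: D_def)
  then obtain R where R: "R \<in> propositions G" "\<And>\<psi>. \<psi> \<in> L2 G \<Longrightarrow> R \<psi> = \<psi> \<longleftrightarrow> D \<psi> = 0"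
    using null_space_proposition[of D G "E' \<circ> P'"] Ev propositionD[OF P']
      adjoint_comp[OF propositionD(3)[OF P'] Eadj propositionD(2)[OF P'] Eb(1)]
    by (auto simp: D_def)
  define v where "v = P \<psi>"
  \<comment> \<open>The point of the graph above \<open>v\<close>, as
    \<open>Y v = P' (X v)\<close>.\<close>
  define w where "w = v + P' (X v)"
  have v: "v \<in> L2 G" "P v = v" using Pp \<psi> by (auto simp: v_def)
  have P'v: "P' v = 0" using v by (simp add: P'_def prop_compl_apply)
  have Xv: "X v \<in> L2 G" "P' (X v) \<in> L2 G" using Xb P' v by auto
  have PP': "P (P' (X v)) = 0"
    using Xv Pp(2) by (simp add: P'_def prop_compl_apply bounded_operator_diff[OF Pp(2)] Pp(5))
  have w: "w \<in> L2 G" "P w = v" using v Xv by (simp_all add: w_def bounded_operator_add[OF Pp(2)] PP')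
  have E_apply: "E \<phi> = (\<lambda>\<alpha>. 1/2 * (\<phi> - X (P \<phi>)) \<alpha>)" if "\<phi> \<in> L2 G" for \<phi>
    using that by (simp add: E_def op_lincomb_def id_op_def fun_eq_iff algebra_simps)
  have D_apply: "D \<phi> = (\<lambda>\<alpha>. 1/2 * (P' \<phi> - P' (X (P \<phi>))) \<alpha>)" if "\<phi> \<in> L2 G" for \<phi>
  proof -
    have "X (P \<phi>) \<in> L2 G" using Xb(1) Pp(2) that by blast
    then show ?thesis
      using bounded_operator_scale[OF propositionD(2)[OF P'], of "\<phi> - X (P \<phi>)" "1/2"] that
        bounded_operator_diff[OF propositionD(2)[OF P']]
      by (simp add: D_def E_apply del: minus_apply)
  qed
  have "D w = 0"
    unfolding D_apply[OF w(1)] w(2) using bounded_operator_add[OF propositionD(2)[OF P'] v(1) Xv(2)]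
    by (simp add: w_def P'v propositionD(5)[OF P'] fun_eq_iff)
  then have "R w = w" using R(2)[OF w(1)] by blast
  \<comment> \<open>Commutation gives \<open>R (P w) = P (R w) = P w\<close>. So \<open>v\<close>
    itself lies on the graph, which forces \<open>Y v = 0\<close>.\<close>
  then have "R v = v"
    using fun_cong[OF comm[OF R(1) P], of w] w(2) by simp
  then have "D v = 0" using R(2)[OF v(1)] by blast
  then have "P' (X v) = 0"
    unfolding D_apply[OF v(1)] v(2) P'v by (simp add: fun_eq_iff)
  then show ?thesis
    using Xv by (simp add: P'_def prop_compl_apply v_def)
qed

text \<open>The corner lemma applies to \<open>X\<close> and to its adjoint. It yields
  \<open>P X P = X P\<close> and \<open>P X' P = X' P\<close>; the adjoint of the second equation
  reads \<open>P X P = P X\<close>.\<close>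

lemma proposition_central:
  assumes comm: "\<And>P Q. P \<in> propositions G \<Longrightarrow> Q \<in> propositions G \<Longrightarrow> P \<circ> Q = Q \<circ> P"
    and P: "P \<in> propositions G"
    and X: "X \<in> vN_algebra G" and X': "X' \<in> vN_algebra G" and adj: "is_adjoint G X X'"
    and contr: "\<And>\<psi>. \<psi> \<in> L2 G \<Longrightarrow> L2_norm G (X \<psi>) \<le> L2_norm G \<psi>"
  shows "P \<circ> X = X \<circ> P"
proof -
  note Pp = propositionD[OF P]
  note Xb = vN_algebra_bounded[OF X] vN_algebra_bounded[OF X']
  have contr': "L2_norm G (X' \<psi>) \<le> L2_norm G \<psi>" if "\<psi> \<in> L2 G" for \<psi>
    by (rule adjoint_contraction[OF Xb adj contr that])
  have 1: "P \<circ> (X \<circ> P) = X \<circ> P"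
    by (rule bounded_operator_eqI[where G = G])
       (use Pp Xb proposition_corner[OF comm P X X' adj contr] in auto)
  have 2: "P \<circ> (X' \<circ> P) = X' \<circ> P"
    by (rule bounded_operator_eqI[where G = G])
       (use Pp Xb proposition_corner[OF comm P X' X adjoint_sym[OF adj] contr'] in auto)
  have a: "is_adjoint G (X' \<circ> P) (P \<circ> X)"
    using adjoint_comp[OF adjoint_sym[OF adj] Pp(3) Xb(1) Pp(2)] .
  have "is_adjoint G (P \<circ> (X' \<circ> P)) ((P \<circ> X) \<circ> P)"
    using adjoint_comp[OF Pp(3) a Pp(2)] Xb Pp by blast
  then have "(P \<circ> X) \<circ> P = P \<circ> X"
    unfolding 2 using adjoint_unique[OF _ a] Xb Pp by blast
  then show ?thesis using 1 by (simp add: comp_assoc)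
qed

section \<open>Expansion along the standard basis\<close>

text \<open>On a truncation of \<open>\<psi>\<close> to a finite set the expansion is linearity. By
  Pythagoras the squared norm of the remainder is that of \<open>\<psi>\<close> minus a partial sum,
  so it tends to 0, and boundedness of \<open>f\<close> concludes. The lemma serves both point
  evaluations of operators and inner products with a fixed vector.\<close>

lemma L2_functional_has_sum:
  fixes f :: "('g \<Rightarrow> complex) \<Rightarrow> complex"
  assumes lin: "\<And>\<psi> \<phi> a b. \<psi> \<in> L2 G \<Longrightarrow> \<phi> \<in> L2 G \<Longrightarrow>
      f (\<lambda>\<alpha>. a * \<psi> \<alpha> + b * \<phi> \<alpha>) = a * f \<psi> + b * f \<phi>"
    and bound: "\<And>\<psi>. \<psi> \<in> L2 G \<Longrightarrow> cmod (f \<psi>) \<le> K * L2_norm G \<psi>"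
    and \<psi>: "\<psi> \<in> L2 G"
  shows "((\<lambda>\<gamma>. \<psi> \<gamma> * f (delta \<gamma>)) has_sum f \<psi>) (arrs G)"
proof -
  define trunc where "trunc F = (\<lambda>\<alpha>. if \<alpha> \<in> F then \<psi> \<alpha> else 0)" for F
  have trunc_L2: "trunc F \<in> L2 G" if "finite F" "F \<subseteq> arrs G" for F
    by (rule finite_support_L2) (use that in \<open>auto simp: trunc_def elim: finite_subset[rotated]\<close>)
  have f0: "f (\<lambda>\<alpha>. 0) = 0" using lin[OF L2_zero(2) L2_zero(2), of 0 0] by simp
  have f_trunc: "f (trunc F) = (\<Sum>\<gamma>\<in>F. \<psi> \<gamma> * f (delta \<gamma>))" if "finite F" "F \<subseteq> arrs G" for F
    using that
  proof (induction F)
    case (insert \<gamma> F)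
    have "trunc (insert \<gamma> F) = (\<lambda>\<alpha>. \<psi> \<gamma> * delta \<gamma> \<alpha> + 1 * trunc F \<alpha>)"
      using insert by (auto simp: trunc_def delta_def fun_eq_iff)
    then show ?case
      using lin[of "delta \<gamma>" "trunc F" "\<psi> \<gamma>" 1] trunc_L2[of F] insert by simp
  qed (simp add: trunc_def f0)
  have norm_trunc: "(L2_norm G (\<psi> - trunc F))\<^sup>2 = (L2_norm G \<psi>)\<^sup>2 - (\<Sum>\<alpha>\<in>F. (cmod (\<psi> \<alpha>))\<^sup>2)"
    if F: "finite F" "F \<subseteq> arrs G" for F
  proof -
    have "L2_inner G \<psi> (trunc F) = (\<Sum>\<^sub>\<infinity>\<alpha>\<in>F. cnj (\<psi> \<alpha>) * \<psi> \<alpha>)"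
      unfolding L2_inner_def by (rule infsum_cong_neutral) (use F in \<open>auto simp: trunc_def\<close>)
    also have "\<dots> = complex_of_real (\<Sum>\<alpha>\<in>F. (cmod (\<psi> \<alpha>))\<^sup>2)"
      using F by (simp add: complex_norm_square mult.commute del: of_real_power)
    finally have 1: "L2_inner G \<psi> (trunc F) = complex_of_real (\<Sum>\<alpha>\<in>F. (cmod (\<psi> \<alpha>))\<^sup>2)" .
    have "(L2_norm G (trunc F))\<^sup>2 = (\<Sum>\<^sub>\<infinity>\<alpha>\<in>F. (cmod (\<psi> \<alpha>))\<^sup>2)"
      unfolding L2_norm_squared by (rule infsum_cong_neutral) (use F in \<open>auto simp: trunc_def\<close>)
    then have 2: "(L2_norm G (trunc F))\<^sup>2 = (\<Sum>\<alpha>\<in>F. (cmod (\<psi> \<alpha>))\<^sup>2)" using F by simp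
    show ?thesis using L2_norm_diff_squared[OF \<psi> trunc_L2[OF F]] 1 2 by simp
  qed
  have "((\<lambda>F. (L2_norm G \<psi>)\<^sup>2 - (\<Sum>\<alpha>\<in>F. (cmod (\<psi> \<alpha>))\<^sup>2)) \<longlongrightarrow> (L2_norm G \<psi>)\<^sup>2 - (L2_norm G \<psi>)\<^sup>2)
    (finite_subsets_at_top (arrs G))"
    unfolding L2_norm_squared
    by (intro tendsto_diff tendsto_const infsum_tendsto L2_summable \<psi>)
  then have "((\<lambda>F. sqrt ((L2_norm G \<psi>)\<^sup>2 - (\<Sum>\<alpha>\<in>F. (cmod (\<psi> \<alpha>))\<^sup>2))) \<longlongrightarrow> sqrt 0)
    (finite_subsets_at_top (arrs G))" by (intro tendsto_real_sqrt) simp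
  from tendsto_mult_right_zero[OF this[unfolded real_sqrt_zero], of K]
  have lim: "((\<lambda>F. K * sqrt ((L2_norm G \<psi>)\<^sup>2 - (\<Sum>\<alpha>\<in>F. (cmod (\<psi> \<alpha>))\<^sup>2))) \<longlongrightarrow> 0)
    (finite_subsets_at_top (arrs G))" .
  have "((\<lambda>F. (\<Sum>\<gamma>\<in>F. \<psi> \<gamma> * f (delta \<gamma>)) - f \<psi>) \<longlongrightarrow> 0) (finite_subsets_at_top (arrs G))"
  proof (rule Lim_null_comparison[OF eventually_finite_subsets_at_top_weakI lim])
    fix F assume F: "finite F" "F \<subseteq> arrs G"
    have "\<psi> - trunc F = (\<lambda>\<alpha>. 1 * \<psi> \<alpha> + (-1) * trunc F \<alpha>)" by (simp add: fun_eq_iff)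
    then have "f (\<psi> - trunc F) = f \<psi> - f (trunc F)"
      using lin[OF \<psi> trunc_L2[OF F], of 1 "-1"] by simp
    then have "cmod ((\<Sum>\<gamma>\<in>F. \<psi> \<gamma> * f (delta \<gamma>)) - f \<psi>) = cmod (f (\<psi> - trunc F))"
      unfolding f_trunc[OF F] by (simp add: norm_minus_commute)
    also have "\<dots> \<le> K * L2_norm G (\<psi> - trunc F)"
      by (rule bound[OF L2_diff[OF \<psi> trunc_L2[OF F]]])
    also have "L2_norm G (\<psi> - trunc F) = sqrt ((L2_norm G \<psi>)\<^sup>2 - (\<Sum>\<alpha>\<in>F. (cmod (\<psi> \<alpha>))\<^sup>2))"
      unfolding norm_trunc[OF F, symmetric] by simp
    finally show "cmod ((\<Sum>\<gamma>\<in>F. \<psi> \<gamma> * f (delta \<gamma>)) - f \<psi>)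
      \<le> K * sqrt ((L2_norm G \<psi>)\<^sup>2 - (\<Sum>\<alpha>\<in>F. (cmod (\<psi> \<alpha>))\<^sup>2))" .
  qed
  then show ?thesis unfolding has_sum_def by (simp add: LIM_zero_iff)
qed

lemma bounded_operator_expansion:
  assumes S: "S \<in> bounded_operators G" and \<psi>: "\<psi> \<in> L2 G"
  shows "((\<lambda>\<gamma>. \<psi> \<gamma> * S (delta \<gamma>) \<beta>) has_sum S \<psi> \<beta>) (arrs G)"
proof -
  obtain K where K: "\<And>\<psi>. \<psi> \<in> L2 G \<Longrightarrow> L2_norm G (S \<psi>) \<le> K * L2_norm G \<psi>"
    using bounded_operator_bound[OF S] by metis
  have "cmod (S \<phi> \<beta>) \<le> K * L2_norm G \<phi>" if "\<phi> \<in> L2 G" for \<phi>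
    using L2_point_le[OF bounded_operator_in[OF S that], of \<beta>] K[OF that] by linarith
  then show ?thesis
    by (intro L2_functional_has_sum[where f = "\<lambda>\<phi>. S \<phi> \<beta>" and K = K, OF _ _ \<psi>])
       (simp_all add: bounded_operator_lincomb[OF S])
qed

lemma bounded_operator_eq_on_basis:
  assumes "S \<in> bounded_operators G" "T \<in> bounded_operators G"
    and eq: "\<And>\<gamma>. \<gamma> \<in> arrs G \<Longrightarrow> S (delta \<gamma>) = T (delta \<gamma>)"
  shows "S = T"
proof (rule bounded_operator_eqI[OF assms(1,2)], rule ext)
  fix \<psi> \<beta> assume \<psi>: "\<psi> \<in> L2 G"
  have "((\<lambda>\<gamma>. \<psi> \<gamma> * S (delta \<gamma>) \<beta>) has_sum T \<psi> \<beta>) (arrs G)"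
    using bounded_operator_expansion[OF assms(2) \<psi>, of \<beta>] eq
    by (simp cong: has_sum_cong)
  then show "S \<psi> \<beta> = T \<psi> \<beta>"
    using bounded_operator_expansion[OF assms(1) \<psi>, of \<beta>] has_sum_unique by blast
qed

section \<open>Projections given by reproducing kernels\<close>

lemma L2_sum:
  assumes "finite F" "\<And>\<beta>. \<beta> \<in> F \<Longrightarrow> q \<beta> \<in> L2 G"
  shows "(\<lambda>\<alpha>. \<Sum>\<beta>\<in>F. c \<beta> * q \<beta> \<alpha>) \<in> L2 G"
    and "\<phi> \<in> L2 G \<Longrightarrow> L2_inner G \<phi> (\<lambda>\<alpha>. \<Sum>\<beta>\<in>F. c \<beta> * q \<beta> \<alpha>) = (\<Sum>\<beta>\<in>F. c \<beta> * L2_inner G \<phi> (q \<beta>))"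
proof -
  have "(\<lambda>\<alpha>. \<Sum>\<beta>\<in>F. c \<beta> * q \<beta> \<alpha>) \<in> L2 G \<and>
    (\<phi> \<in> L2 G \<longrightarrow> L2_inner G \<phi> (\<lambda>\<alpha>. \<Sum>\<beta>\<in>F. c \<beta> * q \<beta> \<alpha>) = (\<Sum>\<beta>\<in>F. c \<beta> * L2_inner G \<phi> (q \<beta>)))"
    using assms
  proof (induction F)
    case empty
    show ?case by (simp add: L2_inner_def)
  next
    case (insert \<beta> F)
    have "(\<lambda>\<alpha>. \<Sum>\<beta>\<in>insert \<beta> F. c \<beta> * q \<beta> \<alpha>)
      = (\<lambda>\<alpha>. c \<beta> * q \<beta> \<alpha>) + (\<lambda>\<alpha>. \<Sum>\<beta>\<in>F. c \<beta> * q \<beta> \<alpha>)"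
      using insert by (simp add: fun_eq_iff)
    then show ?case using insert
      by (simp add: L2_inner_add_right L2_inner_scale_right)
  qed
  then show "(\<lambda>\<alpha>. \<Sum>\<beta>\<in>F. c \<beta> * q \<beta> \<alpha>) \<in> L2 G"
    "\<phi> \<in> L2 G \<Longrightarrow> L2_inner G \<phi> (\<lambda>\<alpha>. \<Sum>\<beta>\<in>F. c \<beta> * q \<beta> \<alpha>) = (\<Sum>\<beta>\<in>F. c \<beta> * L2_inner G \<phi> (q \<beta>))"
    by auto
qed

text \<open>The vectors \<open>q \<beta>\<close> are the conjugated rows of the matrix. If
  \<open>L2_inner G (q \<beta>) (q \<gamma>) = q \<gamma> \<beta>\<close>, they are its columns too,
  and the operator is the orthogonal projection onto their closed span, as in a reproducing kernel
  Hilbert space.\<close>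

definition kernel_op :: "('o, 'g) groupoid \<Rightarrow> ('g \<Rightarrow> 'g \<Rightarrow> complex) \<Rightarrow> 'g operator" where
  "kernel_op G q \<psi> = (\<lambda>\<beta>. if \<psi> \<in> L2 G \<and> \<beta> \<in> arrs G then L2_inner G (q \<beta>) \<psi> else 0)"

text \<open>Contractivity follows by duality. On a finite set \<open>F\<close>, let
  \<open>z \<beta>\<close> be the values of the image and \<open>v\<close> the sum of the
  \<open>z \<beta> * q \<beta>\<close>. The reproducing identity bounds the squared norm of
  \<open>v\<close> by \<open>Z * L2_norm G v\<close>, so the norm of \<open>v\<close> is at most
  \<open>Z\<close>. On the other hand the square of \<open>Z\<close> is the inner product of
  \<open>\<psi>\<close> and \<open>v\<close>, hence at most
  \<open>L2_norm G \<psi> * Z\<close>.\<close>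

lemma kernel_op_norm:
  assumes q: "\<And>\<beta>. \<beta> \<in> arrs G \<Longrightarrow> q \<beta> \<in> L2 G"
    and repr: "\<And>\<beta> \<gamma>. \<beta> \<in> arrs G \<Longrightarrow> \<gamma> \<in> arrs G \<Longrightarrow> L2_inner G (q \<beta>) (q \<gamma>) = q \<gamma> \<beta>"
    and \<psi>: "\<psi> \<in> L2 G"
  shows "kernel_op G q \<psi> \<in> L2 G" "L2_norm G (kernel_op G q \<psi>) \<le> L2_norm G \<psi>"
proof -
  have "(\<Sum>\<beta>\<in>F. (cmod (kernel_op G q \<psi> \<beta>))\<^sup>2) \<le> (L2_norm G \<psi>)\<^sup>2" if F: "finite F" "F \<subseteq> arrs G" for F
  proof -
    define z where "z \<beta> = L2_inner G (q \<beta>) \<psi>" for \<beta>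
    define v where "v = (\<lambda>\<alpha>. \<Sum>\<beta>\<in>F. z \<beta> * q \<beta> \<alpha>)"
    define Z where "Z = L2_set (\<lambda>\<beta>. cmod (z \<beta>)) F"
    have FA: "\<And>\<beta>. \<beta> \<in> F \<Longrightarrow> \<beta> \<in> arrs G" using F by blast
    then have qF: "\<And>\<beta>. \<beta> \<in> F \<Longrightarrow> q \<beta> \<in> L2 G" using q by blast
    have v: "v \<in> L2 G" unfolding v_def by (rule L2_sum(1)[OF F(1) qF])
    have inner_v: "L2_inner G \<phi> v = (\<Sum>\<beta>\<in>F. z \<beta> * L2_inner G \<phi> (q \<beta>))" if "\<phi> \<in> L2 G" for \<phi>
      unfolding v_def by (rule L2_sum(2)[OF F(1) qF that])
    have qv: "L2_inner G (q \<beta>) v = v \<beta>" if "\<beta> \<in> F" for \<beta>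
    proof -
      have "L2_inner G (q \<beta>) v = (\<Sum>\<gamma>\<in>F. z \<gamma> * L2_inner G (q \<beta>) (q \<gamma>))"
        by (rule inner_v[OF qF[OF that]])
      also have "\<dots> = v \<beta>" unfolding v_def by (intro sum.cong refl) (simp add: repr FA that)
      finally show ?thesis .
    qed
    have "complex_of_real ((L2_norm G v)\<^sup>2) = (\<Sum>\<beta>\<in>F. z \<beta> * cnj (v \<beta>))"
      unfolding L2_inner_self[OF v, symmetric] inner_v[OF v]
      using qv by (auto intro!: sum.cong simp: L2_inner_commute[of G v])
    then have "(L2_norm G v)\<^sup>2 = cmod (\<Sum>\<beta>\<in>F. z \<beta> * cnj (v \<beta>))"
      by (metis norm_of_real abs_of_nonneg zero_le_power2)
    also have "\<dots> \<le> (\<Sum>\<beta>\<in>F. \<bar>cmod (z \<beta>)\<bar> * \<bar>cmod (v \<beta>)\<bar>)"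
      by (rule order_trans[OF norm_sum]) (simp add: norm_mult)
    also have "\<dots> \<le> Z * L2_set (\<lambda>\<beta>. cmod (v \<beta>)) F"
      unfolding Z_def by (rule L2_set_mult_ineq)
    also have "L2_set (\<lambda>\<beta>. cmod (v \<beta>)) F \<le> L2_norm G v"
      unfolding L2_set_def by (rule real_le_lsqrt) (auto simp: sum_nonneg L2_finite_sum_le[OF v F])
    finally have "L2_norm G v * L2_norm G v \<le> Z * L2_norm G v"
      by (simp add: power2_eq_square Z_def mult_left_mono)
    then have vZ: "L2_norm G v \<le> Z"
      using L2_norm_nonneg[of G v] by (cases "L2_norm G v = 0") (auto simp: Z_def)
    have Z2: "Z\<^sup>2 = (\<Sum>\<beta>\<in>F. (cmod (z \<beta>))\<^sup>2)" by (simp add: Z_def L2_set_def sum_nonneg)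
    have "L2_inner G \<psi> v = (\<Sum>\<beta>\<in>F. z \<beta> * cnj (z \<beta>))"
      unfolding inner_v[OF \<psi>] by (simp add: z_def L2_inner_commute[of G \<psi>])
    also have "\<dots> = complex_of_real (Z\<^sup>2)" unfolding Z2 by (simp add: complex_norm_square del: of_real_power)
    finally have "Z\<^sup>2 = cmod (L2_inner G \<psi> v)" by (simp add: norm_power)
    also have "\<dots> \<le> L2_norm G \<psi> * Z"
      using L2_inner_bound[OF \<psi> v] mult_left_mono[OF vZ L2_norm_nonneg[of G \<psi>]] by linarith
    finally have "Z * Z \<le> L2_norm G \<psi> * Z" by (simp add: power2_eq_square)
    moreover have "0 \<le> Z" by (simp add: Z_def)
    ultimately have "Z \<le> L2_norm G \<psi>"
      by (cases "Z = 0") (auto dest: mult_right_le_imp_le)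
    then have "Z\<^sup>2 \<le> (L2_norm G \<psi>)\<^sup>2" by (intro power_mono) (auto simp: Z_def)
    moreover have "(\<Sum>\<beta>\<in>F. (cmod (kernel_op G q \<psi> \<beta>))\<^sup>2) = Z\<^sup>2"
      unfolding Z2 z_def using F \<psi> by (intro sum.cong) (auto simp: kernel_op_def)
    ultimately show ?thesis by simp
  qed
  moreover have "kernel_op G q \<psi> \<alpha> = 0" if "\<alpha> \<notin> arrs G" for \<alpha> using that by (simp add: kernel_op_def)
  ultimately show "kernel_op G q \<psi> \<in> L2 G" "L2_norm G (kernel_op G q \<psi>) \<le> L2_norm G \<psi>"
    using L2_boundI[of G "kernel_op G q \<psi>" "L2_norm G \<psi>"] by simp_all
qed

lemma kernel_op_properties:
  assumes q: "\<And>\<beta>. \<beta> \<in> arrs G \<Longrightarrow> q \<beta> \<in> L2 G"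
    and repr: "\<And>\<beta> \<gamma>. \<beta> \<in> arrs G \<Longrightarrow> \<gamma> \<in> arrs G \<Longrightarrow> L2_inner G (q \<beta>) (q \<gamma>) = q \<gamma> \<beta>"
  shows kernel_op_bounded: "kernel_op G q \<in> bounded_operators G"
    and kernel_op_delta: "\<gamma> \<in> arrs G \<Longrightarrow> kernel_op G q (delta \<gamma>) = q \<gamma>"
    and kernel_op_adjoint: "is_adjoint G (kernel_op G q) (kernel_op G q)"
    and kernel_op_idem: "kernel_op G q \<circ> kernel_op G q = kernel_op G q"
proof -
  let ?C = "kernel_op G q"
  have kn: "?C \<psi> \<in> L2 G" "L2_norm G (?C \<psi>) \<le> L2_norm G \<psi>" if "\<psi> \<in> L2 G" for \<psi>
    using kernel_op_norm[of G q \<psi>] q repr that by blast+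
  have bdd: "?C \<in> bounded_operators G"
  proof (rule bounded_operatorI[where K = 1])
    fix \<psi> \<phi> a b assume *: "\<psi> \<in> L2 G" "\<phi> \<in> L2 G"
    have "L2_inner G (q \<beta>) (\<lambda>\<alpha>. a * \<psi> \<alpha> + b * \<phi> \<alpha>) = a * L2_inner G (q \<beta>) \<psi> + b * L2_inner G (q \<beta>) \<phi>"
      if "\<beta> \<in> arrs G" for \<beta>
      using L2_inner_add_right[OF q[OF that] L2_scale[OF *(1)] L2_scale[OF *(2)], of a b]
      by (simp add: L2_inner_scale_right plus_fun_def)
    then show "?C (\<lambda>\<alpha>. a * \<psi> \<alpha> + b * \<phi> \<alpha>) = (\<lambda>\<alpha>. a * ?C \<psi> \<alpha> + b * ?C \<phi> \<alpha>)"
      using * by (simp add: kernel_op_def fun_eq_iff)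
  qed (use kn in \<open>auto simp: kernel_op_def fun_eq_iff\<close>)
  then show "?C \<in> bounded_operators G" .
  show delta: "?C (delta \<gamma>) = q \<gamma>" if "\<gamma> \<in> arrs G" for \<gamma>
  proof
    fix \<beta>
    show "?C (delta \<gamma>) \<beta> = q \<gamma> \<beta>"
    proof (cases "\<beta> \<in> arrs G")
      case True
      have "?C (delta \<gamma>) \<beta> = cnj (q \<beta> \<gamma>)" using True that by (simp add: kernel_op_def L2_inner_delta)
      \<comment> \<open>The kernel is Hermitian: exchange \<open>\<beta>\<close> and
        \<open>\<gamma>\<close> in the reproducing identity and conjugate the inner product.\<close>
      also have "\<dots> = q \<gamma> \<beta>" using repr[OF that True] repr[OF True that] L2_inner_commute by metis
      finally show ?thesis .
    qed (use L2_outside[OF q[OF that]] in \<open>simp add: kernel_op_def\<close>)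
  qed
  show adj: "is_adjoint G ?C ?C" unfolding is_adjoint_def
  proof (intro ballI)
    fix \<phi> \<psi> assume *: "\<phi> \<in> L2 G" "\<psi> \<in> L2 G"
    \<comment> \<open>Self-adjointness is checked by expanding in \<open>\<psi>\<close>: at the
      basis vector \<open>\<gamma>\<close> the functional takes the value
      \<open>L2_inner G \<phi> (q \<gamma>)\<close>, the conjugate of
      \<open>?C \<phi> \<gamma>\<close>.\<close>
    have "((\<lambda>\<gamma>. \<psi> \<gamma> * L2_inner G \<phi> (?C (delta \<gamma>))) has_sum L2_inner G \<phi> (?C \<psi>)) (arrs G)"
    proof (rule L2_functional_has_sum[OF _ _ *(2)])
      fix \<xi> \<zeta> a b assume z: "\<xi> \<in> L2 G" "\<zeta> \<in> L2 G"
      have "?C \<xi> \<in> L2 G" "?C \<zeta> \<in> L2 G" using z bdd by auto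
      from L2_inner_add_right[OF *(1) L2_scale[OF this(1)] L2_scale[OF this(2)], of a b]
      show "L2_inner G \<phi> (?C (\<lambda>\<alpha>. a * \<xi> \<alpha> + b * \<zeta> \<alpha>))
        = a * L2_inner G \<phi> (?C \<xi>) + b * L2_inner G \<phi> (?C \<zeta>)"
        unfolding bounded_operator_lincomb[OF bdd z]
        by (simp add: L2_inner_scale_right plus_fun_def)
    next
      fix \<xi> assume z: "\<xi> \<in> L2 G"
      have "cmod (L2_inner G \<phi> (?C \<xi>)) \<le> L2_norm G \<phi> * L2_norm G (?C \<xi>)"
        by (rule L2_inner_bound[OF *(1) bounded_operator_in[OF bdd z]])
      also have "\<dots> \<le> L2_norm G \<phi> * L2_norm G \<xi>" by (intro mult_left_mono kn z) auto
      finally show "cmod (L2_inner G \<phi> (?C \<xi>)) \<le> L2_norm G \<phi> * L2_norm G \<xi>" .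
    qed
    then have "L2_inner G \<phi> (?C \<psi>) = (\<Sum>\<^sub>\<infinity>\<gamma>\<in>arrs G. \<psi> \<gamma> * L2_inner G \<phi> (?C (delta \<gamma>)))"
      by (rule infsumI[symmetric])
    also have "\<dots> = (\<Sum>\<^sub>\<infinity>\<gamma>\<in>arrs G. cnj (?C \<phi> \<gamma>) * \<psi> \<gamma>)"
    proof (rule infsum_cong)
      fix \<gamma> assume g: "\<gamma> \<in> arrs G"
      have "cnj (?C \<phi> \<gamma>) = L2_inner G \<phi> (q \<gamma>)"
        using g *(1) L2_inner_commute[of G \<phi> "q \<gamma>"] by (simp add: kernel_op_def)
      then show "\<psi> \<gamma> * L2_inner G \<phi> (?C (delta \<gamma>)) = cnj (?C \<phi> \<gamma>) * \<psi> \<gamma>"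
        by (simp add: delta[OF g])
    qed
    finally show "L2_inner G (?C \<phi>) \<psi> = L2_inner G \<phi> (?C \<psi>)" by (simp add: L2_inner_def)
  qed
  show "?C \<circ> ?C = ?C"
  proof (rule bounded_operator_eqI)
    fix \<psi> assume \<psi>: "\<psi> \<in> L2 G"
    \<comment> \<open>By the reproducing identity \<open>?C\<close> fixes \<open>q \<beta>\<close>,
      and self-adjointness moves \<open>?C\<close> to that side.\<close>
    have "L2_inner G (q \<beta>) (?C \<psi>) = L2_inner G (q \<beta>) \<psi>" if b: "\<beta> \<in> arrs G" for \<beta>
    proof -
      have "?C (q \<beta>) = q \<beta>"
        using q[OF b] repr b L2_outside[OF q[OF b]] by (auto simp: kernel_op_def fun_eq_iff)
      then show ?thesis using adjoint_inner[OF adj q[OF b] \<psi>] by simp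
    qed
    then show "(?C \<circ> ?C) \<psi> = ?C \<psi>"
      using \<psi> kn(1)[OF \<psi>] by (simp add: kernel_op_def[of G q "kernel_op G q \<psi>"])
        (auto simp: kernel_op_def)
  qed (use bdd in auto)
qed

section \<open>Projections in the convolution algebra of a cyclic group\<close>

text \<open>Up to a constant factor, the Fourier coefficient of the indicator of a half circle at
  the odd frequency \<open>2 * j + 1\<close>.\<close>

definition odd_recip :: "int \<Rightarrow> real" where
  "odd_recip j = 1 / (2 * of_int j + 1)"

lemma odd_real_nonzero: "2 * real_of_int j + 1 \<noteq> 0"
proof -
  have "2 * j + 1 \<noteq> 0" by presburger
  then have "real_of_int (2 * j + 1) \<noteq> 0" by (simp only: of_int_eq_0_iff not_False_eq_True)
  then show ?thesis by simp
qed

text \<open>Partial fractions: the products that occur in the convolution square become differences,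
  whose sums telescope.\<close>

lemma odd_recip_diff:
  "odd_recip j - odd_recip (j + l) = 2 * of_int l * (odd_recip j * odd_recip (j + l))"
  using odd_real_nonzero[of j] odd_real_nonzero[of "j + l"]
  by (simp add: odd_recip_def field_simps)

lemma odd_recip_step_nat:
  "((\<lambda>i. odd_recip (int i) - odd_recip (int i + 1)) has_sum 1) UNIV"
proof (rule sums_nonneg_imp_has_sum)
  have "(\<lambda>n. odd_recip (int n)) \<longlonglongrightarrow> 0"
    unfolding odd_recip_def by real_asymp
  from telescope_sums'[OF this]
  show "(\<lambda>i. odd_recip (int i) - odd_recip (int i + 1)) sums 1"
    by (simp add: odd_recip_def ac_simps)
  show "0 \<le> odd_recip (int i) - odd_recip (int i + 1)" for i
    by (simp add: odd_recip_def field_simps)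
qed

lemma odd_recip_step: "((\<lambda>j. odd_recip j - odd_recip (j + 1)) has_sum 0) UNIV"
proof -
  let ?D = "\<lambda>j. odd_recip j - odd_recip (j + 1)"
  have pos: "(?D has_sum 1) (range int)"
    by (subst has_sum_reindex) (use odd_recip_step_nat in \<open>auto simp: o_def\<close>)
  \<comment> \<open>The reflection \<open>odd_recip (- 1 - j) = - odd_recip j\<close> maps the
    differences at negative indices below -1 to those at the natural numbers.\<close>
  have neg: "(?D has_sum 1) (range (\<lambda>i. -2 - int i))"
  proof (subst has_sum_reindex)
    have "?D (-2 - int i) = odd_recip (int i) - odd_recip (int i + 1)" for i
      using odd_real_nonzero[of "-2 - int i"] odd_real_nonzero[of "-1 - int i"]
      by (simp add: odd_recip_def field_simps)
    then show "(?D \<circ> (\<lambda>i. -2 - int i) has_sum 1) UNIV"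
      using odd_recip_step_nat by (simp add: o_def)
  qed (auto simp: inj_on_def)
  \<comment> \<open>The difference at -1 straddles the change of sign of \<open>odd_recip\<close>
    and offsets the two halves of sum 1.\<close>
  have mid: "(?D has_sum -2) {-1}" by (rule has_sum_finiteI) (auto simp: odd_recip_def)
  have "(?D has_sum 1 + (1 + -2)) (range int \<union> (range (\<lambda>i. -2 - int i) \<union> {-1}))"
    by (intro has_sum_Un_disjoint pos neg mid) auto
  moreover have "range int \<union> (range (\<lambda>i. -2 - int i) \<union> {-1}) = UNIV"
  proof -
    have "j \<in> range int \<union> (range (\<lambda>i. -2 - int i) \<union> {-1})" for j
    proof (cases "0 \<le> j")
      case False
      then have "j = -1 \<or> j = -2 - int (nat (-2 - j))" by auto
      then show ?thesis by blast
    qed (auto intro: range_eqI[of _ _ "nat j"])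
    then show ?thesis by blast
  qed
  ultimately show ?thesis by simp
qed

text \<open>The family \<open>odd_recip\<close> is not summable on the integers, so its shifts
  cannot simply be subtracted. A shift by \<open>l\<close> is instead a sum of one-step differences,
  each of total 0; negative shifts follow by translating and changing the sign.\<close>

lemma odd_recip_shift: "((\<lambda>j. odd_recip j - odd_recip (j + l)) has_sum 0) UNIV"
proof -
  have shift: "((\<lambda>j. f (j + l)) has_sum s) UNIV" if "(f has_sum s) UNIV" for f :: "int \<Rightarrow> real" and l s
    using has_sum_reindex_bij_betw[of "\<lambda>j. j + l" UNIV UNIV f s] that
    by (simp add: bij_plus_right)
  have nat: "((\<lambda>j. odd_recip j - odd_recip (j + int l)) has_sum 0) UNIV" for l
  proof (induction l)
    case (Suc l)
    from has_sum_add[OF Suc shift[OF odd_recip_step, of "int l"]]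
    show ?case by (simp add: ac_simps)
  qed simp
  show ?thesis
  proof (cases "0 \<le> l")
    case True
    then show ?thesis using nat[of "nat l"] by simp
  next
    case False
    then show ?thesis
      using has_sum_uminusI[OF shift[OF nat[of "nat (-l)"], of l]] by simp
  qed
qed

lemma odd_recip_square_summable: "(\<lambda>j. (odd_recip j)\<^sup>2) summable_on UNIV"
proof (rule summable_on_comparison_test)
  have "(\<lambda>j. odd_recip j - odd_recip (j + 1)) summable_on UNIV"
    using odd_recip_step by (rule has_sum_imp_summable)
  then have "(\<lambda>j. \<bar>odd_recip j - odd_recip (j + 1)\<bar>) summable_on UNIV"
    by (subst (asm) summable_on_iff_abs_summable_on_real) simp
  then show "(\<lambda>j. 3/2 * \<bar>odd_recip j - odd_recip (j + 1)\<bar>) summable_on UNIV"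
    by (rule summable_on_cmult_right)
  \<comment> \<open>With \<open>u = 2 * j + 1\<close> the one-step difference has absolute value
    \<open>2 / (\<bar>u\<bar> * \<bar>u + 2\<bar>)\<close>. The constant \<open>3/2\<close> comes
    from \<open>\<bar>u + 2\<bar> \<le> 3 * \<bar>u\<bar>\<close>, valid as
    \<open>\<bar>u\<bar>\<close> is at least 1.\<close>
  show "(odd_recip j)\<^sup>2 \<le> 3/2 * \<bar>odd_recip j - odd_recip (j + 1)\<bar>" for j
  proof -
    define u where "u = 2 * real_of_int j + 1"
    have "1 \<le> \<bar>2 * j + 1\<bar>" by presburger
    then have "1 \<le> \<bar>real_of_int (2 * j + 1)\<bar>" by linarith
    then have u: "1 \<le> \<bar>u\<bar>" by (simp add: u_def)
    have "u + 2 \<noteq> 0" using odd_real_nonzero[of "j + 1"] by (simp add: u_def)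
    then have u2: "0 < \<bar>u + 2\<bar>" by simp
    have "\<bar>u + 2\<bar> \<le> 3 * \<bar>u\<bar>" using u by linarith
    then have "1 / (3 * \<bar>u\<bar>) \<le> 1 / \<bar>u + 2\<bar>" using u2 by (intro divide_left_mono) auto
    then have "3 / \<bar>u\<bar> * (1 / (3 * \<bar>u\<bar>)) \<le> 3 / \<bar>u\<bar> * (1 / \<bar>u + 2\<bar>)" by (intro mult_left_mono) auto
    then have "1 / \<bar>u\<bar> * (1 / \<bar>u\<bar>) \<le> 3 / \<bar>u\<bar> * (1 / \<bar>u + 2\<bar>)" by simp
    moreover have "odd_recip j = 1 / u" "odd_recip (j + 1) = 1 / (u + 2)"
      by (simp_all add: odd_recip_def u_def)
    moreover have "\<bar>odd_recip j - odd_recip (j + 1)\<bar> = 2 * (\<bar>odd_recip j\<bar> * \<bar>odd_recip (j + 1)\<bar>)"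
      unfolding odd_recip_diff by (simp add: abs_mult)
    ultimately show ?thesis by (simp add: power2_eq_square abs_mult)
  qed
qed simp

lemma has_sum_odd:
  fixes f :: "int \<Rightarrow> 'a :: {comm_monoid_add, topological_space}"
  shows "((\<lambda>n. if odd n then f n else 0) has_sum s) UNIV \<longleftrightarrow> ((\<lambda>j. f (2 * j + 1)) has_sum s) UNIV"
proof -
  have "((\<lambda>n. if odd n then f n else 0) has_sum s) UNIV \<longleftrightarrow> (f has_sum s) {n. odd n}"
    by (rule has_sum_cong_neutral) auto
  also have "\<dots> \<longleftrightarrow> ((\<lambda>j. f (2 * j + 1)) has_sum s) UNIV"
    by (rule has_sum_reindex_bij_witness[where i = "\<lambda>j. 2 * j + 1" and j = "\<lambda>n. n div 2"]) auto
  finally show ?thesis .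
qed

text \<open>The projection in the convolution algebra of the integers is the indicator of a half circle,
  transported by the Fourier transform: half of the unit plus the discrete Hilbert transform.\<close>

lemma integer_projection:
  obtains c :: "int \<Rightarrow> complex" where
    "(\<lambda>n. (cmod (c n))\<^sup>2) summable_on UNIV"
    "\<And>n. c (- n) = cnj (c n)"
    "\<And>k. ((\<lambda>n. cnj (c n) * c (n + k)) has_sum c k) UNIV"
    "\<And>n. c n = c 1 \<longleftrightarrow> n = 1" "c 1 \<noteq> 0"
proof -
  define S where "S = (\<Sum>\<^sub>\<infinity>j. (odd_recip j)\<^sup>2)"
  have S_sum: "((\<lambda>j. (odd_recip j)\<^sup>2) has_sum S) UNIV"
    unfolding S_def using odd_recip_square_summable by (rule has_sum_infsum)
  have "sum (\<lambda>j. (odd_recip j)\<^sup>2) {0} \<le> S"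
    by (rule finite_sum_le_has_sum[OF S_sum]) auto
  then have S: "0 < S" by (simp add: odd_recip_def)
  \<comment> \<open>In closed form \<open>S\<close> is pi squared over 4 and \<open>s\<close> is pi
    over 2, which makes \<open>c n\<close> equal to \<open>- \<i> / (pi * n)\<close> at odd
    \<open>n\<close>. Defining \<open>s\<close> through the sum itself normalises \<open>h\<close>
    directly.\<close>
  define s where "s = sqrt S"
  have s: "0 < s" "s * s = S" using S by (simp_all add: s_def)
  define h :: "int \<Rightarrow> complex" where "h n = (if odd n then - \<i> / of_real (s * of_int n) else 0)" for n
  define e :: "int \<Rightarrow> complex" where "e n = (if n = 0 then 1 else 0)" for n
  define c where "c n = (e n + h n) / 2" for n
  have h_sym: "h (- n) = cnj (h n)" for n by (simp add: h_def)
  \<comment> \<open>On the circle \<open>h\<close> is a sign function, so its convolution square is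
    the unit. For odd \<open>k\<close> one factor always has an even index and vanishes. For even
    nonzero \<open>k\<close> partial fractions reduce the sum to \<open>odd_recip_shift\<close>, and
    \<open>k = 0\<close> gives the normalisation.\<close>
  have hh: "((\<lambda>n. cnj (h n) * h (n + k)) has_sum e k) UNIV" for k
  proof (cases "odd k")
    case True
    then have "cnj (h n) * h (n + k) = 0" for n by (auto simp: h_def)
    moreover have "e k = 0" using True by (auto simp: e_def)
    ultimately show ?thesis by (simp only: has_sum_0_simp)
  next
    case False
    then obtain l where k: "k = 2 * l" by blast
    have "((\<lambda>j. odd_recip j * odd_recip (j + l)) has_sum (if l = 0 then S else 0)) UNIV"
    proof (cases "l = 0")
      case True
      then show ?thesis using S_sum by (simp add: power2_eq_square)
    next
      case False
      then have "odd_recip j * odd_recip (j + l) = 1 / (2 * of_int l) * (odd_recip j - odd_recip (j + l))" for j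
        by (simp add: odd_recip_diff)
      then show ?thesis
        using has_sum_cmult_right[OF odd_recip_shift[of l], of "1 / (2 * of_int l)"] False by simp
    qed
    from has_sum_of_real[OF has_sum_cmult_right[OF this, of "1 / S"], where 'a = complex]
    have "((\<lambda>j. complex_of_real (1 / S * (odd_recip j * odd_recip (j + l)))) has_sum e k) UNIV"
      using S by (simp add: e_def k split: if_splits)
    moreover have "complex_of_real (1 / S * (odd_recip j * odd_recip (j + l)))
      = cnj (h (2 * j + 1)) * h ((2 * j + 1) + k)" for j
    proof -
      have "cnj (h (2 * j + 1)) * h ((2 * j + 1) + k)
        = (\<i> / of_real (s * of_int (2 * j + 1))) * (- \<i> / of_real (s * of_int (2 * (j + l) + 1)))"
        by (simp add: h_def k algebra_simps)
      also have "\<dots> = 1 / of_real ((s * s) * (of_int (2 * j + 1) * of_int (2 * (j + l) + 1)))"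
        by (simp add: field_simps)
      also have "\<dots> = complex_of_real (1 / S * (odd_recip j * odd_recip (j + l)))"
        unfolding s(2) by (simp add: odd_recip_def)
      finally show ?thesis by simp
    qed
    ultimately have "((\<lambda>j. cnj (h (2 * j + 1)) * h ((2 * j + 1) + k)) has_sum e k) UNIV" by simp
    then have "((\<lambda>n. if odd n then cnj (h n) * h (n + k) else 0) has_sum e k) UNIV"
      by (simp only: has_sum_odd[of "\<lambda>n. cnj (h n) * h (n + k)"])
    moreover have "(if odd n then cnj (h n) * h (n + k) else 0) = cnj (h n) * h (n + k)" for n
      by (simp add: h_def)
    ultimately show ?thesis by simp
  qed
  have ee: "((\<lambda>n. e n * f n) has_sum f 0) UNIV" "((\<lambda>n. f n * e (n + k)) has_sum f (- k)) UNIV"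
    for f k
    by (rule has_sum_finite_neutralI[where B = "{0}"] has_sum_finite_neutralI[where B = "{-k}"];
        auto simp: e_def)+
  have "((\<lambda>n. (e n * e (n + k) + e n * h (n + k)) + (cnj (h n) * e (n + k) + cnj (h n) * h (n + k)))
    has_sum ((e k + h k) + (cnj (h (- k)) + e k))) UNIV" for k
    using ee(1)[of "\<lambda>n. e (n + k)"] ee(1)[of "\<lambda>n. h (n + k)"] ee(2)[of "\<lambda>n. cnj (h n)" k] hh[of k]
    by (intro has_sum_add) simp_all
  from has_sum_cmult_right[OF this, of "1/4"]
  moreover have "1/4 * ((e n * e (n + k) + e n * h (n + k)) + (cnj (h n) * e (n + k) + cnj (h n) * h (n + k)))
    = cnj (c n) * c (n + k)" for n k
  proof -
    have "cnj (e n) = e n" by (simp add: e_def)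
    then show ?thesis by (simp add: c_def algebra_simps add_divide_distrib)
  qed
  moreover have "1/4 * ((e k + h k) + (cnj (h (- k)) + e k)) = c k" for k
    by (simp add: c_def h_sym)
  ultimately have conv: "((\<lambda>n. cnj (c n) * c (n + k)) has_sum c k) UNIV" for k
    by simp
  have sym: "c (- n) = cnj (c n)" for n by (simp add: c_def h_sym e_def)
  have "((\<lambda>n. cnj (c n) * c n) has_sum c 0) UNIV" using conv[of 0] by simp
  then have "(\<lambda>n. cnj (c n) * c n) summable_on UNIV" by (rule has_sum_imp_summable)
  then have "(\<lambda>n. cmod (cnj (c n) * c n)) summable_on UNIV"
    by (subst (asm) summable_on_iff_abs_summable_on_complex)
  then have sq: "(\<lambda>n. (cmod (c n))\<^sup>2) summable_on UNIV"
    by (simp add: norm_mult power2_eq_square)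
  have c1: "c 1 = - \<i> / of_real (2 * s)" by (simp add: c_def e_def h_def)
  have sep: "n = 1" if "c n = c 1" for n
  proof -
    \<comment> \<open>A nonzero, purely imaginary value occurs only at odd indices, where
      \<open>c n\<close> is a fixed multiple of \<open>1/n\<close> and therefore determines
      \<open>n\<close>.\<close>
    have "Re (c 1) = 0" "Im (c 1) \<noteq> 0" using s by (simp_all add: c1)
    then have "Re (c n) = 0" "Im (c n) \<noteq> 0" using that by simp_all
    then have n: "n \<noteq> 0" "odd n" by (auto simp: c_def e_def h_def split: if_splits)
    then have "Im (c n) = - (1 / (2 * s * of_int n))"
      by (simp add: c_def e_def h_def Im_divide_of_real)
    moreover have "Im (c 1) = - (1 / (2 * s))" by (simp add: c1)
    ultimately show ?thesis using that s n by (simp add: field_simps)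
  qed
  show ?thesis
  proof (rule that[OF sq sym conv])
    show "c n = c 1 \<longleftrightarrow> n = 1" for n using sep by auto
    show "c 1 \<noteq> 0" using s by (simp add: c1)
  qed
qed

text \<open>The coefficients \<open>w n / m\<close>, with \<open>w 1\<close> a primitive root of
  unity of order \<open>m\<close>, form the projection onto one character of the cyclic group. A
  faithful character takes different values at different residues, and every term of the convolution
  sum equals \<open>c k / m\<close>.\<close>

lemma cyclic_projection:
  fixes m :: nat
  assumes "0 < m"
  obtains c :: "int \<Rightarrow> complex" where
    "\<And>n. c (- n) = cnj (c n)"
    "\<And>k. ((\<lambda>n. cnj (c n) * c (n + k)) has_sum c k) {0..<int m}"
    "\<And>i j. c i = c j \<longleftrightarrow> int m dvd i - j" "c 1 \<noteq> 0"
proof -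
  define w :: "int \<Rightarrow> complex" where "w n = exp (\<i> * of_real (2 * pi * of_int n / m))" for n
  define c where "c n = w n / m" for n
  have w_add: "w (i + j) = w i * w j" for i j
    by (simp add: w_def exp_add[symmetric] algebra_simps add_divide_distrib)
  have w_cnj: "w (- n) = cnj (w n)" for n by (simp add: w_def exp_cnj)
  have w_norm: "cnj (w n) * w n = 1" for n
    unfolding w_cnj[symmetric] w_add[symmetric] by (simp add: w_def)
  have scale: "2 * pi * x / m = of_int (2 * t) * pi \<longleftrightarrow> x = m * of_int t" for x :: real and t :: int
  proof -
    have "2 * pi * x / m = of_int (2 * t) * pi \<longleftrightarrow> (2 * pi) * (x / m) = (2 * pi) * of_int t"
      by (simp add: ac_simps)
    also have "\<dots> \<longleftrightarrow> x / m = of_int t" by (simp only: mult_cancel_left) simp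
    also have "\<dots> \<longleftrightarrow> x = m * of_int t" using assms by (simp add: field_simps)
    finally show ?thesis .
  qed
  have w_eq: "w i = w j \<longleftrightarrow> int m dvd i - j" for i j
  proof -
    have "w i = w (i - j) * w j" by (simp flip: w_add)
    moreover have "w j \<noteq> 0" by (simp add: w_def)
    ultimately have "w i = w j \<longleftrightarrow> w (i - j) = 1" by simp
    also have "\<dots> \<longleftrightarrow> (\<exists>t::int. 2 * pi * of_int (i - j) / m = of_int (2 * t) * pi)"
      unfolding w_def exp_eq_1 by simp
    also have "\<dots> \<longleftrightarrow> (\<exists>t::int. real_of_int (i - j) = of_int (int m * t))"
      unfolding scale by simp
    also have "\<dots> \<longleftrightarrow> int m dvd i - j" unfolding of_int_eq_iff dvd_def ..
    finally show ?thesis .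
  qed
  show ?thesis
  proof (rule that)
    show "c (- n) = cnj (c n)" for n by (simp add: c_def w_cnj)
    show "((\<lambda>n. cnj (c n) * c (n + k)) has_sum c k) {0..<int m}" for k
    proof (rule has_sum_finiteI)
      have "cnj (c n) * c (n + k) = c k / m" for n
        using w_norm[of n] by (simp add: c_def w_add)
      then show "c k = (\<Sum>n\<in>{0..<int m}. cnj (c n) * c (n + k))" using assms by simp
    qed simp
    show "c i = c j \<longleftrightarrow> int m dvd i - j" for i j using assms w_eq by (simp add: c_def)
    show "c 1 \<noteq> 0" using assms by (simp add: c_def w_def)
  qed
qed

text \<open>Transport of integer coefficients along \<open>n \<mapsto> a [^] n\<close>, extended by
  zero. The set \<open>I\<close> represents each power of \<open>a\<close> by one exponent, so that
  infinite and finite order are treated together.\<close>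

lemma (in group) cyclic_subgroup_projection:
  fixes c :: "int \<Rightarrow> complex"
  assumes a: "a \<in> carrier G"
    and bij: "bij_betw (\<lambda>n. a [^] n) I (range (\<lambda>n::int. a [^] n))"
    and eq: "\<And>i j. a [^] i = a [^] j \<Longrightarrow> c i = c j"
    and sq: "(\<lambda>n. (cmod (c n))\<^sup>2) summable_on I"
    and sym: "\<And>n. c (- n) = cnj (c n)"
    and conv: "\<And>k. ((\<lambda>n. cnj (c n) * c (n + k)) has_sum c k) I"
    and one: "\<And>n. c n = c 1 \<Longrightarrow> a [^] n = a" "c 1 \<noteq> 0"
  obtains p where "(\<lambda>\<alpha>. (cmod (p \<alpha>))\<^sup>2) summable_on carrier G"
    "\<And>\<alpha>. \<alpha> \<in> carrier G \<Longrightarrow> p (inv \<alpha>) = cnj (p \<alpha>)"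
    "\<And>\<eta>. \<eta> \<in> carrier G \<Longrightarrow> (\<Sum>\<^sub>\<infinity>\<alpha>\<in>carrier G. cnj (p \<alpha>) * p (\<alpha> \<otimes> \<eta>)) = p \<eta>"
    "\<And>\<alpha>. p \<alpha> = p a \<Longrightarrow> \<alpha> = a"
proof -
  let ?J = "range (\<lambda>n::int. a [^] n)"
  have J: "?J \<subseteq> carrier G" using a by auto
  \<comment> \<open>Any exponent may be chosen, as equal powers have equal coefficients.\<close>
  define p where "p \<alpha> = (if \<alpha> \<in> ?J then c (SOME n. \<alpha> = a [^] n) else 0)" for \<alpha>
  have p_pow: "p (a [^] n) = c n" for n :: int
  proof -
    have "a [^] n = a [^] (SOME k. a [^] n = a [^] (k::int))" by (rule someI) (rule refl)
    from eq[OF this] show ?thesis by (simp add: p_def)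
  qed
  have p_out: "p \<alpha> = 0" if "\<alpha> \<notin> ?J" for \<alpha> using that by (simp add: p_def)
  have inv_J: "inv \<alpha> \<in> ?J" if "\<alpha> \<in> ?J" for \<alpha>
    using that a by (auto simp flip: int_pow_neg)
  have mult_J: "\<alpha> \<otimes> \<beta> \<in> ?J" if "\<alpha> \<in> ?J" "\<beta> \<in> ?J" for \<alpha> \<beta>
    using that a by (auto simp flip: int_pow_mult)
  show ?thesis
  proof (rule that)
    have "(\<lambda>\<alpha>. (cmod (p \<alpha>))\<^sup>2) summable_on carrier G \<longleftrightarrow> (\<lambda>\<alpha>. (cmod (p \<alpha>))\<^sup>2) summable_on ?J"
      by (rule summable_on_cong_neutral) (use J p_out in auto)
    also have "\<dots> \<longleftrightarrow> (\<lambda>n. (cmod (p (a [^] n)))\<^sup>2) summable_on I"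
      by (rule summable_on_reindex_bij_betw[OF bij, symmetric])
    finally show "(\<lambda>\<alpha>. (cmod (p \<alpha>))\<^sup>2) summable_on carrier G" using sq by (simp add: p_pow)
    show "p (inv \<alpha>) = cnj (p \<alpha>)" if \<alpha>: "\<alpha> \<in> carrier G" for \<alpha>
    proof (cases "\<alpha> \<in> ?J")
      case True
      then obtain n :: int where "\<alpha> = a [^] n" by blast
      then show ?thesis using a p_pow sym by (simp flip: int_pow_neg)
    next
      case False
      then have "inv \<alpha> \<notin> ?J" using inv_J[of "inv \<alpha>"] \<alpha> by auto
      then show ?thesis using False by (simp add: p_out)
    qed
    show "(\<Sum>\<^sub>\<infinity>\<alpha>\<in>carrier G. cnj (p \<alpha>) * p (\<alpha> \<otimes> \<eta>)) = p \<eta>" if \<eta>: "\<eta> \<in> carrier G" for \<eta>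
    proof -
      have *: "(\<Sum>\<^sub>\<infinity>\<alpha>\<in>carrier G. cnj (p \<alpha>) * p (\<alpha> \<otimes> \<eta>)) = (\<Sum>\<^sub>\<infinity>\<alpha>\<in>?J. cnj (p \<alpha>) * p (\<alpha> \<otimes> \<eta>))"
        by (rule infsum_cong_neutral) (use J p_out in auto)
      show ?thesis
      proof (cases "\<eta> \<in> ?J")
        case True
        then obtain k :: int where k: "\<eta> = a [^] k" by blast
        have "(\<Sum>\<^sub>\<infinity>\<alpha>\<in>?J. cnj (p \<alpha>) * p (\<alpha> \<otimes> \<eta>)) = (\<Sum>\<^sub>\<infinity>n\<in>I. cnj (p (a [^] n)) * p (a [^] n \<otimes> \<eta>))"
          by (rule infsum_reindex_bij_betw[OF bij, symmetric])
        also have "\<dots> = (\<Sum>\<^sub>\<infinity>n\<in>I. cnj (c n) * c (n + k))"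
          using a by (simp add: k p_pow flip: int_pow_mult)
        also have "\<dots> = p \<eta>" using infsumI[OF conv[of k]] by (simp add: k p_pow)
        finally show ?thesis using * by simp
      next
        case False
        \<comment> \<open>For \<open>\<eta>\<close> outside the subgroup, the coset of
          \<open>\<eta>\<close> misses the support of \<open>p\<close>.\<close>
        have "p (\<alpha> \<otimes> \<eta>) = 0" if "\<alpha> \<in> ?J" for \<alpha>
        proof (rule p_out)
          have "\<alpha> \<in> carrier G" using that J by blast
          then have "inv \<alpha> \<otimes> (\<alpha> \<otimes> \<eta>) = \<eta>" using \<eta> by (simp add: m_assoc[symmetric])
          then show "\<alpha> \<otimes> \<eta> \<notin> ?J" using mult_J[OF inv_J[OF that]] False by metis
        qed
        then show ?thesis using False unfolding * by (simp add: p_out cong: infsum_cong)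
      qed
    qed
    show "\<alpha> = a" if "p \<alpha> = p a" for \<alpha>
    proof -
      have pa: "p a = c 1" using p_pow[of 1] a by simp
      then have "\<alpha> \<in> ?J" using that p_out one(2) by fastforce
      then obtain n :: int where "\<alpha> = a [^] n" by blast
      then show ?thesis using one(1)[of n] that pa by (simp add: p_pow)
    qed
  qed
qed

lemma (in group) exists_separating_projection:
  assumes a: "a \<in> carrier G"
  obtains p :: "'a \<Rightarrow> complex" where "(\<lambda>\<alpha>. (cmod (p \<alpha>))\<^sup>2) summable_on carrier G"
    "\<And>\<alpha>. \<alpha> \<in> carrier G \<Longrightarrow> p (inv \<alpha>) = cnj (p \<alpha>)"
    "\<And>\<eta>. \<eta> \<in> carrier G \<Longrightarrow> (\<Sum>\<^sub>\<infinity>\<alpha>\<in>carrier G. cnj (p \<alpha>) * p (\<alpha> \<otimes> \<eta>)) = p \<eta>"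
    "\<And>\<alpha>. p \<alpha> = p a \<Longrightarrow> \<alpha> = a"
proof (cases "ord a = 0")
  \<comment> \<open>Order 0 encodes infinite order: distinct exponents give distinct powers.\<close>
  case True
  have pow_eq: "a [^] i = a [^] j \<longleftrightarrow> i = j" for i j :: int
    using int_pow_eq[OF a] True by auto
  obtain c :: "int \<Rightarrow> complex" where c: "(\<lambda>n. (cmod (c n))\<^sup>2) summable_on UNIV"
    "\<And>n. c (- n) = cnj (c n)"
    "\<And>k. ((\<lambda>n. cnj (c n) * c (n + k)) has_sum c k) UNIV"
    "\<And>n. c n = c 1 \<longleftrightarrow> n = 1" "c 1 \<noteq> 0"
    using integer_projection by blast
  have "bij_betw (\<lambda>n::int. a [^] n) UNIV (range (\<lambda>n::int. a [^] n))"
    by (rule bij_betw_imageI) (auto simp: inj_on_def pow_eq)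
  then show ?thesis
    by (rule cyclic_subgroup_projection[OF a _ _ c(1-3)]) (use c pow_eq a that in auto)
next
  case False
  have pow_eq: "a [^] i = a [^] j \<longleftrightarrow> int (ord a) dvd i - j" for i j :: int
    using int_pow_eq[OF a, of i j] by (metis dvd_diff_commute)
  obtain c :: "int \<Rightarrow> complex" where c: "\<And>n. c (- n) = cnj (c n)"
    "\<And>k. ((\<lambda>n. cnj (c n) * c (n + k)) has_sum c k) {0..<int (ord a)}"
    "\<And>i j. c i = c j \<longleftrightarrow> int (ord a) dvd i - j" "c 1 \<noteq> 0"
  proof (rule cyclic_projection)
    show "0 < ord a" using False by simp
  qed (rule that)
  have "bij_betw (\<lambda>n::int. a [^] n) {0..<int (ord a)} (range (\<lambda>n::int. a [^] n))"
  proof (rule bij_betw_imageI)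
    show "inj_on (\<lambda>n::int. a [^] n) {0..<int (ord a)}"
    proof (rule inj_onI)
      fix i j :: int assume ij: "i \<in> {0..<int (ord a)}" "j \<in> {0..<int (ord a)}" "a [^] i = a [^] j"
      then have "i mod int (ord a) = j mod int (ord a)"
        unfolding pow_eq by (simp only: mod_eq_dvd_iff)
      moreover have "i mod int (ord a) = i" "j mod int (ord a) = j" using ij by simp_all
      ultimately show "i = j" by simp
    qed
    have "a [^] n \<in> (\<lambda>n. a [^] n) ` {0..<int (ord a)}" for n :: int
    proof (rule image_eqI)
      show "a [^] n = a [^] (n mod int (ord a))" unfolding pow_eq by (simp add: minus_mod_eq_mult_div)
    qed (use False in simp)
    then show "(\<lambda>n. a [^] n) ` {0..<int (ord a)} = range (\<lambda>n::int. a [^] n)" by auto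
  qed
  then show ?thesis
  proof (rule cyclic_subgroup_projection[where c = c, OF a])
    show "c i = c j" if "a [^] i = a [^] j" for i j
      using that pow_eq[of i j] by (simp add: c(3))
    show "a [^] n = a" if "c n = c 1" for n
      using that pow_eq[of n 1] a by (simp add: c(3))
    show "(\<lambda>n. (cmod (c n))\<^sup>2) summable_on {0..<int (ord a)}" by simp
  qed (use c in \<open>blast intro: that\<close>)+
qed

section \<open>Left translations\<close>

context groupoid
begin

lemma inv_inv [simp]:
  assumes "\<alpha> \<in> arrs G" shows "inv_arr G (inv_arr G \<alpha>) = \<alpha>"
proof -
  let ?i = "inv_arr G \<alpha>"
  have i: "?i \<in> arrs G" "src G ?i = tgt G \<alpha>" "tgt G ?i = src G \<alpha>"
    using assms by (simp_all add: inv_in src_inv tgt_inv)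
  have ii: "inv_arr G ?i \<in> arrs G" "src G (inv_arr G ?i) = src G \<alpha>" "tgt G (inv_arr G ?i) = tgt G \<alpha>"
    using i by (simp_all add: inv_in src_inv tgt_inv)
  have "inv_arr G ?i = comp_arr G (inv_arr G ?i) (unit_arr G (src G \<alpha>))"
    using comp_unit_right[OF ii(1)] ii by simp
  also have "\<dots> = comp_arr G (inv_arr G ?i) (comp_arr G ?i \<alpha>)"
    by (simp add: comp_inv_left assms)
  also have "\<dots> = comp_arr G (comp_arr G (inv_arr G ?i) ?i) \<alpha>"
    using comp_assoc[OF ii(1) i(1) assms] ii i by simp
  also have "\<dots> = \<alpha>" using comp_inv_left[OF i(1)] i comp_unit_left[OF assms] by simp
  finally show ?thesis .
qed

lemma inv_comp_cancel:
  assumes "\<alpha> \<in> arrs G" "\<beta> \<in> arrs G"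
  shows "tgt G \<alpha> = tgt G \<beta> \<Longrightarrow> comp_arr G \<alpha> (comp_arr G (inv_arr G \<alpha>) \<beta>) = \<beta>"
    and "src G \<alpha> = tgt G \<beta> \<Longrightarrow> comp_arr G (inv_arr G \<alpha>) (comp_arr G \<alpha> \<beta>) = \<beta>"
    and "src G \<alpha> = src G \<beta> \<Longrightarrow> comp_arr G (comp_arr G \<alpha> (inv_arr G \<beta>)) \<beta> = \<alpha>"
    and "src G \<alpha> = tgt G \<beta> \<Longrightarrow> comp_arr G (comp_arr G \<alpha> \<beta>) (inv_arr G \<beta>) = \<alpha>"
proof -
  note i = inv_in[OF assms(1)] src_inv[OF assms(1)] tgt_inv[OF assms(1)]
    inv_in[OF assms(2)] src_inv[OF assms(2)] tgt_inv[OF assms(2)]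
  show "tgt G \<alpha> = tgt G \<beta> \<Longrightarrow> comp_arr G \<alpha> (comp_arr G (inv_arr G \<alpha>) \<beta>) = \<beta>"
    using comp_assoc[OF assms(1) i(1) assms(2)] i comp_inv_right[OF assms(1)] comp_unit_left[OF assms(2)]
    by simp
  show "src G \<alpha> = tgt G \<beta> \<Longrightarrow> comp_arr G (inv_arr G \<alpha>) (comp_arr G \<alpha> \<beta>) = \<beta>"
    using comp_assoc[OF i(1) assms] i comp_inv_left[OF assms(1)] comp_unit_left[OF assms(2)] by simp
  show "src G \<alpha> = src G \<beta> \<Longrightarrow> comp_arr G (comp_arr G \<alpha> (inv_arr G \<beta>)) \<beta> = \<alpha>"
    using comp_assoc[OF assms(1) i(4) assms(2)] i comp_inv_left[OF assms(2)] comp_unit_right[OF assms(1)]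
    by simp
  show "src G \<alpha> = tgt G \<beta> \<Longrightarrow> comp_arr G (comp_arr G \<alpha> \<beta>) (inv_arr G \<beta>) = \<alpha>"
    using comp_assoc[OF assms i(4)] i comp_inv_right[OF assms(2)] comp_unit_right[OF assms(1)] by simp
qed

lemma left_div:
  assumes "\<alpha> \<in> arrs G" "\<beta> \<in> arrs G" "tgt G \<alpha> = tgt G \<beta>"
  shows "comp_arr G (inv_arr G \<alpha>) \<beta> \<in> arrs G" "src G (comp_arr G (inv_arr G \<alpha>) \<beta>) = src G \<beta>"
    "tgt G (comp_arr G (inv_arr G \<alpha>) \<beta>) = src G \<alpha>"
  using assms by (simp_all add: comp_in src_comp tgt_comp inv_in src_inv tgt_inv)

lemma right_div:
  assumes "\<alpha> \<in> arrs G" "\<beta> \<in> arrs G" "src G \<alpha> = src G \<beta>"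
  shows "comp_arr G \<alpha> (inv_arr G \<beta>) \<in> arrs G" "src G (comp_arr G \<alpha> (inv_arr G \<beta>)) = tgt G \<beta>"
    "tgt G (comp_arr G \<alpha> (inv_arr G \<beta>)) = tgt G \<alpha>"
  using assms by (simp_all add: comp_in src_comp tgt_comp inv_in src_inv tgt_inv)

abbreviation left_translation :: "'g \<Rightarrow> 'g operator" where
  "left_translation \<alpha> \<equiv> left_regular G (delta \<alpha>)"

lemma delta_algebra: "\<alpha> \<in> arrs G \<Longrightarrow> delta \<alpha> \<in> groupoid_algebra G"
  by (auto simp: groupoid_algebra_def delta_def)

lemma left_translation_apply:
  assumes "\<alpha> \<in> arrs G" "\<psi> \<in> L2 G"
  shows "left_translation \<alpha> \<psi> \<beta>
    = (if \<beta> \<in> arrs G \<and> tgt G \<beta> = tgt G \<alpha> then \<psi> (comp_arr G (inv_arr G \<alpha>) \<beta>) else 0)"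
proof -
  have "{\<gamma> \<in> arrs G. delta \<alpha> \<gamma> \<noteq> (0::complex) \<and> tgt G \<gamma> = tgt G \<beta>}
    = (if tgt G \<beta> = tgt G \<alpha> then {\<alpha>} else {})"
    using assms by (auto simp: delta_def)
  then show ?thesis using assms by (simp add: left_regular_def delta_def)
qed

text \<open>On arrows with the target of \<open>\<alpha>\<close>, composition with the inverse of
  \<open>\<alpha>\<close> is injective, so the squared values on a finite set are squared values of
  \<open>\<psi>\<close> at distinct arrows.\<close>

lemma left_translation_norm:
  assumes \<alpha>: "\<alpha> \<in> arrs G" and \<psi>: "\<psi> \<in> L2 G"
  shows "left_translation \<alpha> \<psi> \<in> L2 G" "L2_norm G (left_translation \<alpha> \<psi>) \<le> L2_norm G \<psi>"
proof -
  have "(\<Sum>\<beta>\<in>F. (cmod (left_translation \<alpha> \<psi> \<beta>))\<^sup>2) \<le> (L2_norm G \<psi>)\<^sup>2"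
    if F: "finite F" "F \<subseteq> arrs G" for F
  proof -
    define F' where "F' = {\<beta> \<in> F. tgt G \<beta> = tgt G \<alpha>}"
    let ?d = "comp_arr G (inv_arr G \<alpha>)"
    have F': "\<beta> \<in> arrs G" "tgt G \<alpha> = tgt G \<beta>" if "\<beta> \<in> F'" for \<beta> using that F by (auto simp: F'_def)
    have inj: "inj_on ?d F'"
      by (rule inj_on_inverseI[where g = "comp_arr G \<alpha>"]) (use inv_comp_cancel(1)[OF \<alpha>] F' in auto)
    have "(\<Sum>\<beta>\<in>F. (cmod (left_translation \<alpha> \<psi> \<beta>))\<^sup>2) = (\<Sum>\<beta>\<in>F'. (cmod (\<psi> (?d \<beta>)))\<^sup>2)"
      by (rule sum.mono_neutral_cong_right)
         (use F in \<open>auto simp: F'_def left_translation_apply[OF \<alpha> \<psi>]\<close>)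
    also have "\<dots> = (\<Sum>\<beta>\<in>?d ` F'. (cmod (\<psi> \<beta>))\<^sup>2)" by (simp add: sum.reindex[OF inj])
    also have "\<dots> \<le> (L2_norm G \<psi>)\<^sup>2"
    proof (rule L2_finite_sum_le[OF \<psi>])
      show "finite (?d ` F')" using F by (simp add: F'_def)
      show "?d ` F' \<subseteq> arrs G" using F' left_div(1)[OF \<alpha>] by blast
    qed
    finally show ?thesis .
  qed
  moreover have "left_translation \<alpha> \<psi> \<beta> = 0" if "\<beta> \<notin> arrs G" for \<beta>
    using that by (simp add: left_translation_apply[OF \<alpha> \<psi>])
  ultimately show "left_translation \<alpha> \<psi> \<in> L2 G" "L2_norm G (left_translation \<alpha> \<psi>) \<le> L2_norm G \<psi>"
    using L2_boundI[of G "left_translation \<alpha> \<psi>" "L2_norm G \<psi>"] by simp_all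
qed

lemma left_translation_bounded [simp, intro]:
  assumes \<alpha>: "\<alpha> \<in> arrs G"
  shows "left_translation \<alpha> \<in> bounded_operators G"
proof (rule bounded_operatorI[where K = 1])
  fix \<psi> \<phi> a b assume *: "\<psi> \<in> L2 G" "\<phi> \<in> L2 G"
  show "left_translation \<alpha> (\<lambda>\<beta>. a * \<psi> \<beta> + b * \<phi> \<beta>)
    = (\<lambda>\<beta>. a * left_translation \<alpha> \<psi> \<beta> + b * left_translation \<alpha> \<phi> \<beta>)"
    by (rule ext) (simp add: left_translation_apply[OF \<alpha>] *)
qed (use left_translation_norm[OF \<alpha>] in \<open>auto simp: left_regular_def fun_eq_iff\<close>)

lemma left_regular_sum:
  assumes "A \<in> groupoid_algebra G" "\<psi> \<in> L2 G"
  shows "left_regular G A \<psi> \<beta> = (\<Sum>\<alpha> | A \<alpha> \<noteq> 0. A \<alpha> * left_translation \<alpha> \<psi> \<beta>)"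
proof (cases "\<beta> \<in> arrs G")
  case True
  have sub: "\<And>\<alpha>. A \<alpha> \<noteq> 0 \<Longrightarrow> \<alpha> \<in> arrs G" and fin: "finite {\<alpha>. A \<alpha> \<noteq> 0}"
    using assms by (auto simp: groupoid_algebra_def)
  have "left_regular G A \<psi> \<beta>
    = (\<Sum>\<alpha> | \<alpha> \<in> arrs G \<and> A \<alpha> \<noteq> 0 \<and> tgt G \<alpha> = tgt G \<beta>. A \<alpha> * left_translation \<alpha> \<psi> \<beta>)"
    using True assms by (auto simp: left_regular_def[of G A] left_translation_apply intro!: sum.cong)
  also have "\<dots> = (\<Sum>\<alpha> | A \<alpha> \<noteq> 0. A \<alpha> * left_translation \<alpha> \<psi> \<beta>)"
    by (rule sum.mono_neutral_left)
       (use sub fin in \<open>auto simp: left_translation_apply[OF sub assms(2)]\<close>)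
  finally show ?thesis .
qed (simp add: left_regular_def)

lemma left_regular_bounded:
  assumes A: "A \<in> groupoid_algebra G"
  shows "left_regular G A \<in> bounded_operators G"
proof -
  have fin: "finite {\<alpha>. A \<alpha> \<noteq> 0}" and sub: "\<And>\<alpha>. A \<alpha> \<noteq> 0 \<Longrightarrow> \<alpha> \<in> arrs G"
    using A by (auto simp: groupoid_algebra_def)
  let ?T = "\<lambda>\<psi> \<beta>. \<Sum>\<alpha> | A \<alpha> \<noteq> 0. A \<alpha> * left_translation \<alpha> \<psi> \<beta>"
  have "?T \<in> bounded_operators G" by (rule bounded_operator_sum[OF fin]) (use sub in auto)
  moreover have "left_regular G A = ?T"
  proof (intro ext)
    fix \<psi> \<beta>
    show "left_regular G A \<psi> \<beta> = ?T \<psi> \<beta>"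
      by (cases "\<psi> \<in> L2 G") (use left_regular_sum[OF A] in \<open>auto simp: left_regular_def\<close>)
  qed
  ultimately show ?thesis by simp
qed

lemma left_regular_vN:
  assumes A: "A \<in> groupoid_algebra G"
  shows "left_regular G A \<in> vN_algebra G"
  unfolding vN_algebra_def
proof (rule commutantI[OF left_regular_bounded[OF A]])
  fix S assume S: "S \<in> commutant G (left_regular G ` groupoid_algebra G)"
  show "left_regular G A \<circ> S = S \<circ> left_regular G A"
    using commutant_in(2)[OF S imageI[OF A]] by (simp add: fun_eq_iff)
qed

lemma left_translation_vN: "\<alpha> \<in> arrs G \<Longrightarrow> left_translation \<alpha> \<in> vN_algebra G"
  by (intro left_regular_vN delta_algebra)

lemma left_translation_adjoint:
  assumes \<alpha>: "\<alpha> \<in> arrs G"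
  shows "is_adjoint G (left_translation \<alpha>) (left_translation (inv_arr G \<alpha>))"
  unfolding is_adjoint_def
proof (intro ballI)
  fix \<psi> \<phi> assume *: "\<psi> \<in> L2 G" "\<phi> \<in> L2 G"
  note i = inv_in[OF \<alpha>] src_inv[OF \<alpha>] tgt_inv[OF \<alpha>]
  let ?d = "comp_arr G (inv_arr G \<alpha>)"
  have "L2_inner G (left_translation \<alpha> \<psi>) \<phi>
    = (\<Sum>\<^sub>\<infinity>\<beta> | \<beta> \<in> arrs G \<and> tgt G \<beta> = tgt G \<alpha>. cnj (\<psi> (?d \<beta>)) * \<phi> \<beta>)"
    unfolding L2_inner_def
    by (rule infsum_cong_neutral) (auto simp: left_translation_apply \<alpha> *)
  also have "\<dots> = (\<Sum>\<^sub>\<infinity>\<gamma> | \<gamma> \<in> arrs G \<and> tgt G \<gamma> = src G \<alpha>. cnj (\<psi> \<gamma>) * \<phi> (comp_arr G \<alpha> \<gamma>))"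
    by (rule infsum_reindex_bij_witness[where i = "comp_arr G \<alpha>" and j = ?d])
       (use \<alpha> in \<open>auto simp: inv_comp_cancel left_div comp_in tgt_comp\<close>)
  also have "\<dots> = L2_inner G \<psi> (left_translation (inv_arr G \<alpha>) \<phi>)"
    unfolding L2_inner_def
    by (rule infsum_cong_neutral) (auto simp: left_translation_apply \<alpha> i *)
  finally show "L2_inner G (left_translation \<alpha> \<psi>) \<phi> = L2_inner G \<psi> (left_translation (inv_arr G \<alpha>) \<phi>)" .
qed

lemma left_translation_delta:
  assumes "\<alpha> \<in> arrs G" "\<gamma> \<in> arrs G" "src G \<alpha> = tgt G \<gamma>"
  shows "left_translation \<alpha> (delta \<gamma>) = delta (comp_arr G \<alpha> \<gamma>)"
proof
  fix \<beta>
  show "left_translation \<alpha> (delta \<gamma>) \<beta> = delta (comp_arr G \<alpha> \<gamma>) \<beta>"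
    unfolding left_translation_apply[OF assms(1) delta_L2[OF assms(2)]]
    using assms inv_comp_cancel(1)[OF assms(1)] inv_comp_cancel(2)[OF assms(1)]
    by (auto simp: delta_def comp_in tgt_comp)
qed

section \<open>Convolution kernels of an isotropy group\<close>

definition isotropy :: "'o \<Rightarrow> 'g set" where
  "isotropy x = {\<alpha> \<in> arrs G. src G \<alpha> = x \<and> tgt G \<alpha> = x}"

text \<open>The image of the basis vector at \<open>\<gamma>\<close> under left convolution by
  \<open>p\<close>, that is, under the formal series of the \<open>p \<alpha>\<close> times
  \<open>left_translation \<alpha>\<close> over the isotropy group at \<open>x\<close>. It acts on
  all arrows into \<open>x\<close>, whatever their source.\<close>

definition conv_kernel :: "'o \<Rightarrow> ('g \<Rightarrow> complex) \<Rightarrow> 'g \<Rightarrow> 'g \<Rightarrow> complex" where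
  "conv_kernel x p \<gamma> \<beta> = (if \<gamma> \<in> arrs G \<and> \<beta> \<in> arrs G \<and> tgt G \<gamma> = x \<and> tgt G \<beta> = x \<and> src G \<beta> = src G \<gamma>
    then p (comp_arr G \<beta> (inv_arr G \<gamma>)) else 0)"

text \<open>By composition on the left, the isotropy group at \<open>x\<close> acts simply
  transitively on the arrows with target \<open>x\<close> and the source of
  \<open>\<gamma>\<close>.\<close>

lemma infsum_fibre:
  assumes \<gamma>: "\<gamma> \<in> arrs G" "tgt G \<gamma> = x"
    and zero: "\<And>\<beta>. \<beta> \<in> arrs G \<Longrightarrow> \<not> (tgt G \<beta> = x \<and> src G \<beta> = src G \<gamma>) \<Longrightarrow> f \<beta> = 0"
  shows "(\<Sum>\<^sub>\<infinity>\<beta>\<in>arrs G. f \<beta>) = (\<Sum>\<^sub>\<infinity>\<alpha>\<in>isotropy x. f (comp_arr G \<alpha> \<gamma>))"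
    and "f summable_on arrs G \<longleftrightarrow> (\<lambda>\<alpha>. f (comp_arr G \<alpha> \<gamma>)) summable_on isotropy x"
proof -
  let ?S = "{\<beta> \<in> arrs G. tgt G \<beta> = x \<and> src G \<beta> = src G \<gamma>}"
  have "(\<Sum>\<^sub>\<infinity>\<beta>\<in>arrs G. f \<beta>) = (\<Sum>\<^sub>\<infinity>\<beta>\<in>?S. f \<beta>)"
    by (rule infsum_cong_neutral) (use zero in auto)
  also have "\<dots> = (\<Sum>\<^sub>\<infinity>\<alpha>\<in>isotropy x. f (comp_arr G \<alpha> \<gamma>))"
    by (rule infsum_reindex_bij_witness[where i = "\<lambda>\<alpha>. comp_arr G \<alpha> \<gamma>"
          and j = "\<lambda>\<beta>. comp_arr G \<beta> (inv_arr G \<gamma>)"])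
       (use \<gamma> in \<open>auto simp: isotropy_def inv_comp_cancel right_div comp_in tgt_comp src_comp\<close>)
  finally show "(\<Sum>\<^sub>\<infinity>\<beta>\<in>arrs G. f \<beta>) = (\<Sum>\<^sub>\<infinity>\<alpha>\<in>isotropy x. f (comp_arr G \<alpha> \<gamma>))" .
  have "f summable_on arrs G \<longleftrightarrow> f summable_on ?S"
    by (rule summable_on_cong_neutral) (use zero in auto)
  also have "\<dots> \<longleftrightarrow> (\<lambda>\<alpha>. f (comp_arr G \<alpha> \<gamma>)) summable_on isotropy x"
    by (rule summable_on_reindex_bij_witness[where i = "\<lambda>\<alpha>. comp_arr G \<alpha> \<gamma>"
          and j = "\<lambda>\<beta>. comp_arr G \<beta> (inv_arr G \<gamma>)"])
       (use \<gamma> in \<open>auto simp: isotropy_def inv_comp_cancel right_div comp_in tgt_comp src_comp\<close>)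
  finally show "f summable_on arrs G \<longleftrightarrow> (\<lambda>\<alpha>. f (comp_arr G \<alpha> \<gamma>)) summable_on isotropy x" .
qed

lemma conv_kernel_comp:
  assumes "\<gamma> \<in> arrs G" "tgt G \<gamma> = x" "\<alpha> \<in> isotropy x"
  shows "conv_kernel x p \<gamma> (comp_arr G \<alpha> \<gamma>) = p \<alpha>"
  using assms by (auto simp: conv_kernel_def isotropy_def inv_comp_cancel comp_in tgt_comp src_comp)

lemma conv_kernel_L2:
  assumes sq: "(\<lambda>\<alpha>. (cmod (p \<alpha>))\<^sup>2) summable_on isotropy x"
  shows "conv_kernel x p \<gamma> \<in> L2 G"
proof (cases "\<gamma> \<in> arrs G \<and> tgt G \<gamma> = x")
  case True
  then have "(\<lambda>\<beta>. (cmod (conv_kernel x p \<gamma> \<beta>))\<^sup>2) summable_on arrs G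
    \<longleftrightarrow> (\<lambda>\<alpha>. (cmod (conv_kernel x p \<gamma> (comp_arr G \<alpha> \<gamma>)))\<^sup>2) summable_on isotropy x"
    by (intro infsum_fibre(2)) (auto simp: conv_kernel_def)
  also have "\<dots> \<longleftrightarrow> (\<lambda>\<alpha>. (cmod (p \<alpha>))\<^sup>2) summable_on isotropy x"
    using True by (intro summable_on_cong) (simp add: conv_kernel_comp)
  finally show ?thesis using sq by (simp add: L2_def) (simp add: conv_kernel_def)
next
  case False
  then have "conv_kernel x p \<gamma> = 0" by (auto simp: conv_kernel_def fun_eq_iff)
  then show ?thesis by simp
qed

text \<open>Summing over arrows \<open>comp_arr G \<alpha> \<beta>\<close> turns the inner product
  into the convolution identity for \<open>p\<close> at \<open>\<beta>\<close> composed with the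
  inverse of \<open>\<gamma>\<close>. Without a common fibre over \<open>x\<close> both sides
  vanish.\<close>

lemma conv_kernel_reproducing:
  assumes conv: "\<And>\<eta>. \<eta> \<in> isotropy x \<Longrightarrow>
      (\<Sum>\<^sub>\<infinity>\<alpha>\<in>isotropy x. cnj (p \<alpha>) * p (comp_arr G \<alpha> \<eta>)) = p \<eta>"
    and \<beta>: "\<beta> \<in> arrs G" and \<gamma>: "\<gamma> \<in> arrs G"
  shows "L2_inner G (conv_kernel x p \<beta>) (conv_kernel x p \<gamma>) = conv_kernel x p \<gamma> \<beta>"
proof (cases "tgt G \<beta> = x \<and> tgt G \<gamma> = x \<and> src G \<beta> = src G \<gamma>")
  case True
  define \<eta> where "\<eta> = comp_arr G \<beta> (inv_arr G \<gamma>)"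
  have \<eta>: "\<eta> \<in> isotropy x" using True \<beta> \<gamma> by (simp add: \<eta>_def isotropy_def right_div)
  have "L2_inner G (conv_kernel x p \<beta>) (conv_kernel x p \<gamma>)
    = (\<Sum>\<^sub>\<infinity>\<alpha>\<in>isotropy x. cnj (conv_kernel x p \<beta> (comp_arr G \<alpha> \<beta>)) * conv_kernel x p \<gamma> (comp_arr G \<alpha> \<beta>))"
    unfolding L2_inner_def by (rule infsum_fibre(1)) (use True \<beta> in \<open>auto simp: conv_kernel_def\<close>)
  also have "\<dots> = (\<Sum>\<^sub>\<infinity>\<alpha>\<in>isotropy x. cnj (p \<alpha>) * p (comp_arr G \<alpha> \<eta>))"
  proof (rule infsum_cong)
    fix \<alpha> assume a: "\<alpha> \<in> isotropy x"
    have "comp_arr G (comp_arr G \<alpha> \<beta>) (inv_arr G \<gamma>) = comp_arr G \<alpha> \<eta>"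
      unfolding \<eta>_def using a True \<beta> \<gamma>
      by (intro comp_assoc) (auto simp: isotropy_def inv_in tgt_inv)
    then have "conv_kernel x p \<gamma> (comp_arr G \<alpha> \<beta>) = p (comp_arr G \<alpha> \<eta>)"
      using a True \<beta> \<gamma> by (auto simp: conv_kernel_def isotropy_def comp_in src_comp tgt_comp)
    then show "cnj (conv_kernel x p \<beta> (comp_arr G \<alpha> \<beta>)) * conv_kernel x p \<gamma> (comp_arr G \<alpha> \<beta>)
      = cnj (p \<alpha>) * p (comp_arr G \<alpha> \<eta>)"
      using conv_kernel_comp[OF \<beta> _ a] True by simp
  qed
  also have "\<dots> = conv_kernel x p \<gamma> \<beta>"
    using conv[OF \<eta>] True \<beta> \<gamma> by (simp add: conv_kernel_def \<eta>_def)
  finally show ?thesis .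
next
  case False
  then have "cnj (conv_kernel x p \<beta> \<delta>) * conv_kernel x p \<gamma> \<delta> = 0" for \<delta>
    by (auto simp: conv_kernel_def)
  then have "L2_inner G (conv_kernel x p \<beta>) (conv_kernel x p \<gamma>) = 0"
    by (simp only: L2_inner_def infsum_0_simp)
  moreover have "conv_kernel x p \<gamma> \<beta> = 0" using False by (auto simp: conv_kernel_def)
  ultimately show ?thesis by simp
qed

text \<open>As \<open>p\<close> may have infinite support, membership in the double commutant is
  verified directly. An operator \<open>S\<close> of the commutant is determined on a fibre by one
  basis vector, because it commutes with translations. Expanding \<open>S\<close> along the basis
  then gives the same series as convolving \<open>S (delta \<gamma>)\<close> with
  \<open>p\<close>.\<close>

lemma conv_kernel_proposition:
  assumes sq: "(\<lambda>\<alpha>. (cmod (p \<alpha>))\<^sup>2) summable_on isotropy x"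
    and herm: "\<And>\<alpha>. \<alpha> \<in> isotropy x \<Longrightarrow> p (inv_arr G \<alpha>) = cnj (p \<alpha>)"
    and conv: "\<And>\<eta>. \<eta> \<in> isotropy x \<Longrightarrow>
      (\<Sum>\<^sub>\<infinity>\<alpha>\<in>isotropy x. cnj (p \<alpha>) * p (comp_arr G \<alpha> \<eta>)) = p \<eta>"
  shows "kernel_op G (conv_kernel x p) \<in> propositions G"
    and "\<And>\<gamma>. \<gamma> \<in> arrs G \<Longrightarrow> kernel_op G (conv_kernel x p) (delta \<gamma>) = conv_kernel x p \<gamma>"
proof -
  let ?q = "conv_kernel x p" and ?C = "kernel_op G (conv_kernel x p)"
  note q = conv_kernel_L2[OF sq] and repr = conv_kernel_reproducing[OF conv]
  have Cb: "?C \<in> bounded_operators G" and Cadj: "is_adjoint G ?C ?C" and Cidem: "?C \<circ> ?C = ?C"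
    using kernel_op_properties[of G ?q] q repr by blast+
  show Cd: "?C (delta \<gamma>) = ?q \<gamma>" if "\<gamma> \<in> arrs G" for \<gamma>
    using kernel_op_delta[of G ?q \<gamma>] q repr that by blast
  have "?C \<circ> S = S \<circ> ?C" if S: "S \<in> commutant G (left_regular G ` groupoid_algebra G)" for S
  proof (rule bounded_operator_eq_on_basis)
    have Sb: "S \<in> bounded_operators G" using S by (rule commutant_in(1))
    show "?C \<circ> S \<in> bounded_operators G" "S \<circ> ?C \<in> bounded_operators G" using Sb Cb by auto
    have S_trans: "S (left_translation \<alpha> \<psi>) = left_translation \<alpha> (S \<psi>)" if "\<alpha> \<in> arrs G" for \<alpha> \<psi>
      using commutant_in(2)[OF S] delta_algebra[OF that] by blast
    fix \<gamma> assume \<gamma>: "\<gamma> \<in> arrs G"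
    have S\<gamma>: "S (delta \<gamma>) \<in> L2 G" using Sb \<gamma> by blast
    have C_eq: "?C (S (delta \<gamma>)) \<beta> = (if \<beta> \<in> arrs G \<and> tgt G \<beta> = x
      then \<Sum>\<^sub>\<infinity>\<alpha>\<in>isotropy x. p \<alpha> * S (delta \<gamma>) (comp_arr G (inv_arr G \<alpha>) \<beta>) else 0)" for \<beta>
    proof (cases "\<beta> \<in> arrs G \<and> tgt G \<beta> = x")
      case True
      have "?C (S (delta \<gamma>)) \<beta> = (\<Sum>\<^sub>\<infinity>\<delta>\<in>arrs G. cnj (?q \<beta> \<delta>) * S (delta \<gamma>) \<delta>)"
        using True S\<gamma> by (simp add: kernel_op_def L2_inner_def)
      also have "\<dots> = (\<Sum>\<^sub>\<infinity>\<alpha>\<in>isotropy x. cnj (?q \<beta> (comp_arr G \<alpha> \<beta>)) * S (delta \<gamma>) (comp_arr G \<alpha> \<beta>))"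
        by (rule infsum_fibre(1)) (use True in \<open>auto simp: conv_kernel_def\<close>)
      also have "\<dots> = (\<Sum>\<^sub>\<infinity>\<alpha>\<in>isotropy x. cnj (p \<alpha>) * S (delta \<gamma>) (comp_arr G \<alpha> \<beta>))"
        using True by (intro infsum_cong) (simp add: conv_kernel_comp)
      \<comment> \<open>Inversion permutes the isotropy group, and Hermitian symmetry of
        \<open>p\<close> removes the conjugate.\<close>
      also have "\<dots> = (\<Sum>\<^sub>\<infinity>\<alpha>\<in>isotropy x. p \<alpha> * S (delta \<gamma>) (comp_arr G (inv_arr G \<alpha>) \<beta>))"
        by (rule infsum_reindex_bij_witness[where i = "inv_arr G" and j = "inv_arr G"])
           (use herm in \<open>auto simp: isotropy_def inv_in src_inv tgt_inv\<close>)
      finally show ?thesis using True by simp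
    next
      case False
      then have "cnj (?q \<beta> \<delta>) * S (delta \<gamma>) \<delta> = 0" if "\<beta> \<in> arrs G" for \<delta>
        using that by (auto simp: conv_kernel_def)
      then have "L2_inner G (?q \<beta>) (S (delta \<gamma>)) = 0" if "\<beta> \<in> arrs G"
        using that by (simp only: L2_inner_def infsum_0_simp)
      then show ?thesis using False by (auto simp: kernel_op_def)
    qed
    show "(?C \<circ> S) (delta \<gamma>) = (S \<circ> ?C) (delta \<gamma>)"
    proof (cases "tgt G \<gamma> = x")
      case True
      have "S (?q \<gamma>) \<beta> = ?C (S (delta \<gamma>)) \<beta>" for \<beta>
      proof -
        have "S (?q \<gamma>) \<beta> = (\<Sum>\<^sub>\<infinity>\<delta>\<in>arrs G. ?q \<gamma> \<delta> * S (delta \<delta>) \<beta>)"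
          by (rule infsumI[symmetric], rule bounded_operator_expansion[OF Sb q])
        also have "\<dots> = (\<Sum>\<^sub>\<infinity>\<alpha>\<in>isotropy x. ?q \<gamma> (comp_arr G \<alpha> \<gamma>) * S (delta (comp_arr G \<alpha> \<gamma>)) \<beta>)"
          by (rule infsum_fibre(1)) (use True \<gamma> in \<open>auto simp: conv_kernel_def\<close>)
        also have "\<dots> = (\<Sum>\<^sub>\<infinity>\<alpha>\<in>isotropy x. if \<beta> \<in> arrs G \<and> tgt G \<beta> = x
          then p \<alpha> * S (delta \<gamma>) (comp_arr G (inv_arr G \<alpha>) \<beta>) else 0)"
        proof (rule infsum_cong)
          fix \<alpha> assume a: "\<alpha> \<in> isotropy x"
          then have a': "\<alpha> \<in> arrs G" "src G \<alpha> = tgt G \<gamma>" "tgt G \<alpha> = x" using True by (auto simp: isotropy_def)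
          have "S (delta (comp_arr G \<alpha> \<gamma>)) = left_translation \<alpha> (S (delta \<gamma>))"
            using S_trans[OF a'(1), of "delta \<gamma>"] left_translation_delta[OF a'(1) \<gamma> a'(2)] by simp
          then show "?q \<gamma> (comp_arr G \<alpha> \<gamma>) * S (delta (comp_arr G \<alpha> \<gamma>)) \<beta>
            = (if \<beta> \<in> arrs G \<and> tgt G \<beta> = x
               then p \<alpha> * S (delta \<gamma>) (comp_arr G (inv_arr G \<alpha>) \<beta>) else 0)"
            using left_translation_apply[OF a'(1) S\<gamma>] a' True by (simp add: conv_kernel_comp[OF \<gamma> True a])
        qed
        also have "\<dots> = ?C (S (delta \<gamma>)) \<beta>" unfolding C_eq
          by (cases "\<beta> \<in> arrs G"; cases "tgt G \<beta> = x") simp_all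
        finally show ?thesis .
      qed
      then show ?thesis by (simp add: Cd[OF \<gamma>] fun_eq_iff)
    next
      case False
      \<comment> \<open>The unit at the target of \<open>\<gamma>\<close> fixes the basis vector and
        commutes with \<open>S\<close>. Hence \<open>S (delta \<gamma>)\<close> stays supported on
        arrows with that target, while \<open>?C\<close> reads only arrows into
        \<open>x\<close>.\<close>
      define u where "u = unit_arr G (tgt G \<gamma>)"
      have u: "u \<in> arrs G" "src G u = tgt G \<gamma>" "tgt G u = tgt G \<gamma>" "comp_arr G u \<gamma> = \<gamma>"
        using \<gamma> by (simp_all add: u_def unit_in tgt_in src_unit tgt_unit comp_unit_left)
      have "S (delta \<gamma>) = left_translation u (S (delta \<gamma>))"
        using S_trans[OF u(1), of "delta \<gamma>"] left_translation_delta[OF u(1) \<gamma> u(2)] u(4) by simp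
      then have zero: "S (delta \<gamma>) \<beta> = 0" if "tgt G \<beta> = x" for \<beta>
        using left_translation_apply[OF u(1) S\<gamma>, of \<beta>] u(3) False that by simp
      have "?C (S (delta \<gamma>)) = 0"
      proof
        fix \<beta>
        have "(\<Sum>\<^sub>\<infinity>\<alpha>\<in>isotropy x. p \<alpha> * S (delta \<gamma>) (comp_arr G (inv_arr G \<alpha>) \<beta>)) = 0"
          if "\<beta> \<in> arrs G" "tgt G \<beta> = x"
          by (rule infsum_0) (use that in \<open>auto simp: isotropy_def zero left_div\<close>)
        then show "?C (S (delta \<gamma>)) \<beta> = 0 \<beta>" by (simp add: C_eq)
      qed
      moreover have "?q \<gamma> = 0" using False by (auto simp: conv_kernel_def fun_eq_iff)
      ultimately show ?thesis
        by (simp add: Cd[OF \<gamma>] bounded_operator_zero(1)[OF Sb])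
    qed
  qed
  then show "?C \<in> propositions G"
    using Cadj Cidem commutantI[OF Cb] by (simp add: propositions_def vN_algebra_def)
qed

end

section \<open>Isotropy groups and commutativity\<close>

context groupoid
begin

lemma isotropy_group_simps [simp]:
  "carrier (isotropy_group G x) = isotropy x"
  "mult (isotropy_group G x) = comp_arr G"
  "one (isotropy_group G x) = unit_arr G x"
  by (simp_all add: isotropy_group_def isotropy_def)

lemma group_isotropy_group:
  assumes "x \<in> objs G" shows "group (isotropy_group G x)"
proof (rule groupI)
  fix \<alpha> assume "\<alpha> \<in> carrier (isotropy_group G x)"
  then have a: "\<alpha> \<in> arrs G" "src G \<alpha> = x" "tgt G \<alpha> = x" by (auto simp: isotropy_def)
  show "\<one>\<^bsub>isotropy_group G x\<^esub> \<otimes>\<^bsub>isotropy_group G x\<^esub> \<alpha> = \<alpha>"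
    using comp_unit_left[OF a(1)] a by simp
  show "\<exists>\<beta>\<in>carrier (isotropy_group G x). \<beta> \<otimes>\<^bsub>isotropy_group G x\<^esub> \<alpha> = \<one>\<^bsub>isotropy_group G x\<^esub>"
    by (rule bexI[of _ "inv_arr G \<alpha>"])
       (use a in \<open>auto simp: isotropy_def comp_inv_left inv_in src_inv tgt_inv\<close>)
qed (use assms in \<open>auto simp: isotropy_def comp_in src_comp tgt_comp comp_assoc unit_in src_unit tgt_unit\<close>)

lemma isotropy_inv:
  assumes "x \<in> objs G" "\<alpha> \<in> isotropy x"
  shows "inv\<^bsub>isotropy_group G x\<^esub> \<alpha> = inv_arr G \<alpha>"
proof (rule group.inv_equality[OF group_isotropy_group[OF assms(1)]])
  show "inv_arr G \<alpha> \<otimes>\<^bsub>isotropy_group G x\<^esub> \<alpha> = \<one>\<^bsub>isotropy_group G x\<^esub>"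
    using assms by (auto simp: isotropy_def comp_inv_left)
qed (use assms in \<open>auto simp: isotropy_def inv_in src_inv tgt_inv\<close>)

lemma inv_unit: "x \<in> objs G \<Longrightarrow> inv_arr G (unit_arr G x) = unit_arr G x"
  using comp_inv_left[of "unit_arr G x"] comp_unit_right[of "inv_arr G (unit_arr G x)"]
  by (simp add: unit_in src_unit tgt_unit inv_in src_inv)

section \<open>Unit projections and the consequences of centrality\<close>

lemma left_translation_unit:
  assumes "x \<in> objs G" "\<psi> \<in> L2 G"
  shows "left_translation (unit_arr G x) \<psi> \<beta> = (if \<beta> \<in> arrs G \<and> tgt G \<beta> = x then \<psi> \<beta> else 0)"
  using assms comp_unit_left[of \<beta>]
  by (auto simp: left_translation_apply unit_in tgt_unit inv_unit)

lemma left_translation_unit_proposition: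
  assumes "x \<in> objs G"
  shows "left_translation (unit_arr G x) \<in> propositions G"
proof -
  let ?P = "left_translation (unit_arr G x)"
  have u: "unit_arr G x \<in> arrs G" using assms by (rule unit_in)
  have "?P \<circ> ?P = ?P"
  proof (rule bounded_operator_eqI)
    fix \<psi> assume \<psi>: "\<psi> \<in> L2 G"
    have "?P (?P \<psi>) \<beta> = ?P \<psi> \<beta>" for \<beta>
      using left_translation_unit[OF assms left_translation_norm(1)[OF u \<psi>], of \<beta>]
        left_translation_unit[OF assms \<psi>, of \<beta>] by simp
    then show "(?P \<circ> ?P) \<psi> = ?P \<psi>" by (simp add: fun_eq_iff)
  qed (use u in auto)
  then show ?thesis
    using left_translation_vN[OF u] left_translation_adjoint[OF u] assms
    by (simp add: propositions_def inv_unit)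
qed

lemma boolean_imp_central:
  assumes "boolean_propositions G" "P \<in> propositions G" "\<alpha> \<in> arrs G"
  shows "P (left_translation \<alpha> \<psi>) = left_translation \<alpha> (P \<psi>)"
proof -
  have "P \<circ> left_translation \<alpha> = left_translation \<alpha> \<circ> P"
  proof (rule proposition_central[of G])
    show "Q \<circ> R = R \<circ> Q" if "Q \<in> propositions G" "R \<in> propositions G" for Q R
      using boolean_imp_commuting[OF assms(1) that] .
    show "is_adjoint G (left_translation \<alpha>) (left_translation (inv_arr G \<alpha>))"
      by (rule left_translation_adjoint[OF assms(3)])
  qed (use assms left_translation_vN left_translation_norm inv_in in auto)
  then show ?thesis by (simp add: fun_eq_iff)
qed

lemma boolean_imp_totally_disconnected:
  assumes "boolean_propositions G"
  shows "totally_disconnected G"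
  unfolding totally_disconnected_def
proof (rule notI, elim bexE)
  fix \<alpha> assume \<alpha>: "\<alpha> \<in> arrs G" "src G \<alpha> \<noteq> tgt G \<alpha>"
  \<comment> \<open>The projection at the target of \<open>\<alpha>\<close> kills
    \<open>delta u\<close> but fixes its translate \<open>delta \<alpha>\<close>, so it cannot
    commute with the translation.\<close>
  let ?P = "left_translation (unit_arr G (tgt G \<alpha>))"
  define u where "u = unit_arr G (src G \<alpha>)"
  have u: "u \<in> arrs G" "tgt G u = src G \<alpha>" using \<alpha> by (simp_all add: u_def unit_in tgt_unit src_in)
  have x: "tgt G \<alpha> \<in> objs G" using \<alpha> tgt_in by blast
  have "?P (delta u) = 0"
  proof
    show "?P (delta u) \<beta> = 0 \<beta>" for \<beta>
      unfolding left_translation_unit[OF x delta_L2[OF u(1)]] using u \<alpha> by (auto simp: delta_def)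
  qed
  moreover have "left_translation \<alpha> (delta u) = delta \<alpha>"
    using left_translation_delta[OF \<alpha>(1) u(1)] u comp_unit_right[OF \<alpha>(1)] by (simp add: u_def)
  moreover have "?P (delta \<alpha>) \<alpha> = 1"
    unfolding left_translation_unit[OF x delta_L2[OF \<alpha>(1)]] using \<alpha> by (simp add: delta_def)
  moreover have "?P (left_translation \<alpha> (delta u)) = left_translation \<alpha> (?P (delta u))"
    by (rule boolean_imp_central[OF assms left_translation_unit_proposition[OF x] \<alpha>(1)])
  ultimately show False
    using bounded_operator_zero(1)[OF left_translation_bounded[OF \<alpha>(1)]] by simp
qed

text \<open>Commuting the projection with the translation by \<open>b\<close> and evaluating at
  \<open>comp_arr G a b\<close> gives \<open>p a = p d\<close>, where \<open>d\<close> is the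
  conjugate of \<open>a\<close> by \<open>b\<close>. The value \<open>p a\<close> occurs only at
  \<open>a\<close>, hence \<open>d = a\<close>.\<close>

lemma boolean_imp_isotropy_commute:
  assumes bool: "boolean_propositions G" and x: "x \<in> objs G"
    and a: "a \<in> isotropy x" and b: "b \<in> isotropy x"
  shows "comp_arr G a b = comp_arr G b a"
proof -
  have grp: "group (isotropy_group G x)" by (rule group_isotropy_group[OF x])
  obtain p :: "'g \<Rightarrow> complex" where p: "(\<lambda>\<alpha>. (cmod (p \<alpha>))\<^sup>2) summable_on isotropy x"
    "\<And>\<alpha>. \<alpha> \<in> isotropy x \<Longrightarrow> p (inv_arr G \<alpha>) = cnj (p \<alpha>)"
    "\<And>\<eta>. \<eta> \<in> isotropy x \<Longrightarrow> (\<Sum>\<^sub>\<infinity>\<alpha>\<in>isotropy x. cnj (p \<alpha>) * p (comp_arr G \<alpha> \<eta>)) = p \<eta>"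
    "\<And>\<alpha>. p \<alpha> = p a \<Longrightarrow> \<alpha> = a"
    using group.exists_separating_projection[OF grp, of a] a isotropy_inv[OF x] by auto
  let ?q = "conv_kernel x p"
  let ?P = "kernel_op G ?q"
  have P: "?P \<in> propositions G" "\<And>\<gamma>. \<gamma> \<in> arrs G \<Longrightarrow> ?P (delta \<gamma>) = ?q \<gamma>"
    using conv_kernel_proposition[of p x] p(1-3) by blast+
  define u where "u = unit_arr G x"
  have u: "u \<in> arrs G" "src G u = x" "tgt G u = x" using x by (simp_all add: u_def unit_in src_unit tgt_unit)
  have a': "a \<in> arrs G" "src G a = x" "tgt G a = x" and b': "b \<in> arrs G" "src G b = x" "tgt G b = x"
    using a b by (auto simp: isotropy_def)
  have ab: "comp_arr G a b \<in> arrs G" "src G (comp_arr G a b) = x" "tgt G (comp_arr G a b) = x"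
    using a' b' by (simp_all add: comp_in src_comp tgt_comp)
  have bu: "comp_arr G b u = b" using comp_unit_right[OF b'(1)] b' by (simp add: u_def)
  define d where "d = comp_arr G (inv_arr G b) (comp_arr G a b)"
  have d: "d \<in> isotropy x" using left_div[OF b'(1) ab(1)] ab b' by (simp add: d_def isotropy_def)
  have "?P (left_translation b (delta u)) = left_translation b (?P (delta u))"
    by (rule boolean_imp_central[OF bool P(1) b'(1)])
  then have "?q b = left_translation b (?q u)"
    using left_translation_delta[OF b'(1) u(1)] b' u P(2)[OF b'(1)] P(2)[OF u(1)] bu by simp
  then have "?q b (comp_arr G a b) = ?q u d"
    using left_translation_apply[OF b'(1) conv_kernel_L2[OF p(1)], of u "comp_arr G a b"] ab b'
    by (simp add: d_def)
  moreover have "?q b (comp_arr G a b) = p a" by (rule conv_kernel_comp[OF b'(1) b'(3) a])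
  moreover have "?q u d = p d"
  proof -
    have "comp_arr G d u = d" using d comp_unit_right[of d] by (auto simp: isotropy_def u_def)
    then show ?thesis using conv_kernel_comp[OF u(1,3) d, of p] by simp
  qed
  ultimately have "d = a" using p(4) by simp
  then show ?thesis using inv_comp_cancel(1)[OF b'(1) ab(1)] ab b' by (simp add: d_def)
qed

section \<open>Commutativity of the algebra of transitions and its double commutant\<close>

lemma left_translation_commute:
  assumes disc: "totally_disconnected G"
    and comm: "\<And>x \<alpha> \<beta>. x \<in> objs G \<Longrightarrow> \<alpha> \<in> isotropy x \<Longrightarrow> \<beta> \<in> isotropy x \<Longrightarrow>
      comp_arr G \<alpha> \<beta> = comp_arr G \<beta> \<alpha>"
    and \<alpha>: "\<alpha> \<in> arrs G" and \<gamma>: "\<gamma> \<in> arrs G" and \<psi>: "\<psi> \<in> L2 G"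
  shows "left_translation \<alpha> (left_translation \<gamma> \<psi>) \<beta> = left_translation \<gamma> (left_translation \<alpha> \<psi>) \<beta>"
proof (cases "\<beta> \<in> arrs G \<and> tgt G \<alpha> = tgt G \<beta> \<and> tgt G \<gamma> = tgt G \<beta>")
  case True
  have s: "src G \<alpha> = tgt G \<alpha>" "src G \<gamma> = tgt G \<gamma>"
    using disc \<alpha> \<gamma> by (auto simp: totally_disconnected_def)
  let ?a = "inv_arr G \<alpha>" and ?c = "inv_arr G \<gamma>"
  have i: "?a \<in> arrs G" "?c \<in> arrs G" "src G ?a = tgt G \<beta>" "src G ?c = tgt G \<beta>"
    "tgt G ?a = tgt G \<beta>" "tgt G ?c = tgt G \<beta>"
    using \<alpha> \<gamma> s True by (auto simp: inv_in src_inv tgt_inv)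
  have "comp_arr G ?c (comp_arr G ?a \<beta>) = comp_arr G (comp_arr G ?c ?a) \<beta>"
    using i True by (simp add: comp_assoc)
  also have "comp_arr G ?c ?a = comp_arr G ?a ?c"
    using True i by (intro comm[of "tgt G \<beta>"]) (auto simp: isotropy_def tgt_in)
  also have "comp_arr G (comp_arr G ?a ?c) \<beta> = comp_arr G ?a (comp_arr G ?c \<beta>)"
    using i True by (simp add: comp_assoc)
  finally have eq: "comp_arr G ?c (comp_arr G ?a \<beta>) = comp_arr G ?a (comp_arr G ?c \<beta>)" .
  show ?thesis
    using True s left_div[OF \<alpha>, of \<beta>] left_div[OF \<gamma>, of \<beta>] eq
    by (simp add: left_translation_apply[OF \<alpha>] left_translation_apply[OF \<gamma>] \<psi>
        left_translation_norm[OF \<alpha>] left_translation_norm[OF \<gamma>])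
next
  \<comment> \<open>Without transitions between different outcomes, a translation neither leaves the
    set of arrows with its own target nor reads any other, so both sides vanish.\<close>
  case False
  have s: "src G \<alpha> = tgt G \<alpha>" "src G \<gamma> = tgt G \<gamma>"
    using disc \<alpha> \<gamma> by (auto simp: totally_disconnected_def)
  show ?thesis
    using False s left_div[OF \<alpha>, of \<beta>] left_div[OF \<gamma>, of \<beta>]
    by (auto simp: left_translation_apply[OF \<alpha>] left_translation_apply[OF \<gamma>] \<psi>
        left_translation_norm[OF \<alpha>] left_translation_norm[OF \<gamma>])
qed

lemma left_regular_commute:
  assumes comm: "\<And>\<alpha> \<gamma> \<psi> \<beta>. \<alpha> \<in> arrs G \<Longrightarrow> \<gamma> \<in> arrs G \<Longrightarrow> \<psi> \<in> L2 G \<Longrightarrow>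
      left_translation \<alpha> (left_translation \<gamma> \<psi>) \<beta> = left_translation \<gamma> (left_translation \<alpha> \<psi>) \<beta>"
    and A: "A \<in> groupoid_algebra G" and B: "B \<in> groupoid_algebra G"
  shows "left_regular G A \<circ> left_regular G B = left_regular G B \<circ> left_regular G A"
proof (rule bounded_operator_eqI)
  have sub: "\<alpha> \<in> arrs G" if "A' \<in> groupoid_algebra G" "A' \<alpha> \<noteq> 0" for A' \<alpha>
    using that by (auto simp: groupoid_algebra_def)
  have step: "left_translation \<alpha> (left_regular G A' \<psi>) \<beta>
      = (\<Sum>\<gamma> | A' \<gamma> \<noteq> 0. A' \<gamma> * left_translation \<alpha> (left_translation \<gamma> \<psi>) \<beta>)"
    if A': "A' \<in> groupoid_algebra G" and \<alpha>: "\<alpha> \<in> arrs G" and \<psi>: "\<psi> \<in> L2 G" for A' \<alpha> \<psi> \<beta>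
  proof -
    have in2: "left_regular G A' \<psi> \<in> L2 G" using left_regular_bounded[OF A'] \<psi> by blast
    note appl = left_translation_apply[OF \<alpha> left_translation_norm(1)[OF sub[OF A'] \<psi>]]
      left_translation_apply[OF \<alpha> in2]
    show ?thesis
    proof (cases "\<beta> \<in> arrs G \<and> tgt G \<beta> = tgt G \<alpha>")
      case True
      then show ?thesis by (simp add: appl left_regular_sum[OF A' \<psi>])
    next
      case False
      then have "left_translation \<alpha> (left_translation \<gamma> \<psi>) \<beta> = 0" if "A' \<gamma> \<noteq> 0" for \<gamma>
        unfolding appl(1)[OF that] by (rule if_not_P)
      moreover have "left_translation \<alpha> (left_regular G A' \<psi>) \<beta> = 0"
        unfolding appl(2) using False by (rule if_not_P)
      ultimately show ?thesis by (simp add: sum.neutral)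
    qed
  qed
  fix \<psi> assume \<psi>: "\<psi> \<in> L2 G"
  have expand: "left_regular G A1 (left_regular G A2 \<psi>) \<beta>
    = (\<Sum>\<alpha> | A1 \<alpha> \<noteq> 0. \<Sum>\<gamma> | A2 \<gamma> \<noteq> 0. A1 \<alpha> * A2 \<gamma> * left_translation \<alpha> (left_translation \<gamma> \<psi>) \<beta>)"
    if A12: "A1 \<in> groupoid_algebra G" "A2 \<in> groupoid_algebra G" for A1 A2 \<beta>
  proof -
    have in2: "left_regular G A2 \<psi> \<in> L2 G" using left_regular_bounded[OF A12(2)] \<psi> by blast
    show ?thesis unfolding left_regular_sum[OF A12(1) in2]
      by (intro sum.cong refl) (simp add: step[OF A12(2) sub[OF A12(1)] \<psi>] sum_distrib_left mult.assoc)
  qed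
  have "left_regular G A (left_regular G B \<psi>) \<beta> = left_regular G B (left_regular G A \<psi>) \<beta>" for \<beta>
    unfolding expand[OF A B] expand[OF B A]
    by (subst sum.swap, intro sum.cong refl)
       (simp add: comm[OF sub[OF A] sub[OF B] \<psi>] mult.commute)
  then show "(left_regular G A \<circ> left_regular G B) \<psi> = (left_regular G B \<circ> left_regular G A) \<psi>"
    by (simp add: fun_eq_iff)
qed (use A B left_regular_bounded in auto)

text \<open>A commuting family lies in its commutant. Taking commutants reverses this inclusion, so
  the double commutant lies in the commutant, all of whose members commute with the double
  commutant.\<close>

lemma abelian_bicommutant:
  assumes "\<And>A B. A \<in> N \<Longrightarrow> B \<in> N \<Longrightarrow> A \<circ> B = B \<circ> A" "N \<subseteq> bounded_operators G"
  shows "abelian_algebra (commutant G (commutant G N))"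
  unfolding abelian_algebra_def
proof (intro ballI)
  fix A B assume AB: "A \<in> commutant G (commutant G N)" "B \<in> commutant G (commutant G N)"
  have "N \<subseteq> commutant G N" using assms by (auto intro: commutantI)
  then have "B \<in> commutant G N" using AB(2) unfolding commutant_def by blast
  then show "A \<circ> B = B \<circ> A" using AB(1) unfolding commutant_def by blast
qed

lemma abelian_imp_boolean:
  assumes "abelian_algebra (vN_algebra G)"
  shows "boolean_propositions G"
  using assms propositionD(1) by (intro commuting_imp_boolean) (auto simp: abelian_algebra_def)

lemma boolean_iff:
  "boolean_propositions G \<longleftrightarrow> totally_disconnected G \<and>
    (\<forall>x \<in> objs G. comm_group (isotropy_group G x)) \<and> abelian_algebra (vN_algebra G)"
proof
  assume bool: "boolean_propositions G"
  note disc = boolean_imp_totally_disconnected[OF bool]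
    and comm = boolean_imp_isotropy_commute[OF bool]
  have "comm_group (isotropy_group G x)" if x: "x \<in> objs G" for x
    by (rule group.group_comm_groupI[OF group_isotropy_group[OF x]]) (use comm[OF x] in simp)
  moreover have "abelian_algebra (vN_algebra G)"
    unfolding vN_algebra_def
  proof (rule abelian_bicommutant)
    show "left_regular G ` groupoid_algebra G \<subseteq> bounded_operators G"
      using left_regular_bounded by blast
    have "left_regular G A \<circ> left_regular G B = left_regular G B \<circ> left_regular G A"
      if "A \<in> groupoid_algebra G" "B \<in> groupoid_algebra G" for A B
      by (rule left_regular_commute[OF _ that], rule left_translation_commute[OF disc])
         (auto intro: comm)
    then show "S \<circ> T = T \<circ> S"
      if "S \<in> left_regular G ` groupoid_algebra G" "T \<in> left_regular G ` groupoid_algebra G" for S T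
      using that by blast
  qed
  ultimately show "totally_disconnected G \<and> (\<forall>x \<in> objs G. comm_group (isotropy_group G x)) \<and>
    abelian_algebra (vN_algebra G)" using disc by blast
qed (use abelian_imp_boolean in blast)

end

theorem theorem1:
  fixes G :: "('o, 'g) groupoid"
  assumes "discrete_countable_groupoid G"
  shows "boolean_propositions G \<longleftrightarrow>
    totally_disconnected G \<and>
    (\<forall>x \<in> objs G. comm_group (isotropy_group G x)) \<and>
    abelian_algebra (vN_algebra G)"
  using assms groupoid.boolean_iff unfolding discrete_countable_groupoid_def by blast

end
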